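(* Let $N\ge 3$ and $1<q<2<p<\infty$. Let $V:\mathbb R^N\to\mathbb R$ be a continuous function such that there is a constant $V_0>0$ with $V_0\le V(x)$ for all $x\in\mathbb R^N$, and such that $1/V\in L^1(\mathbb R^N)$. Then there exists $\Lambda_0>0$ such that for each $\lambda\in(0,\Lambda_0)$ the problem $$-\Delta u+V(x)u=|u|^{p-2}u+\lambda|u|^{q-2}u\quad\text{in }\mathbb R^N,\qquad u\in H^1(\mathbb R^N),\quad \int_{\mathbb R^N}V(x)|u|^2\,dx<\infty,$$ has infinitely many distinct nontrivial (weak) solutions $u$ with negative energy, $\mathcal I(u)<0$.
   Context: Let $E_V=\{u\in H^1(\mathbb R^N):\int_{\mathbb R^N}V(x)|u|^2\,dx<\infty\}$ with norm $\|u\|_{E_V}=\left(\int_{\mathbb R^N}|\nabla u|^2\,dx+\int_{\mathbb R^N}V(x)|u|^2\,dx\right)^{1/2}$, and let $\mathcal V=E_V\cap L^p(\mathbb R^N)$ with norm $\|u\|=\|u\|_{E_V}+\|u\|_{L^p(\mathbb R^N)}$. No upper bound is imposed on $p$. A (weak) solution is a function $u\in\mathcal V$ such that $\int_{\mathbb R^N}\nabla u\cdot\nabla\eta\,dx+\int_{\mathbb R^N}V(x)u\eta\,dx=\int_{\mathbb R^N}(|u|^{p-2}u+\lambda|u|^{q-2}u)\eta\,dx$ for all $\eta\in\mathcal V$. The energy of $u\in\mathcal V$ is $$\mathcal I(u)=\frac12\int_{\mathbb R^N}|\nabla u|^2\,dx+\frac12\int_{\mathbb R^N}V(x)|u|^2\,dx-\frac1p\int_{\mathbb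 R^N}|u|^p\,dx-\frac{\lambda}{q}\int_{\mathbb R^N}|u|^q\,dx .$$ *)

theory Defs
  imports "HOL-Analysis.Analysis"
begin

text \<open>
  Functions on Euclidean space are Borel representatives, and integrals are taken with respect to
  \<open>lborel\<close>. Every Lebesgue measurable function agrees almost everywhere with a Borel function, so
  this yields the usual spaces once functions that agree almost everywhere are identified.
  The identification is made explicitly, by \<open>ae_eq\<close>, wherever functions are counted.
\<close>

primrec Ck :: "nat \<Rightarrow> ('a::euclidean_space \<Rightarrow> real) \<Rightarrow> bool" where
  "Ck 0 f \<longleftrightarrow> continuous_on UNIV f"
| "Ck (Suc k) f \<longleftrightarrow>
     (\<forall>x. f differentiable (at x)) \<and>
     (\<forall>i\<in>Basis. Ck k (\<lambda>x. frechet_derivative f (at x) i))"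

definition test_fun :: "('a::euclidean_space \<Rightarrow> real) \<Rightarrow> bool" where
  "test_fun \<phi> \<longleftrightarrow> (\<forall>k. Ck k \<phi>) \<and> compact (closure {x. \<phi> x \<noteq> 0})"

definition locally_integrable :: "('a::euclidean_space \<Rightarrow> 'b::euclidean_space) \<Rightarrow> bool" where
  "locally_integrable f \<longleftrightarrow>
     f \<in> borel_measurable lborel \<and> (\<forall>K. compact K \<longrightarrow> set_integrable lborel K f)"

definition has_weak_gradient ::
    "('a::euclidean_space \<Rightarrow> real) \<Rightarrow> ('a \<Rightarrow> 'a) \<Rightarrow> bool" where
  "has_weak_gradient u g \<longleftrightarrow>
     locally_integrable u \<and> locally_integrable g \<and>
     (\<forall>\<phi>. test_fun \<phi> \<longrightarrow> (\<forall>i\<in>Basis.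
        (LINT x|lborel. u x * frechet_derivative \<phi> (at x) i)
          = - (LINT x|lborel. (g x \<bullet> i) * \<phi> x)))"

text \<open>
  A weak gradient is unique up to null sets, so the choice below does not affect integrals.
  The value is arbitrary when \<open>u\<close> has no weak gradient.
\<close>

definition weak_grad :: "('a::euclidean_space \<Rightarrow> real) \<Rightarrow> 'a \<Rightarrow> 'a" where
  "weak_grad u = (SOME g. has_weak_gradient u g)"

definition Lp :: "real \<Rightarrow> ('a::euclidean_space \<Rightarrow> real) set" where
  "Lp p = {u \<in> borel_measurable lborel. integrable lborel (\<lambda>x. \<bar>u x\<bar> powr p)}"

definition H1 :: "('a::euclidean_space \<Rightarrow> real) set" where
  "H1 = {u \<in> Lp 2. \<exists>g. has_weak_gradient u g \<and> integrable lborel (\<lambda>x. (norm (g x))\<^sup>2)}"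

definition E_space :: "('a::euclidean_space \<Rightarrow> real) \<Rightarrow> ('a \<Rightarrow> real) set" where
  "E_space V = {u \<in> H1. integrable lborel (\<lambda>x. V x * \<bar>u x\<bar>\<^sup>2)}"

definition V_space :: "('a::euclidean_space \<Rightarrow> real) \<Rightarrow> real \<Rightarrow> ('a \<Rightarrow> real) set" where
  "V_space V p = E_space V \<inter> Lp p"

text \<open>
  Where \<open>u x = 0\<close>, the factor \<open>\<bar>u x\<bar> powr (q - 2) * u x\<close> is \<open>0\<close>, which is the usual
  convention also for \<open>1 < q < 2\<close>.
\<close>

definition weak_solution ::
    "('a::euclidean_space \<Rightarrow> real) \<Rightarrow> real \<Rightarrow> real \<Rightarrow> real \<Rightarrow> ('a \<Rightarrow> real) \<Rightarrow> bool" where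
  "weak_solution V p q lam u \<longleftrightarrow>
     u \<in> V_space V p \<and>
     (\<forall>\<eta>\<in>V_space V p.
        (LINT x|lborel. weak_grad u x \<bullet> weak_grad \<eta> x) + (LINT x|lborel. V x * u x * \<eta> x)
          = (LINT x|lborel. (\<bar>u x\<bar> powr (p - 2) * u x + lam * (\<bar>u x\<bar> powr (q - 2) * u x)) * \<eta> x))"

definition energy ::
    "('a::euclidean_space \<Rightarrow> real) \<Rightarrow> real \<Rightarrow> real \<Rightarrow> real \<Rightarrow> ('a \<Rightarrow> real) \<Rightarrow> real" where
  "energy V p q lam u =
     1 / 2 * (LINT x|lborel. (norm (weak_grad u x))\<^sup>2)
     + 1 / 2 * (LINT x|lborel. V x * \<bar>u x\<bar>\<^sup>2)
     - 1 / p * (LINT x|lborel. \<bar>u x\<bar> powr p)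
     - lam / q * (LINT x|lborel. \<bar>u x\<bar> powr q)"

definition ae_eq :: "(('a::euclidean_space \<Rightarrow> real) \<times> ('a \<Rightarrow> real)) set" where
  "ae_eq = {(u, v). u \<in> borel_measurable lborel \<and> v \<in> borel_measurable lborel
                    \<and> (AE x in lborel. u x = v x)}"

lemma equiv_ae_eq: "equiv (borel_measurable lborel) ae_eq"
proof (rule equivI)
  show "ae_eq \<subseteq> borel_measurable lborel \<times> borel_measurable lborel"
    by (auto simp: ae_eq_def)
  show "refl_on (borel_measurable lborel) ae_eq"
    by (auto simp: refl_on_def ae_eq_def)
  show "sym ae_eq"
    by (auto simp: sym_def ae_eq_def elim: eventually_mono)
  show "trans ae_eq"
    unfolding trans_def ae_eq_def by (auto elim: eventually_elim2)
qed

end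

theory Submission
  imports Defs "HOL-Library.Z2" "HOL-Library.Diagonal_Subsequence"
begin

text \<open>
  The nonlinearity is truncated, so that the exponent \<open>p\<close> no longer matters, and the truncated
  problem is solved by a Clark-type argument; a maximum principle then shows that its solutions
  never feel the truncation.

  \<^bold>\<open>Truncation.\<close> Fix \<open>\<delta>\<close> with \<open>\<delta> powr (p - 1) = (V0 / 4) * \<delta>\<close>; for small \<open>\<lambda>\<close> the right hand side
  \<open>f\<close> satisfies \<open>f \<delta> < V0 * \<delta>\<close>. Freezing \<open>f\<close> outside \<open>[-\<delta>, \<delta>]\<close> gives a bounded, odd, continuous and
  nondecreasing function with a convex primitive \<open>F\<close>. If \<open>u\<close> solves the truncated equation, then
  testing with \<open>exp (- 1 / (u - \<delta>))\<close> on \<open>{u > \<delta>}\<close>, extended by \<open>0\<close>, forces \<open>u \<le> \<delta>\<close>, because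
  \<open>V u - f u > 0\<close> where \<open>u > \<delta>\<close> (\<open>fixed_point_le\<close>). By oddness \<open>\<bar>u\<bar> \<le> \<delta>\<close>, and \<open>u\<close> solves the
  original equation with the same energy.

  \<^bold>\<open>Variational structure.\<close> A function \<open>u\<close> with weak gradient \<open>g\<close> is encoded as the element
  \<open>(sqrt V * u, g)\<close> of an \<open>L\<^sup>2\<close> space, in which the energy space is a closed subspace \<open>S\<close>. The
  truncated energy is \<open>J x = (norm x)\<^sup>2 / 2 - \<Phi> x\<close> with \<open>\<Phi>\<close> convex and even, and solutions are the fixed
  points of \<open>T = grad \<Phi>\<close> on \<open>S\<close>. Convexity of \<open>\<Phi>\<close> gives
  \<open>J (T x) \<le> J x - (norm (T x - x))\<^sup>2 / 2\<close> (\<open>descent\<close>), so that iterating \<open>T\<close> replaces the gradient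
  flow. Since \<open>f\<close> is bounded and \<open>1 / V\<close> is integrable, \<open>norm (T x - T y)\<close> is at most the norm of
  \<open>f u - f v\<close> in \<open>L\<^sup>2\<close> of the finite measure \<open>dx / V\<close>; hence convergence almost everywhere of the functions
  suffices for norm convergence of their images, and Rellich's theorem (\<open>rellich\<close>) makes
  \<open>T\<close> compact, although \<open>p\<close> may be supercritical.

  \<^bold>\<open>Multiplicity.\<close> Suppose that \<open>T\<close> has only finitely many fixed points with \<open>J < 0\<close>, so that their levels
  lie below some \<open>- \<epsilon> < 0\<close>. By compactness there are finitely many vectors \<open>z\<^sub>1, \<dots>, z\<^sub>m\<close> such that
  \<open>J > - \<epsilon>\<close> on the part of \<open>{J \<le> 0}\<close> orthogonal to all of them. As \<open>q < 2\<close>, combinations of \<open>m + 1\<close> small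
  bumps with disjoint supports span an \<open>m\<close>-dimensional sphere on which \<open>J < 0\<close>
  (\<open>negative_cross_polytopes\<close>), and the Palais--Smale property shows that an iterate of \<open>T\<close> pushes
  this sphere, oddly and continuously, into \<open>{J \<le> - \<epsilon>}\<close>. By the Borsuk--Ulam theorem some point of
  the image is orthogonal to \<open>z\<^sub>1, \<dots>, z\<^sub>m\<close>, a contradiction
  (\<open>infinitely_many_negative_fixed_points\<close>).

  The Borsuk--Ulam theorem is proved by evaluating a cup product of sign changes on iterated
  barycentric subdivisions of hemispheres of a cross-polytope. The calculus of weak gradients
  rests on the identity \<open>u (x + y) - u x = \<integral>\<^sub>0\<^sup>1 g (x + s y) \<bullet> y ds\<close> for almost every \<open>x\<close>
  (\<open>weak_gradient_FTC\<close>), which characterises weak gradients by difference quotients and yields the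
  chain rule as well as the compactness estimate.
\<close>

section \<open>Ordered chains modulo two and the Borsuk--Ulam theorem\<close>

text \<open>
  Without these two rules the simplifier keeps sums and products of bits in ring form.
\<close>

declare add_bit_eq_xor [simp del] mult_bit_eq_and [simp del]

lemma bit_double [simp]: "(a::bit) + a = 0" "(a::bit) + (a + b) = b"
  by (cases a; cases b; simp add: add_bit_eq_xor)+

lemma bit_eq_add: "(a::bit) + b = 0 \<longleftrightarrow> a = b"
  by (cases a; cases b; simp add: add_bit_eq_xor)

fun faces :: "'a list \<Rightarrow> 'a list list" where
  "faces [] = []"
| "faces (x # xs) = xs # map ((#) x) (faces xs)"

text \<open>
  A chain modulo two is represented by a list of ordered simplices. Chains are compared only
  through the sums of cochains over them, so that repeated simplices cancel without any quotient.
\<close>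

definition chain_sum :: "('a list \<Rightarrow> bit) \<Rightarrow> 'a list list \<Rightarrow> bit" where
  "chain_sum \<alpha> c = (\<Sum>\<sigma>\<leftarrow>c. \<alpha> \<sigma>)"

definition coboundary :: "('a list \<Rightarrow> bit) \<Rightarrow> 'a list \<Rightarrow> bit" where
  "coboundary \<alpha> \<sigma> = chain_sum \<alpha> (faces \<sigma>)"

lemma chain_sum_simps [simp]:
  "chain_sum \<alpha> [] = 0"
  "chain_sum \<alpha> (\<sigma> # c) = \<alpha> \<sigma> + chain_sum \<alpha> c"
  "chain_sum \<alpha> (c @ d) = chain_sum \<alpha> c + chain_sum \<alpha> d"
  "chain_sum \<alpha> (map f c) = chain_sum (\<lambda>\<sigma>. \<alpha> (f \<sigma>)) c"
  by (simp_all add: chain_sum_def o_def)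

lemma chain_sum_add: "chain_sum (\<lambda>\<sigma>. \<alpha> \<sigma> + \<beta> \<sigma>) c = chain_sum \<alpha> c + chain_sum \<beta> c"
  by (induction c) (simp_all add: algebra_simps)

lemma chain_sum_mult: "chain_sum (\<lambda>\<sigma>. k * \<alpha> \<sigma>) c = k * chain_sum \<alpha> c"
  by (induction c) (simp_all add: algebra_simps)

lemma chain_sum_cong: "(\<And>\<sigma>. \<sigma> \<in> set c \<Longrightarrow> \<alpha> \<sigma> = \<beta> \<sigma>) \<Longrightarrow> chain_sum \<alpha> c = chain_sum \<beta> c"
  by (induction c) simp_all

lemma chain_sum_concat: "chain_sum \<alpha> (concat (map f c)) = chain_sum (\<lambda>\<sigma>. chain_sum \<alpha> (f \<sigma>)) c"
  by (induction c) simp_all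

lemma length_faces: "\<tau> \<in> set (faces \<sigma>) \<Longrightarrow> Suc (length \<tau>) = length \<sigma>"
  by (induction \<sigma> arbitrary: \<tau>) auto

lemma set_faces: "\<tau> \<in> set (faces \<sigma>) \<Longrightarrow> set \<tau> \<subseteq> set \<sigma>"
  by (induction \<sigma> arbitrary: \<tau>) (auto, blast)

lemma faces_map: "faces (map f \<sigma>) = map (map f) (faces \<sigma>)"
  by (induction \<sigma>) simp_all

lemma coboundary_Cons:
  "coboundary \<alpha> (x # xs) = \<alpha> xs + coboundary (\<lambda>\<tau>. \<alpha> (x # \<tau>)) xs"
  by (simp add: coboundary_def)

lemma coboundary_coboundary: "coboundary (coboundary \<alpha>) \<sigma> = 0"
proof (induction \<sigma> arbitrary: \<alpha>)
  case Nil
  then show ?case by (simp add: coboundary_def)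
next
  case (Cons x xs)
  have "coboundary (coboundary \<alpha>) (x # xs)
      = coboundary \<alpha> xs + coboundary (\<lambda>\<tau>. \<alpha> \<tau> + coboundary (\<lambda>\<rho>. \<alpha> (x # \<rho>)) \<tau>) xs"
    by (simp add: coboundary_Cons)
  also have "\<dots> = coboundary \<alpha> xs + (coboundary \<alpha> xs + coboundary (coboundary (\<lambda>\<rho>. \<alpha> (x # \<rho>))) xs)"
    by (simp add: coboundary_def[abs_def] chain_sum_add)
  also have "\<dots> = 0"
    using Cons.IH by simp
  finally show ?case .
qed

subsection \<open>Barycentric subdivision\<close>

definition barycenter :: "'a::real_vector list \<Rightarrow> 'a" where
  "barycenter \<sigma> = (1 / real (length \<sigma>)) *\<^sub>R sum_list \<sigma>"

function subdivide :: "'a::real_vector list \<Rightarrow> 'a list list" where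
  "subdivide \<sigma> = (if \<sigma> = [] then [[]]
     else map ((#) (barycenter \<sigma>)) (concat (map subdivide (faces \<sigma>))))"
  by auto
termination
  by (relation "Wellfounded.measure length") (auto dest: length_faces)

declare subdivide.simps [simp del]

lemma subdivide_Nil [simp]: "subdivide [] = [[]]"
  by (simp add: subdivide.simps)

lemma subdivide_nonempty:
  "\<sigma> \<noteq> [] \<Longrightarrow> subdivide \<sigma> = map ((#) (barycenter \<sigma>)) (concat (map subdivide (faces \<sigma>)))"
  by (simp add: subdivide.simps)

lemma chain_sum_subdivide:
  "\<sigma> \<noteq> [] \<Longrightarrow> chain_sum \<alpha> (subdivide \<sigma>)
     = coboundary (\<lambda>\<pi>. chain_sum (\<lambda>\<tau>. \<alpha> (barycenter \<sigma> # \<tau>)) (subdivide \<pi>)) \<sigma>"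
  by (simp add: subdivide_nonempty chain_sum_concat coboundary_def)

text \<open>
  The boundary of a cone is its base plus the cone over the boundary of the base. Subdividing
  \<open>\<sigma>\<close> means coning the subdivided boundary, so the first part is the subdivision of the boundary;
  the second part is, by induction, a cone over the subdivision of a boundary of a boundary.
\<close>

lemma coboundary_subdivide:
  "chain_sum (coboundary \<alpha>) (subdivide \<sigma>) = coboundary (\<lambda>\<pi>. chain_sum \<alpha> (subdivide \<pi>)) \<sigma>"
proof (induction "length \<sigma>" arbitrary: \<alpha> \<sigma> rule: less_induct)
  case less
  show ?case
  proof (cases "\<sigma> = []")
    case True
    then show ?thesis by (simp add: coboundary_def)
  next
    case False
    let ?b = "barycenter \<sigma>"
    have "chain_sum (coboundary \<alpha>) (subdivide \<sigma>)
        = coboundary (\<lambda>\<pi>. chain_sum (\<lambda>\<tau>. \<alpha> \<tau> + coboundary (\<lambda>\<rho>. \<alpha> (?b # \<rho>)) \<tau>) (subdivide \<pi>)) \<sigma>"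
      using False by (simp add: chain_sum_subdivide coboundary_Cons)
    also have "\<dots> = coboundary (\<lambda>\<pi>. chain_sum \<alpha> (subdivide \<pi>)) \<sigma>
        + coboundary (\<lambda>\<pi>. chain_sum (coboundary (\<lambda>\<rho>. \<alpha> (?b # \<rho>))) (subdivide \<pi>)) \<sigma>"
      by (simp add: chain_sum_add coboundary_def[abs_def])
    also have "coboundary (\<lambda>\<pi>. chain_sum (coboundary (\<lambda>\<rho>. \<alpha> (?b # \<rho>))) (subdivide \<pi>)) \<sigma>
        = coboundary (coboundary (\<lambda>\<pi>. chain_sum (\<lambda>\<rho>. \<alpha> (?b # \<rho>)) (subdivide \<pi>))) \<sigma>"
      unfolding coboundary_def [of _ \<sigma>]
      by (rule chain_sum_cong) (metis less lessI length_faces)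
    also have "\<dots> = 0"
      by (rule coboundary_coboundary)
    finally show ?thesis by simp
  qed
qed

lemma barycenter_uminus: "barycenter (map uminus \<sigma>) = - barycenter \<sigma>"
proof -
  have "sum_list (map uminus \<sigma>) = - sum_list \<sigma>"
    by (induction \<sigma>) simp_all
  then show ?thesis by (simp add: barycenter_def)
qed

lemma subdivide_uminus: "subdivide (map uminus \<sigma>) = map (map uminus) (subdivide \<sigma>)"
proof (induction "length \<sigma>" arbitrary: \<sigma> rule: less_induct)
  case less
  show ?case
  proof (cases "\<sigma> = []")
    case False
    have *: "map (\<lambda>\<pi>. subdivide (map uminus \<pi>)) (faces \<sigma>) = map (\<lambda>\<pi>. map (map uminus) (subdivide \<pi>)) (faces \<sigma>)"
      by (rule map_cong) (metis less lessI length_faces)+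
    have "subdivide (map uminus \<sigma>)
        = map ((#) (- barycenter \<sigma>)) (concat (map (\<lambda>\<pi>. subdivide (map uminus \<pi>)) (faces \<sigma>)))"
      using False by (simp add: subdivide_nonempty faces_map barycenter_uminus o_def)
    also have "\<dots> = map (map uminus) (subdivide \<sigma>)"
      unfolding * using False by (simp add: subdivide_nonempty map_concat o_def)
    finally show ?thesis .
  qed simp
qed

lemma length_subdivide: "\<tau> \<in> set (subdivide \<sigma>) \<Longrightarrow> length \<tau> = length \<sigma>"
proof (induction "length \<sigma>" arbitrary: \<sigma> \<tau> rule: less_induct)
  case less
  show ?case
  proof (cases "\<sigma> = []")
    case True
    then show ?thesis using less.prems by simp
  next
    case False
    then obtain \<pi> \<rho> where "\<pi> \<in> set (faces \<sigma>)" "\<rho> \<in> set (subdivide \<pi>)" "\<tau> = barycenter \<sigma> # \<rho>"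
      using less.prems by (auto simp: subdivide_nonempty)
    then show ?thesis
      using less.hyps[of \<pi> \<rho>] length_faces[of \<pi> \<sigma>] by simp
  qed
qed

lemma barycenter_in_hull:
  assumes "\<sigma> \<noteq> []"
  shows "barycenter \<sigma> \<in> convex hull (set \<sigma>)"
proof -
  have "sum_list \<sigma> = (\<Sum>i<length \<sigma>. \<sigma> ! i)"
    by (simp add: sum_list_sum_nth atLeast0LessThan)
  then have "barycenter \<sigma> = (\<Sum>i<length \<sigma>. (1 / real (length \<sigma>)) *\<^sub>R (\<sigma> ! i))"
    by (simp add: barycenter_def scaleR_sum_right)
  also have "\<dots> \<in> convex hull (set \<sigma>)"
    using assms by (intro convex_sum) (auto simp: hull_inc)
  finally show ?thesis .
qed

lemma subdivide_in_hull:
  "\<tau> \<in> set (subdivide \<sigma>) \<Longrightarrow> set \<tau> \<subseteq> convex hull (set \<sigma>)"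
proof (induction "length \<sigma>" arbitrary: \<sigma> \<tau> rule: less_induct)
  case less
  show ?case
  proof (cases "\<sigma> = []")
    case True
    then show ?thesis using less.prems by simp
  next
    case False
    then obtain \<pi> \<rho> where \<pi>: "\<pi> \<in> set (faces \<sigma>)" "\<rho> \<in> set (subdivide \<pi>)" "\<tau> = barycenter \<sigma> # \<rho>"
      using less.prems by (auto simp: subdivide_nonempty)
    have "set \<rho> \<subseteq> convex hull (set \<pi>)"
      using less.hyps[of \<pi> \<rho>] length_faces[of \<pi> \<sigma>] \<pi> by simp
    also have "\<dots> \<subseteq> convex hull (set \<sigma>)"
      by (rule hull_mono) (rule set_faces[OF \<pi>(1)])
    finally show ?thesis
      using \<pi> barycenter_in_hull[OF False] by simp
  qed
qed

text \<open>
  The barycenter is the mean of the vertices, and a vertex is at distance \<open>0\<close> from itself: this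
  is where the factor \<open>(n - 1) / n\<close> comes from. It passes to the convex hull by convexity of balls.
\<close>

lemma dist_barycenter_le:
  fixes \<sigma> :: "'a::real_normed_vector list"
  assumes "\<And>x y. x \<in> set \<sigma> \<Longrightarrow> y \<in> set \<sigma> \<Longrightarrow> norm (x - y) \<le> d" "z \<in> convex hull (set \<sigma>)" "\<sigma> \<noteq> []"
  shows "norm (z - barycenter \<sigma>) \<le> (1 - 1 / real (length \<sigma>)) * d"
proof -
  let ?n = "length \<sigma>"
  have vert: "norm (x - barycenter \<sigma>) \<le> (1 - 1 / real ?n) * d" if "x \<in> set \<sigma>" for x
  proof -
    obtain j where j: "j < ?n" "\<sigma> ! j = x"
      using \<open>x \<in> set \<sigma>\<close> by (auto simp: in_set_conv_nth)
    have "sum_list \<sigma> = (\<Sum>i<?n. \<sigma> ! i)"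
      by (simp add: sum_list_sum_nth atLeast0LessThan)
    then have "x - barycenter \<sigma> = (1 / real ?n) *\<^sub>R (\<Sum>i<?n. x - \<sigma> ! i)"
      using assms(3) by (simp add: barycenter_def sum_subtractf scaleR_diff_right sum_constant_scaleR)
    also have "(\<Sum>i<?n. x - \<sigma> ! i) = (\<Sum>i\<in>{..<?n} - {j}. x - \<sigma> ! i)"
      using j by (subst sum.remove[of _ j]) auto
    finally have "norm (x - barycenter \<sigma>) \<le> (1 / real ?n) * norm (\<Sum>i\<in>{..<?n} - {j}. x - \<sigma> ! i)"
      by simp
    also have "norm (\<Sum>i\<in>{..<?n} - {j}. x - \<sigma> ! i) \<le> (\<Sum>i\<in>{..<?n} - {j}. d)"
      by (rule order_trans[OF norm_sum sum_mono]) (use assms(1) that in auto)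
    also have "\<dots> = (real ?n - 1) * d"
      using j assms(3) by (simp add: of_nat_diff Suc_le_eq)
    finally have "norm (x - barycenter \<sigma>) \<le> (1 / real ?n) * ((real ?n - 1) * d)"
      by (simp add: mult_left_mono divide_right_mono)
    then show ?thesis using assms(3) by (simp add: field_simps)
  qed
  then have "set \<sigma> \<subseteq> cball (barycenter \<sigma>) ((1 - 1 / real ?n) * d)"
    by (auto simp: dist_norm norm_minus_commute)
  then have "convex hull (set \<sigma>) \<subseteq> cball (barycenter \<sigma>) ((1 - 1 / real ?n) * d)"
    by (rule hull_minimal) simp
  then show ?thesis
    using assms(2) by (auto simp: dist_norm norm_minus_commute)
qed

text \<open>
  Two vertices of a subdivided simplex either include the barycenter, or both lie in the
  subdivision of a proper face, for which the contraction factor is even smaller.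
\<close>

lemma subdivide_shrinks:
  fixes \<sigma> :: "'a::real_normed_vector list"
  assumes "\<tau> \<in> set (subdivide \<sigma>)" "\<And>x y. x \<in> set \<sigma> \<Longrightarrow> y \<in> set \<sigma> \<Longrightarrow> norm (x - y) \<le> d"
    and "x \<in> set \<tau>" "y \<in> set \<tau>" "d \<ge> 0"
  shows "norm (x - y) \<le> (1 - 1 / real (length \<sigma>)) * d"
  using assms
proof (induction "length \<sigma>" arbitrary: \<sigma> \<tau> x y rule: less_induct)
  case less
  show ?case
  proof (cases "\<sigma> = []")
    case True
    then show ?thesis using less.prems by simp
  next
    case False
    then obtain \<pi> \<rho> where \<pi>: "\<pi> \<in> set (faces \<sigma>)" "\<rho> \<in> set (subdivide \<pi>)" "\<tau> = barycenter \<sigma> # \<rho>"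
      using less.prems by (auto simp: subdivide_nonempty)
    have bary: "norm (z - barycenter \<sigma>) \<le> (1 - 1 / real (length \<sigma>)) * d" if "z \<in> set \<tau>" for z
      using dist_barycenter_le[of \<sigma> d z] less.prems(2) subdivide_in_hull[OF less.prems(1)] that False
      by auto
    consider "x = barycenter \<sigma>" | "y = barycenter \<sigma>" | "x \<in> set \<rho>" "y \<in> set \<rho>"
      using less.prems \<pi> by auto
    then show ?thesis
    proof cases
      case 1
      then show ?thesis using bary[OF less.prems(4)] by (simp add: norm_minus_commute)
    next
      case 2
      then show ?thesis using bary[OF less.prems(3)] by simp
    next
      case 3
      then have ne: "\<pi> \<noteq> []" using \<pi> by auto
      have "norm (x - y) \<le> (1 - 1 / real (length \<pi>)) * d"
        using less.hyps[of \<pi> \<rho> x y] 3 \<pi> length_faces[OF \<pi>(1)] set_faces[OF \<pi>(1)] less.prems(2,5) by auto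
      also have "\<dots> \<le> (1 - 1 / real (length \<sigma>)) * d"
        using length_faces[OF \<pi>(1)] ne less.prems(5)
        by (intro mult_right_mono) (auto simp: frac_le)
      finally show ?thesis .
    qed
  qed
qed

definition refine :: "nat \<Rightarrow> 'a::real_vector list list \<Rightarrow> 'a list list" where
  "refine k = ((\<lambda>c. concat (map subdivide c)) ^^ k)"

lemma refine_Suc: "refine (Suc k) c = concat (map subdivide (refine k c))"
  by (simp add: refine_def)

lemma chain_sum_refine_Suc:
  "chain_sum \<alpha> (refine (Suc k) c) = chain_sum (\<lambda>\<sigma>. chain_sum \<alpha> (subdivide \<sigma>)) (refine k c)"
  by (simp add: refine_Suc chain_sum_concat)

lemma refine_properties:
  fixes c :: "'a::real_normed_vector list list"
  assumes "\<And>\<sigma>. \<sigma> \<in> set c \<Longrightarrow> length \<sigma> = n \<and> set \<sigma> \<subseteq> cball 0 r \<and> convex hull (set \<sigma>) \<subseteq> K"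
    and "\<tau> \<in> set (refine k c)" "r \<ge> 0" "n > 0"
  shows "length \<tau> = n \<and> convex hull (set \<tau>) \<subseteq> K
    \<and> (\<forall>x\<in>set \<tau>. \<forall>y\<in>set \<tau>. norm (x - y) \<le> (1 - 1 / real n) ^ k * (2 * r))"
  using assms(2)
proof (induction k arbitrary: \<tau>)
  case 0
  have "norm (x - y) \<le> 2 * r" if "x \<in> set \<tau>" "y \<in> set \<tau>" for x y
  proof -
    have "norm x \<le> r" "norm y \<le> r"
      using assms(1)[of \<tau>] 0 that by (auto simp: refine_def)
    then show ?thesis using norm_triangle_ineq4[of x y] by linarith
  qed
  then show ?case using assms(1)[of \<tau>] 0 by (auto simp: refine_def)
next
  case (Suc k)
  then obtain \<sigma> where \<sigma>: "\<sigma> \<in> set (refine k c)" "\<tau> \<in> set (subdivide \<sigma>)"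
    by (auto simp: refine_Suc)
  note IH = Suc.IH[OF \<sigma>(1)]
  have hull: "convex hull (set \<tau>) \<subseteq> convex hull (set \<sigma>)"
    using subdivide_in_hull[OF \<sigma>(2)] by (simp add: hull_minimal)
  have nn: "(1 - 1 / real n) ^ k * (2 * r) \<ge> 0"
    using assms(3,4) by simp
  have "norm (x - y) \<le> (1 - 1 / real n) * ((1 - 1 / real n) ^ k * (2 * r))"
    if "x \<in> set \<tau>" "y \<in> set \<tau>" for x y
    using subdivide_shrinks[OF \<sigma>(2) _ that nn] IH by auto
  then show ?case
    using length_subdivide[OF \<sigma>(2)] IH hull by (auto simp: mult.assoc)
qed

subsection \<open>Hemispheres of the cross-polytope\<close>

abbreviation antipode :: "'a::real_vector list list \<Rightarrow> 'a list list" where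
  "antipode \<equiv> map (map uminus)"

text \<open>
  Coning an equator (a hemisphere and its antipode) from the next vertex gives the
  triangulated upper hemispheres of the boundary of a cross-polytope with vertices \<open>\<plusminus> e i\<close>.
\<close>

fun hemisphere :: "(nat \<Rightarrow> 'a::real_vector) \<Rightarrow> nat \<Rightarrow> 'a list list" where
  "hemisphere e 0 = [[e 0]]"
| "hemisphere e (Suc i) = map ((#) (e (Suc i))) (hemisphere e i @ antipode (hemisphere e i))"

lemma coboundary_uminus:
  "coboundary (\<lambda>\<tau>. \<alpha> (map uminus \<tau>)) \<sigma> = coboundary \<alpha> (map uminus \<sigma>)"
  by (simp add: coboundary_def faces_map)

text \<open>
  The boundary of a cone over the equator is the equator plus the cone over its boundary; the
  latter vanishes, as by induction the boundary of a hemisphere is invariant under the antipode.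
\<close>

lemma chain_sum_hemisphere:
  fixes \<alpha> :: "'a::real_vector list \<Rightarrow> bit"
  shows "chain_sum (coboundary \<alpha>) (hemisphere e (Suc i))
    = chain_sum \<alpha> (hemisphere e i @ antipode (hemisphere e i))"
proof (induction i arbitrary: \<alpha>)
  case 0
  show ?case by (simp add: coboundary_def)
next
  case (Suc i)
  let ?h = "hemisphere e (Suc i)"
  let ?\<beta> = "\<lambda>\<tau>. \<alpha> (e (Suc (Suc i)) # \<tau>)"
  have "chain_sum (coboundary \<alpha>) (hemisphere e (Suc (Suc i)))
      = chain_sum \<alpha> (?h @ antipode ?h)
        + (chain_sum (coboundary ?\<beta>) ?h + chain_sum (\<lambda>\<sigma>. coboundary ?\<beta> (map uminus \<sigma>)) ?h)"
    unfolding hemisphere.simps(2)[of e "Suc i"] chain_sum_simps(3,4)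
    by (simp add: coboundary_Cons chain_sum_add algebra_simps del: hemisphere.simps)
  also have "(\<lambda>\<sigma>. coboundary ?\<beta> (map uminus \<sigma>)) = coboundary (\<lambda>\<tau>. ?\<beta> (map uminus \<tau>))"
    by (rule ext) (rule coboundary_uminus[of ?\<beta>, symmetric])
  finally show ?case
    unfolding Suc.IH by (simp add: o_def algebra_simps del: hemisphere.simps)
qed

lemma chain_sum_refine_hemisphere:
  fixes \<alpha> :: "'a::real_vector list \<Rightarrow> bit"
  shows "chain_sum (coboundary \<alpha>) (refine k (hemisphere e (Suc i)))
    = chain_sum (\<lambda>\<sigma>. \<alpha> \<sigma> + \<alpha> (map uminus \<sigma>)) (refine k (hemisphere e i))"
proof (induction k arbitrary: \<alpha>)
  case 0
  show ?case
    using chain_sum_hemisphere[of \<alpha> e i] by (simp add: refine_def chain_sum_add o_def del: hemisphere.simps)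
next
  case (Suc k)
  show ?case
    by (simp add: chain_sum_refine_Suc coboundary_subdivide Suc.IH chain_sum_add subdivide_uminus
        del: hemisphere.simps)
qed

lemma hemisphere_vertices:
  assumes "\<sigma> \<in> set (hemisphere e i)"
  shows "length \<sigma> = Suc i" "\<exists>s. \<sigma> = map (\<lambda>j. s j *\<^sub>R e j) (rev [0..<Suc i]) \<and> (\<forall>j. \<bar>s j\<bar> = (1::real))"
proof -
  have "length \<sigma> = Suc i \<and> (\<exists>s. \<sigma> = map (\<lambda>j. s j *\<^sub>R e j) (rev [0..<Suc i]) \<and> (\<forall>j. \<bar>s j\<bar> = (1::real)))"
    using assms
  proof (induction i arbitrary: \<sigma>)
    case 0
    then show ?case by (auto intro!: exI[of _ "\<lambda>_. 1"])
  next
    case (Suc i)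
    then obtain \<tau> t where \<tau>: "\<tau> \<in> set (hemisphere e i)" "\<bar>t\<bar> = (1::real)"
      "\<sigma> = e (Suc i) # map (\<lambda>x. t *\<^sub>R x) \<tau>"
    proof -
      assume *: "\<And>\<tau> t. \<tau> \<in> set (hemisphere e i) \<Longrightarrow> \<bar>t\<bar> = 1
        \<Longrightarrow> \<sigma> = e (Suc i) # map ((*\<^sub>R) t) \<tau> \<Longrightarrow> thesis"
      consider \<tau> where "\<tau> \<in> set (hemisphere e i)" "\<sigma> = e (Suc i) # \<tau>"
        | \<tau> where "\<tau> \<in> set (hemisphere e i)" "\<sigma> = e (Suc i) # map uminus \<tau>"
        using Suc.prems by auto
      then show thesis
      proof cases
        case (1 \<tau>)
        then show thesis using *[of \<tau> 1] by (simp add: map_idI)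
      next
        case (2 \<tau>)
        then show thesis using *[of \<tau> "-1"] by simp
      qed
    qed
    obtain s where s: "length \<tau> = Suc i" "\<tau> = map (\<lambda>j. s j *\<^sub>R e j) (rev [0..<Suc i])" "\<forall>j. \<bar>s j\<bar> = (1::real)"
      using Suc.IH[OF \<tau>(1)] by auto
    let ?s = "(\<lambda>j. t * s j)(Suc i := 1)"
    have "\<sigma> = map (\<lambda>j. ?s j *\<^sub>R e j) (rev [0..<Suc (Suc i)])"
      unfolding \<tau>(3) s(2) by simp
    moreover have "\<forall>j. \<bar>?s j\<bar> = 1"
      using s(3) \<tau>(2) by (simp add: abs_mult)
    ultimately show ?case
      using s(1) \<tau>(3) by (intro conjI exI[of _ ?s]) auto
  qed
  then show "length \<sigma> = Suc i" "\<exists>s. \<sigma> = map (\<lambda>j. s j *\<^sub>R e j) (rev [0..<Suc i]) \<and> (\<forall>j. \<bar>s j\<bar> = (1::real))"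
    by auto
qed

subsection \<open>Cup products of sign changes\<close>

text \<open>
  This cochain is the cup product of the coboundaries of the \<open>0\<close>-cochains in the list: it is \<open>1\<close> on
  \<open>[x\<^sub>0, \<dots>, x\<^sub>m]\<close> if, for every \<open>j\<close>, the \<open>j\<close>-th sign differs at \<open>x\<^sub>j\<^sub>-\<^sub>1\<close> and \<open>x\<^sub>j\<close>.
\<close>

fun sign_changes :: "('a \<Rightarrow> bit) list \<Rightarrow> 'a list \<Rightarrow> bit" where
  "sign_changes [] \<sigma> = of_bool (length \<sigma> = 1)"
| "sign_changes (\<epsilon> # \<epsilon>s) (x # y # \<sigma>) = (\<epsilon> x + \<epsilon> y) * sign_changes \<epsilon>s (y # \<sigma>)"
| "sign_changes (\<epsilon> # \<epsilon>s) _ = 0"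

text \<open>
  Omitting the coboundary from the first factor gives a primitive of the product.
\<close>

definition leading_sign :: "('a \<Rightarrow> bit) \<Rightarrow> ('a \<Rightarrow> bit) list \<Rightarrow> 'a list \<Rightarrow> bit" where
  "leading_sign \<epsilon> \<epsilon>s \<sigma> = (case \<sigma> of [] \<Rightarrow> 0 | x # _ \<Rightarrow> \<epsilon> x * sign_changes \<epsilon>s \<sigma>)"

lemma sign_changes_length: "length \<sigma> \<noteq> Suc (length \<epsilon>s) \<Longrightarrow> sign_changes \<epsilon>s \<sigma> = 0"
  by (induction \<epsilon>s \<sigma> rule: sign_changes.induct) auto

lemma coboundary_leading_sign_aux:
  assumes "\<And>\<tau>. coboundary (sign_changes \<epsilon>s) \<tau> = 0" "\<sigma> \<noteq> [] \<or> \<epsilon>s \<noteq> []"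
  shows "coboundary (leading_sign \<epsilon> \<epsilon>s) \<sigma> = sign_changes (\<epsilon> # \<epsilon>s) \<sigma>"
proof -
  consider "\<sigma> = []" | x where "\<sigma> = [x]" | x y vs where "\<sigma> = x # y # vs"
    by (metis list.exhaust)
  then show ?thesis
  proof cases
    case 3
    have c: "coboundary (\<lambda>\<tau>. sign_changes \<epsilon>s (x # \<tau>)) (y # vs) = sign_changes \<epsilon>s (y # vs)"
      using assms(1)[of "x # y # vs"] by (simp add: coboundary_Cons[of _ x] bit_eq_add)
    have "coboundary (leading_sign \<epsilon> \<epsilon>s) \<sigma>
       = \<epsilon> y * sign_changes \<epsilon>s (y # vs) + \<epsilon> x * coboundary (\<lambda>\<tau>. sign_changes \<epsilon>s (x # \<tau>)) (y # vs)"
      unfolding 3 coboundary_Cons[of _ x]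
      by (simp add: leading_sign_def coboundary_def chain_sum_mult del: sign_changes.simps faces.simps)
    then show ?thesis
      unfolding c 3 by (simp add: algebra_simps)
  qed (auto simp: coboundary_def leading_sign_def)
qed

lemma coboundary_sign_changes: "coboundary (sign_changes \<epsilon>s) \<sigma> = 0"
proof (induction \<epsilon>s arbitrary: \<sigma>)
  case Nil
  consider "\<sigma> = []" | x where "\<sigma> = [x]" | x y where "\<sigma> = [x, y]" | "length \<sigma> > 2"
    by (metis length_Cons list.exhaust length_greater_0_conv Suc_less_eq numeral_2_eq_2)
  then show ?case
  proof cases
    case 4
    have "chain_sum (sign_changes []) (faces \<sigma>) = chain_sum (\<lambda>_. 0) (faces \<sigma>)"
      by (rule chain_sum_cong) (use 4 length_faces in force)
    also have "\<dots> = 0" by (simp add: chain_sum_def)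
    finally show ?thesis unfolding coboundary_def .
  qed (auto simp: coboundary_def)
next
  case (Cons \<epsilon> \<epsilon>s)
  have "sign_changes (\<epsilon> # \<epsilon>s) = coboundary (leading_sign \<epsilon> \<epsilon>s)"
  proof
    fix \<sigma> show "sign_changes (\<epsilon> # \<epsilon>s) \<sigma> = coboundary (leading_sign \<epsilon> \<epsilon>s) \<sigma>"
      using coboundary_leading_sign_aux[of \<epsilon>s \<sigma> \<epsilon>] Cons.IH
      by (cases \<sigma>) (auto simp: coboundary_def)
  qed
  then show ?case by (simp add: coboundary_coboundary)
qed

lemma coboundary_leading_sign:
  "coboundary (leading_sign \<epsilon> \<epsilon>s) \<sigma> = sign_changes (\<epsilon> # \<epsilon>s) \<sigma>"
  using coboundary_leading_sign_aux[of \<epsilon>s \<sigma> \<epsilon>] coboundary_sign_changes[of \<epsilon>s]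
  by (cases \<sigma>) (auto simp: coboundary_def)

lemma sign_changes_uminus:
  assumes "\<And>\<epsilon> x. \<epsilon> \<in> set \<epsilon>s \<Longrightarrow> x \<in> set \<sigma> \<Longrightarrow> \<epsilon> (- x) = \<epsilon> x + 1"
  shows "sign_changes \<epsilon>s (map uminus \<sigma>) = sign_changes \<epsilon>s \<sigma>"
  using assms
proof (induction \<epsilon>s \<sigma> rule: sign_changes.induct)
  case (2 \<epsilon> \<epsilon>s x y \<sigma>)
  have "\<epsilon> (- x) + \<epsilon> (- y) = \<epsilon> x + \<epsilon> y"
    using "2.prems"[of \<epsilon> x] "2.prems"[of \<epsilon> y] by (simp add: algebra_simps)
  then show ?case using 2 by simp
qed auto

text \<open>
  The product is the coboundary of \<open>leading_sign\<close>, so its value on a hemisphere is the value of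
  \<open>leading_sign\<close> on the equator. There the two antipodal halves differ exactly by the flip of the
  leading sign and leave the product of the remaining signs on a hemisphere of one dimension
  less. The recursion ends with the number of vertices of a point, which is \<open>1\<close>.
\<close>

theorem refined_hemisphere_sign_changes:
  fixes e :: "nat \<Rightarrow> 'a::real_vector"
  assumes "\<And>\<epsilon> x. \<epsilon> \<in> set \<epsilon>s \<Longrightarrow> x \<in> K \<Longrightarrow> \<epsilon> (- x) = \<epsilon> x + 1"
    and "\<And>i \<sigma>. i \<le> length \<epsilon>s \<Longrightarrow> \<sigma> \<in> set (refine k (hemisphere e i)) \<Longrightarrow> length \<sigma> = Suc i \<and> set \<sigma> \<subseteq> K"
  shows "chain_sum (sign_changes \<epsilon>s) (refine k (hemisphere e (length \<epsilon>s))) = 1"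
  using assms
proof (induction \<epsilon>s)
  case Nil
  have "chain_sum (\<lambda>\<sigma>. of_bool (length \<sigma> = 1)) (refine k [[e 0]]) = 1"
  proof (induction k)
    case (Suc k)
    have "chain_sum (\<lambda>\<tau>. of_bool (length \<tau> = 1)) (subdivide \<sigma>) = of_bool (length \<sigma> = 1)"
      if "\<sigma> \<in> set (refine k [[e 0]])" for \<sigma> :: "'a list"
    proof (cases "length \<sigma> = 1")
      case True
      then obtain x where "\<sigma> = [x]" by (metis One_nat_def length_0_conv length_Suc_conv)
      then show ?thesis by (simp add: subdivide_nonempty)
    next
      case False
      have "chain_sum (\<lambda>\<tau>. of_bool (length \<tau> = 1)) (subdivide \<sigma>) = chain_sum (\<lambda>_. 0) (subdivide \<sigma>)"
        by (rule chain_sum_cong) (use False length_subdivide in force)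
      also have "\<dots> = 0" by (simp add: chain_sum_def)
      finally show ?thesis using False by simp
    qed
    then show ?case
      using Suc unfolding chain_sum_refine_Suc by (metis (mono_tags, lifting) chain_sum_cong)
  qed (simp add: refine_def)
  then show ?case by simp
next
  case (Cons \<epsilon> \<epsilon>s)
  let ?n = "length \<epsilon>s"
  have "chain_sum (sign_changes (\<epsilon> # \<epsilon>s)) (refine k (hemisphere e (Suc ?n)))
      = chain_sum (coboundary (leading_sign \<epsilon> \<epsilon>s)) (refine k (hemisphere e (Suc ?n)))"
    by (simp add: coboundary_leading_sign[abs_def] del: hemisphere.simps)
  also have "\<dots> = chain_sum (\<lambda>\<sigma>. leading_sign \<epsilon> \<epsilon>s \<sigma> + leading_sign \<epsilon> \<epsilon>s (map uminus \<sigma>)) (refine k (hemisphere e ?n))"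
    by (rule chain_sum_refine_hemisphere)
  also have "\<dots> = chain_sum (sign_changes \<epsilon>s) (refine k (hemisphere e ?n))"
  proof (rule chain_sum_cong)
    fix \<sigma> assume "\<sigma> \<in> set (refine k (hemisphere e ?n))"
    then have \<sigma>: "length \<sigma> = Suc ?n" "set \<sigma> \<subseteq> K"
      using Cons.prems(2)[of ?n \<sigma>] by auto
    then obtain x vs where xs: "\<sigma> = x # vs" by (cases \<sigma>) auto
    have "sign_changes \<epsilon>s (map uminus \<sigma>) = sign_changes \<epsilon>s \<sigma>"
      by (rule sign_changes_uminus) (use Cons.prems(1) \<sigma> in auto)
    moreover have "\<epsilon> (- x) = \<epsilon> x + 1"
      using Cons.prems(1) \<sigma> xs by auto
    ultimately show "leading_sign \<epsilon> \<epsilon>s \<sigma> + leading_sign \<epsilon> \<epsilon>s (map uminus \<sigma>) = sign_changes \<epsilon>s \<sigma>"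
      by (simp add: leading_sign_def xs algebra_simps)
  qed
  also have "\<dots> = 1"
  proof (rule Cons.IH)
    show "\<epsilon>' (- x) = \<epsilon>' x + 1" if "\<epsilon>' \<in> set \<epsilon>s" "x \<in> K" for \<epsilon>' x
      using Cons.prems(1)[of \<epsilon>' x] that by simp
    show "length \<sigma> = Suc i \<and> set \<sigma> \<subseteq> K" if "i \<le> length \<epsilon>s" "\<sigma> \<in> set (refine k (hemisphere e i))" for i \<sigma>
      using Cons.prems(2)[of i \<sigma>] that by simp
  qed
  finally show ?case by simp
qed

lemma sign_changes_consecutive:
  assumes "sign_changes \<epsilon>s \<sigma> \<noteq> 0" "j < length \<epsilon>s"
  shows "length \<sigma> = Suc (length \<epsilon>s) \<and> (\<epsilon>s ! j) (\<sigma> ! j) \<noteq> (\<epsilon>s ! j) (\<sigma> ! Suc j)"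
  using assms
proof (induction \<epsilon>s \<sigma> arbitrary: j rule: sign_changes.induct)
  case (2 \<epsilon> \<epsilon>s x y \<sigma>)
  have len: "length (y # \<sigma>) = Suc (length \<epsilon>s)"
    using 2 sign_changes_length by fastforce
  have "\<epsilon> x \<noteq> \<epsilon> y" using 2 by auto
  then show ?case
    using 2 len by (cases j) auto
qed auto


subsection \<open>The Borsuk--Ulam theorem on cross-polytopes\<close>

definition cross_polytope :: "(nat \<Rightarrow> 'a::real_vector) \<Rightarrow> nat \<Rightarrow> 'a set" where
  "cross_polytope e m = {\<Sum>i\<le>m. a i *\<^sub>R e i | a. (\<Sum>i\<le>m. \<bar>a i\<bar>) = (1::real)}"

lemma compact_cross_polytope:
  fixes e :: "nat \<Rightarrow> 'a::real_normed_vector"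
  shows "compact (cross_polytope e m)"
proof -
  let ?A = "(\<Pi>\<^sub>E i\<in>UNIV. {-1..1}) :: (nat \<Rightarrow> real) set"
  let ?B = "{a. (\<Sum>i\<le>m. \<bar>a i\<bar>) = (1::real)} :: (nat \<Rightarrow> real) set"
  have coord: "continuous_on UNIV (\<lambda>a::nat \<Rightarrow> real. a i)" for i
    by (rule continuous_on_product_coordinates)
  have "compactin (product_topology (\<lambda>_. euclidean) UNIV) ?A"
    unfolding compactin_PiE by auto
  then have "compact ?A"
    by (simp add: euclidean_product_topology)
  moreover have "closed ?B"
    by (intro closed_Collect_eq continuous_intros coord)
  ultimately have "compact (?A \<inter> ?B)"
    by (rule compact_Int_closed)
  moreover have "continuous_on (?A \<inter> ?B) (\<lambda>a. \<Sum>i\<le>m. a i *\<^sub>R e i)"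
    by (intro continuous_intros continuous_on_subset[OF coord]) auto
  ultimately have "compact ((\<lambda>a. \<Sum>i\<le>m. a i *\<^sub>R e i) ` (?A \<inter> ?B))"
    by (intro compact_continuous_image)
  also have "(\<lambda>a. \<Sum>i\<le>m. a i *\<^sub>R e i) ` (?A \<inter> ?B) = cross_polytope e m"
  proof
    show "cross_polytope e m \<subseteq> (\<lambda>a. \<Sum>i\<le>m. a i *\<^sub>R e i) ` (?A \<inter> ?B)"
    proof
      fix x assume "x \<in> cross_polytope e m"
      then obtain a where a: "(\<Sum>i\<le>m. \<bar>a i\<bar>) = 1" "x = (\<Sum>i\<le>m. a i *\<^sub>R e i)"
        by (auto simp: cross_polytope_def)
      define b where "b i = (if i \<le> m then a i else 0)" for i
      have "\<bar>b i\<bar> \<le> 1" for i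
        using member_le_sum[of i "{..m}" "\<lambda>i. \<bar>a i\<bar>"] a(1) by (auto simp: b_def)
      then have "b \<in> ?A \<inter> ?B"
      proof -
        have "(\<Sum>i\<le>m. \<bar>b i\<bar>) = (\<Sum>i\<le>m. \<bar>a i\<bar>)"
          by (rule sum.cong) (auto simp: b_def)
        then show ?thesis
          using a(1) \<open>\<And>i. \<bar>b i\<bar> \<le> 1\<close> by (auto simp: abs_le_iff minus_le_iff)
      qed
      moreover have "x = (\<Sum>i\<le>m. b i *\<^sub>R e i)"
        unfolding a(2) by (rule sum.cong) (auto simp: b_def)
      ultimately show "x \<in> (\<lambda>a. \<Sum>i\<le>m. a i *\<^sub>R e i) ` (?A \<inter> ?B)"
        by blast
    qed
  qed (auto simp: cross_polytope_def)
  finally show ?thesis .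
qed

lemma hemisphere_subset_cross_polytope:
  assumes "\<sigma> \<in> set (hemisphere e i)" "i \<le> m"
  shows "convex hull (set \<sigma>) \<subseteq> cross_polytope e m"
proof -
  obtain s where s: "\<sigma> = map (\<lambda>j. s j *\<^sub>R e j) (rev [0..<Suc i])" "\<forall>j. \<bar>s j\<bar> = (1::real)"
    using hemisphere_vertices(2)[OF assms(1)] by blast
  define C where "C = {\<Sum>j\<le>m. (a j * s j) *\<^sub>R e j | a. (\<forall>j\<le>m. 0 \<le> a j) \<and> (\<Sum>j\<le>m. a j) = (1::real)}"
  have "set \<sigma> \<subseteq> C"
  proof
    fix x assume "x \<in> set \<sigma>"
    then obtain j where j: "j \<le> m" "x = s j *\<^sub>R e j"
    proof -
      obtain j where "j \<in> set (rev [0..<Suc i])" "x = s j *\<^sub>R e j"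
        using \<open>x \<in> set \<sigma>\<close> unfolding s(1) by (auto simp del: upt_Suc)
      then show thesis using that[of j] assms(2) by auto
    qed
    have "x = (\<Sum>l\<le>m. ((if l = j then 1 else 0) * s l) *\<^sub>R e l)"
    proof -
      have "(\<Sum>l\<le>m. ((if l = j then 1 else 0) * s l) *\<^sub>R e l) = (\<Sum>l\<le>m. if l = j then s j *\<^sub>R e j else 0)"
        by (rule sum.cong) auto
      then show ?thesis using j by simp
    qed
    moreover have "(\<Sum>l\<le>m. if l = j then 1 else 0) = (1::real)"
      using j by simp
    ultimately show "x \<in> C"
      unfolding C_def by (auto intro!: exI[of _ "\<lambda>l. if l = j then 1 else 0"])
  qed
  moreover have "convex C"
  proof (rule convexI)
    fix x y :: 'a and u v :: real
    assume "x \<in> C" "y \<in> C" and uv: "0 \<le> u" "0 \<le> v" "u + v = 1"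
    then obtain a b where a: "\<forall>j\<le>m. 0 \<le> a j" "(\<Sum>j\<le>m. a j) = 1" "x = (\<Sum>j\<le>m. (a j * s j) *\<^sub>R e j)"
      and b: "\<forall>j\<le>m. 0 \<le> b j" "(\<Sum>j\<le>m. b j) = 1" "y = (\<Sum>j\<le>m. (b j * s j) *\<^sub>R e j)"
      unfolding C_def by blast
    have "u *\<^sub>R x + v *\<^sub>R y = (\<Sum>j\<le>m. ((u * a j + v * b j) * s j) *\<^sub>R e j)"
      unfolding a(3) b(3) by (simp add: scaleR_sum_right flip: sum.distrib) (simp add: algebra_simps)
    moreover have "(\<Sum>j\<le>m. u * a j + v * b j) = 1"
      using a(2) b(2) uv by (simp add: sum.distrib flip: sum_distrib_left)
    ultimately show "u *\<^sub>R x + v *\<^sub>R y \<in> C"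
      unfolding C_def using a(1) b(1) uv by (auto intro!: exI[of _ "\<lambda>j. u * a j + v * b j"])
  qed
  ultimately have "convex hull (set \<sigma>) \<subseteq> C"
    by (rule hull_minimal)
  also have "C \<subseteq> cross_polytope e m"
  proof
    fix x assume "x \<in> C"
    then obtain a where a: "\<forall>j\<le>m. 0 \<le> a j" "(\<Sum>j\<le>m. a j) = 1" "x = (\<Sum>j\<le>m. (a j * s j) *\<^sub>R e j)"
      unfolding C_def by blast
    have "(\<Sum>j\<le>m. \<bar>a j * s j\<bar>) = (\<Sum>j\<le>m. a j)"
      by (rule sum.cong) (use a(1) s(2) in \<open>auto simp: abs_mult\<close>)
    then show "x \<in> cross_polytope e m"
      unfolding cross_polytope_def using a by (auto intro!: exI[of _ "\<lambda>j. a j * s j"])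
  qed
  finally show ?thesis .
qed

text \<open>
  Where \<open>f\<close> vanishes, one of the two points \<open>x\<close>, \<open>- x\<close> is selected by choice, so that antipodal points
  always get different signs.
\<close>

definition odd_sign :: "('a::real_vector \<Rightarrow> real) \<Rightarrow> 'a \<Rightarrow> bit" where
  "odd_sign f x = (if f x \<noteq> 0 then of_bool (f x > 0) else of_bool (x = (SOME y. y \<in> {x, - x})))"

lemma odd_sign_uminus:
  assumes "f (- x) = - f x" "x \<noteq> 0"
  shows "odd_sign f (- x) = odd_sign f x + 1"
proof (cases "f x = 0")
  case False
  then show ?thesis using assms(1) by (auto simp: odd_sign_def)
next
  case True
  let ?y = "SOME y. y \<in> {x, - x}"
  have "?y \<in> {x, - x}"
    by (rule someI[of _ x]) simp
  moreover have "x \<noteq> - x"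
    using assms(2) by (metis double_zero_sym scaleR_2 scaleR_eq_0_iff add.right_inverse zero_neq_numeral)
  moreover have "{- x, - (- x)} = {x, - x}"
    by auto
  ultimately show ?thesis
    using True assms(1) by (auto simp: odd_sign_def)
qed

text \<open>
  If the functions had no common zero, then \<open>0\<close> would not lie on the sphere and \<open>\<Sum> \<bar>f j x\<bar>\<close> would be
  bounded below. A fine subdivision of the hemisphere contains a simplex along whose vertices
  every \<open>f j\<close> changes sign, hence is small everywhere on that simplex by uniform continuity.
\<close>

theorem borsuk_ulam_cross_polytope:
  fixes e :: "nat \<Rightarrow> 'a::real_normed_vector" and f :: "nat \<Rightarrow> 'a \<Rightarrow> real"
  assumes cont: "\<And>j. j < m \<Longrightarrow> continuous_on (cross_polytope e m) (f j)"
    and odd: "\<And>j x. j < m \<Longrightarrow> x \<in> cross_polytope e m \<Longrightarrow> f j (- x) = - f j x"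
  shows "\<exists>x\<in>cross_polytope e m. \<forall>j<m. f j x = 0"
proof (rule ccontr)
  assume neg: "\<not> ?thesis"
  let ?K = "cross_polytope e m"
  define F where "F x = (\<Sum>j<m. \<bar>f j x\<bar>)" for x
  have nz: "0 \<notin> ?K"
    using neg odd[of _ 0] by fastforce
  have "?K \<noteq> {}"
  proof -
    have "convex hull set [e 0] \<subseteq> ?K"
      by (rule hemisphere_subset_cross_polytope[of _ e 0]) auto
    then show ?thesis by auto
  qed
  moreover have "continuous_on ?K F"
    unfolding F_def by (intro continuous_intros cont) auto
  ultimately obtain x0 where x0: "x0 \<in> ?K" "\<And>x. x \<in> ?K \<Longrightarrow> F x0 \<le> F x"
    using continuous_attains_inf[OF compact_cross_polytope] by metis
  have "F x0 > 0"
  proof -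
    obtain j where "j < m" "f j x0 \<noteq> 0" using neg x0(1) by auto
    then have "0 < \<bar>f j x0\<bar>" "\<bar>f j x0\<bar> \<le> F x0"
      unfolding F_def by (auto intro!: member_le_sum)
    then show ?thesis by linarith
  qed
  \<comment> \<open>A variation of all \<open>f j\<close> below \<open>c\<close> on a simplex gives \<open>F < 2 * c * m < F x0\<close> at its first vertex.\<close>
  define c where "c = F x0 / (2 * real (Suc m))"
  have c: "c > 0" using \<open>F x0 > 0\<close> by (simp add: c_def)
  have "\<exists>d>0. \<forall>j<m. \<forall>x\<in>?K. \<forall>y\<in>?K. dist x y < d \<longrightarrow> \<bar>f j x - f j y\<bar> < c"
  proof -
    have "\<exists>d>0. \<forall>x\<in>?K. \<forall>y\<in>?K. dist x y < d \<longrightarrow> \<bar>f j x - f j y\<bar> < c" if j: "j < m" for j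
    proof -
      obtain d where "d > 0" "\<And>x x'. x \<in> ?K \<Longrightarrow> x' \<in> ?K \<Longrightarrow> dist x' x < d \<Longrightarrow> dist (f j x') (f j x) < c"
        using compact_uniformly_continuous[OF cont[OF j] compact_cross_polytope] c
        by (rule uniformly_continuous_onE) blast
      then show ?thesis
        unfolding dist_real_def by (intro exI[of _ d]) blast
    qed
    then obtain d where d: "\<And>j. j < m \<Longrightarrow> d j > 0 \<and> (\<forall>x\<in>?K. \<forall>y\<in>?K. dist x y < d j \<longrightarrow> \<bar>f j x - f j y\<bar> < c)"
      by metis
    show ?thesis
    proof (intro exI[of _ "Min (insert 1 (d ` {..<m}))"] conjI)
      show "Min (insert 1 (d ` {..<m})) > 0" using d by (subst Min_gr_iff) auto
    qed (use d in auto)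
  qed
  then obtain d where d: "d > 0" "\<And>j x y. j < m \<Longrightarrow> x \<in> ?K \<Longrightarrow> y \<in> ?K \<Longrightarrow> dist x y < d \<Longrightarrow> \<bar>f j x - f j y\<bar> < c"
    by blast
  obtain r where r: "r > 0" "?K \<subseteq> cball 0 r"
  proof -
    obtain r where "r > 0" "\<forall>x\<in>?K. norm x \<le> r"
      using compact_imp_bounded[OF compact_cross_polytope, of e m] unfolding bounded_pos by blast
    then show thesis using that[of r] by (auto simp: subset_iff)
  qed
  have "(\<lambda>k. (1 - 1 / real (Suc m)) ^ k * (2 * r)) \<longlonglongrightarrow> 0 * (2 * r)"
    by (intro tendsto_mult_right LIMSEQ_power_zero) simp
  then have "\<forall>\<^sub>F k in sequentially. (1 - 1 / real (Suc m)) ^ k * (2 * r) < d"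
    using d(1) by (intro order_tendstoD(2)) auto
  then obtain k where k: "(1 - 1 / real (Suc m)) ^ k * (2 * r) < d"
    unfolding eventually_sequentially by blast
  define \<epsilon>s where "\<epsilon>s = map (\<lambda>j. odd_sign (f j)) [0..<m]"
  have props: "length \<tau> = Suc i \<and> convex hull (set \<tau>) \<subseteq> ?K
      \<and> (\<forall>x\<in>set \<tau>. \<forall>y\<in>set \<tau>. norm (x - y) \<le> (1 - 1 / real (Suc i)) ^ k * (2 * r))"
    if "i \<le> m" "\<tau> \<in> set (refine k (hemisphere e i))" for i \<tau>
  proof (rule refine_properties[OF _ that(2)])
    fix \<sigma> assume \<sigma>: "\<sigma> \<in> set (hemisphere e i)"
    have hull: "convex hull (set \<sigma>) \<subseteq> ?K"
      by (rule hemisphere_subset_cross_polytope[OF \<sigma> that(1)])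
    moreover have "set \<sigma> \<subseteq> cball 0 r"
      using hull r(2) hull_subset[of "set \<sigma>" convex] by blast
    ultimately show "length \<sigma> = Suc i \<and> set \<sigma> \<subseteq> cball 0 r \<and> convex hull (set \<sigma>) \<subseteq> ?K"
      using hemisphere_vertices(1)[OF \<sigma>] by simp
  qed (use r in auto)
  have "chain_sum (sign_changes \<epsilon>s) (refine k (hemisphere e (length \<epsilon>s))) = 1"
  proof (rule refined_hemisphere_sign_changes[of \<epsilon>s ?K])
    show "\<epsilon> (- x) = \<epsilon> x + 1" if \<epsilon>: "\<epsilon> \<in> set \<epsilon>s" and x: "x \<in> ?K" for \<epsilon> x
    proof -
      obtain j where j: "j < m" "\<epsilon> = odd_sign (f j)" using \<epsilon> by (auto simp: \<epsilon>s_def)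
      show ?thesis
        unfolding j(2) by (rule odd_sign_uminus) (use odd[OF j(1) x] nz x in auto)
    qed
    show "length \<sigma> = Suc i \<and> set \<sigma> \<subseteq> ?K"
      if "i \<le> length \<epsilon>s" "\<sigma> \<in> set (refine k (hemisphere e i))" for i \<sigma>
      using props[of i \<sigma>] that hull_subset[of "set \<sigma>" convex] by (auto simp: \<epsilon>s_def)
  qed
  then obtain \<tau> where \<tau>: "\<tau> \<in> set (refine k (hemisphere e m))" "sign_changes \<epsilon>s \<tau> \<noteq> 0"
  proof -
    have "\<exists>\<tau>\<in>set (refine k (hemisphere e m)). sign_changes \<epsilon>s \<tau> \<noteq> 0"
    proof (rule ccontr)
      assume "\<not> ?thesis"
      then have "chain_sum (sign_changes \<epsilon>s) (refine k (hemisphere e m)) = chain_sum (\<lambda>_. 0) (refine k (hemisphere e m))"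
        by (intro chain_sum_cong) auto
      then show False
        using \<open>chain_sum (sign_changes \<epsilon>s) _ = 1\<close> by (simp add: \<epsilon>s_def chain_sum_def)
    qed
    then show thesis using that by blast
  qed
  have \<tau>K: "set \<tau> \<subseteq> ?K" and len: "length \<tau> = Suc m"
    using props[OF order_refl \<tau>(1)] hull_subset[of "set \<tau>" convex] by auto
  have close: "dist x y < d" if "x \<in> set \<tau>" "y \<in> set \<tau>" for x y
    using props[OF order_refl \<tau>(1)] that k unfolding dist_norm by fastforce
  have in\<tau>: "\<tau> ! j \<in> set \<tau>" if "j \<le> m" for j
    using that len by auto
  have small: "\<bar>f j (\<tau> ! 0)\<bar> < 2 * c" if j: "j < m" for j
  proof -
    have "odd_sign (f j) (\<tau> ! j) \<noteq> odd_sign (f j) (\<tau> ! Suc j)"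
      using sign_changes_consecutive[OF \<tau>(2), of j] j by (simp add: \<epsilon>s_def)
    then have "f j (\<tau> ! j) * f j (\<tau> ! Suc j) \<le> 0"
      by (auto simp: odd_sign_def mult_le_0_iff split: if_splits)
    moreover have "\<bar>f j (\<tau> ! j) - f j (\<tau> ! Suc j)\<bar> < c" "\<bar>f j (\<tau> ! 0) - f j (\<tau> ! j)\<bar> < c"
      using j in\<tau> \<tau>K by (auto intro!: d(2) close)
    ultimately show ?thesis
      by (auto simp: mult_le_0_iff)
  qed
  have "F x0 \<le> F (\<tau> ! 0)"
    using x0(2) in\<tau> \<tau>K by auto
  also have "\<dots> \<le> (\<Sum>j<m. 2 * c)"
    unfolding F_def by (rule sum_mono) (use small in \<open>auto intro: less_imp_le\<close>)
  also have "\<dots> < F x0"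
    using \<open>F x0 > 0\<close> by (simp add: c_def field_simps)
  finally show False by simp
qed

section \<open>Orthogonal projections and weak convergence in Hilbert spaces\<close>

text \<open>
  The representing vector minimises \<open>(norm x)\<^sup>2 / 2 - l x\<close> on \<open>S\<close>. By the parallelogram identity
  minimising sequences are Cauchy, and comparing with \<open>z + t *\<^sub>R y\<close> gives the equation. Applied to
  \<open>l = inner a\<close> this is the orthogonal projection, applied to \<open>S = UNIV\<close> the Riesz theorem.
\<close>

lemma riesz_on_closed_subspace:
  fixes l :: "'h::{real_inner, complete_space} \<Rightarrow> real"
  assumes S: "subspace S" "closed S" and l: "bounded_linear l"
  shows "\<exists>z\<in>S. \<forall>y\<in>S. inner z y = l y"
proof -
  define q where "q x = (norm x)\<^sup>2 / 2 - l x" for x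
  interpret l: bounded_linear l by fact
  obtain B where B: "\<And>x. \<bar>l x\<bar> \<le> norm x * B"
    using l.bounded by auto
  have below: "- (B\<^sup>2 / 2) \<le> q x" for x
  proof -
    have "l x \<le> norm x * B" using B[of x] by linarith
    moreover have "0 \<le> (norm x - B)\<^sup>2" by simp
    ultimately show ?thesis by (simp add: q_def power2_diff field_simps)
  qed
  define m where "m = (INF x\<in>S. q x)"
  have bdd: "bdd_below (q ` S)"
    using below by (auto intro!: bdd_belowI2)
  have ne: "S \<noteq> {}" using subspace_0[OF S(1)] by auto
  have m_le: "m \<le> q x" if "x \<in> S" for x
    unfolding m_def by (rule cINF_lower[OF bdd that])
  have "\<exists>x\<in>S. q x < m + 1 / real (Suc n)" for n
  proof -
    have "m < m + 1 / real (Suc n)" by simp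
    then show ?thesis
      unfolding m_def using cINF_less_iff[OF ne bdd] by blast
  qed
  then obtain X where X: "\<And>n. X n \<in> S" "\<And>n. q (X n) < m + 1 / real (Suc n)"
    by metis
  have para: "(norm (x - y))\<^sup>2 \<le> 4 * (q x - m) + 4 * (q y - m)" if "x \<in> S" "y \<in> S" for x y
  proof -
    have "m \<le> q ((1/2) *\<^sub>R (x + y))"
      by (rule m_le) (use S(1) that in \<open>auto intro: subspace_add subspace_scale\<close>)
    also have "q ((1/2) *\<^sub>R (x + y)) = q x / 2 + q y / 2 - (norm (x - y))\<^sup>2 / 8"
      unfolding q_def l.scaleR l.add power2_norm_eq_inner
      by (simp add: inner_add inner_diff inner_commute field_simps)
    finally show ?thesis by simp
  qed
  have "Cauchy X"
  proof (rule metric_CauchyI)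
    fix e :: real assume e: "e > 0"
    obtain N where N: "8 / e\<^sup>2 < real N"
      using reals_Archimedean2 by blast
    then have N0: "N > 0" using e by (metis gr0I of_nat_0 less_le_not_le zero_le_divide_iff zero_le_power2 zero_le_numeral)
    have "dist (X i) (X j) < e" if "i \<ge> N" "j \<ge> N" for i j
    proof -
      have bd: "q (X i) - m < 1 / real N" if "i \<ge> N" for i
      proof -
        have "1 / real (Suc i) \<le> 1 / real N"
          using that N0 by (intro divide_left_mono) auto
        then show ?thesis using X(2)[of i] by linarith
      qed
      have "(norm (X i - X j))\<^sup>2 < 8 / real N"
        using para[OF X(1) X(1), of i j] bd[OF that(1)] bd[OF that(2)] by simp
      also have "\<dots> < e\<^sup>2"
        using N N0 e by (simp add: field_simps)
      finally show ?thesis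
        using e by (simp add: dist_norm power2_less_imp_less)
    qed
    then show "\<exists>M. \<forall>i\<ge>M. \<forall>j\<ge>M. dist (X i) (X j) < e" by blast
  qed
  then obtain z where z: "X \<longlonglongrightarrow> z"
    using Cauchy_convergent convergent_def by blast
  have zS: "z \<in> S"
    by (rule closed_sequentially[OF S(2) X(1) z])
  have "(\<lambda>n. q (X n)) \<longlonglongrightarrow> q z"
    unfolding q_def by (intro tendsto_intros z l.tendsto) simp
  moreover have "(\<lambda>n. m + 1 / real (Suc n)) \<longlonglongrightarrow> m + 0"
    by (intro tendsto_add tendsto_const LIMSEQ_Suc[OF lim_1_over_n])
  ultimately have "q z \<le> m + 0"
    by (rule LIMSEQ_le) (use X(2) in \<open>auto intro: less_imp_le\<close>)
  then have min: "q z \<le> q x" if "x \<in> S" for x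
    using m_le[OF that] by simp
  have "inner z y = l y" if y: "y \<in> S" for y
  proof (rule ccontr)
    define a where "a = inner z y - l y"
    assume "inner z y \<noteq> l y"
    then have "a \<noteq> 0" by (simp add: a_def)
    \<comment> \<open>This \<open>t\<close> minimises the quadratic upper bound \<open>t * a + t\<^sup>2 * (1 + (norm y)\<^sup>2) / 2\<close>.\<close>
    define t where "t = - a / (1 + (norm y)\<^sup>2)"
    have pos: "1 + (norm y)\<^sup>2 > 0" by (simp add: add_pos_nonneg)
    have "q z \<le> q (z + t *\<^sub>R y)"
      by (rule min) (use S(1) zS y in \<open>auto intro: subspace_add subspace_scale\<close>)
    also have "\<dots> = q z + t * a + t\<^sup>2 * (norm y)\<^sup>2 / 2"
      unfolding q_def l.scaleR l.add power2_norm_eq_inner a_def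
      by (simp add: inner_add inner_commute field_simps power2_eq_square)
    finally have "0 \<le> t * a + t\<^sup>2 * (norm y)\<^sup>2 / 2" by simp
    also have "t\<^sup>2 * (norm y)\<^sup>2 / 2 \<le> t\<^sup>2 * (1 + (norm y)\<^sup>2) / 2"
      by (intro divide_right_mono mult_left_mono) auto
    also have "t * a + t\<^sup>2 * (1 + (norm y)\<^sup>2) / 2 = - (a\<^sup>2 / (2 * (1 + (norm y)\<^sup>2)))"
    proof -
      define c where "c = 1 + (norm y)\<^sup>2"
      have "c \<noteq> 0" using pos by (simp add: c_def)
      then have "- a / c * a + (- a / c)\<^sup>2 * c / 2 = - (a\<^sup>2 / (2 * c))"
        by (simp add: power2_eq_square field_simps)
      then show ?thesis by (simp add: t_def c_def)
    qed
    also have "\<dots> < 0"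
      using \<open>a \<noteq> 0\<close> pos by simp
    finally show False by simp
  qed
  then show ?thesis using zS by blast
qed

definition proj :: "'h::real_inner set \<Rightarrow> 'h \<Rightarrow> 'h" where
  "proj S a = (SOME z. z \<in> S \<and> (\<forall>y\<in>S. inner z y = inner a y))"

lemma proj:
  fixes S :: "'h::{real_inner, complete_space} set"
  assumes "subspace S" "closed S"
  shows proj_mem: "proj S a \<in> S" and inner_proj: "y \<in> S \<Longrightarrow> inner (proj S a) y = inner a y"
proof -
  have "\<exists>z. z \<in> S \<and> (\<forall>y\<in>S. inner z y = inner a y)"
    using riesz_on_closed_subspace[OF assms, of "inner a"] by (auto intro: bounded_linear_inner_right)
  then have "proj S a \<in> S \<and> (\<forall>y\<in>S. inner (proj S a) y = inner a y)"
    unfolding proj_def by (rule someI_ex)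
  then show "proj S a \<in> S" "y \<in> S \<Longrightarrow> inner (proj S a) y = inner a y" by auto
qed

lemma proj_eqI:
  fixes S :: "'h::{real_inner, complete_space} set"
  assumes S: "subspace S" "closed S" and z: "z \<in> S" "\<And>y. y \<in> S \<Longrightarrow> inner z y = inner a y"
  shows "proj S a = z"
proof -
  have d: "proj S a - z \<in> S"
    using S(1) proj_mem[OF S] z(1) by (rule subspace_diff)
  have "inner (proj S a - z) (proj S a - z) = 0"
    using inner_proj[OF S d, of a] z(2)[OF d] by (simp add: inner_diff_left)
  then show ?thesis by simp
qed

lemma proj_diff:
  fixes S :: "'h::{real_inner, complete_space} set"
  assumes S: "subspace S" "closed S"
  shows "proj S (a - b) = proj S a - proj S b"
  by (rule proj_eqI[OF S]) (simp_all add: subspace_diff[OF S(1)] proj_mem[OF S] inner_diff_left inner_proj[OF S])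

lemma proj_uminus:
  fixes S :: "'h::{real_inner, complete_space} set"
  assumes S: "subspace S" "closed S"
  shows "proj S (- a) = - proj S a"
  by (rule proj_eqI[OF S]) (simp_all add: subspace_neg[OF S(1)] proj_mem[OF S] inner_proj[OF S])

lemma norm_proj_le:
  fixes S :: "'h::{real_inner, complete_space} set"
  assumes S: "subspace S" "closed S"
  shows "norm (proj S a) \<le> norm a"
proof -
  have "norm (proj S a) * norm (proj S a) = inner a (proj S a)"
    using inner_proj[OF S proj_mem[OF S], of a a] by (simp add: dot_square_norm power2_eq_square)
  also have "\<dots> \<le> norm a * norm (proj S a)"
    by (rule norm_cauchy_schwarz)
  finally show ?thesis
    by (cases "norm (proj S a) = 0") auto
qed

definition weakly_tendsto :: "(nat \<Rightarrow> 'h::real_inner) \<Rightarrow> 'h \<Rightarrow> bool" where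
  "weakly_tendsto X x \<longleftrightarrow> (\<forall>z. (\<lambda>n. inner (X n) z) \<longlonglongrightarrow> inner x z)"

lemma weakly_tendsto_subseq:
  "weakly_tendsto X x \<Longrightarrow> strict_mono r \<Longrightarrow> weakly_tendsto (X \<circ> r) x"
  unfolding weakly_tendsto_def
proof
  fix z
  assume "\<forall>z. (\<lambda>n. inner (X n) z) \<longlonglongrightarrow> inner x z" and r: "strict_mono r"
  then have "((\<lambda>n. inner (X n) z) \<circ> r) \<longlonglongrightarrow> inner x z"
    by (intro LIMSEQ_subseq_LIMSEQ) blast
  then show "(\<lambda>n. inner ((X \<circ> r) n) z) \<longlonglongrightarrow> inner x z"
    by (simp only: o_def)
qed

lemma tendsto_imp_weakly_tendsto: "X \<longlonglongrightarrow> x \<Longrightarrow> weakly_tendsto X x"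
  unfolding weakly_tendsto_def by (auto intro: tendsto_intros)

text \<open>
  The component of the weak limit orthogonal to \<open>S\<close> is tested against itself.
\<close>

lemma weak_limit_in_closed_subspace:
  fixes S :: "'h::{real_inner, complete_space} set"
  assumes S: "subspace S" "closed S" and X: "\<And>n. X n \<in> S" "weakly_tendsto X x"
  shows "x \<in> S"
proof -
  let ?y = "x - proj S x"
  have "inner (X n) ?y = 0" for n
    using inner_proj[OF S X(1), of x n] by (simp add: inner_diff_right inner_commute)
  moreover have "(\<lambda>n. inner (X n) ?y) \<longlonglongrightarrow> inner x ?y"
    using X(2) by (simp only: weakly_tendsto_def)
  ultimately have "inner x ?y = 0"
    by (simp add: LIMSEQ_const_iff)
  moreover have "inner (proj S x) ?y = 0"
    unfolding inner_diff_right inner_commute[of "proj S x" x] inner_proj[OF S proj_mem[OF S], of x x]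
    by (rule diff_self)
  ultimately have "inner ?y ?y = 0" by (simp add: inner_diff_left)
  then have "proj S x = x" by simp
  then show ?thesis using proj_mem[OF S, of x] by simp
qed

text \<open>
  Closedness allows projecting onto this subspace, which reduces convergence against an
  arbitrary vector to convergence against vectors of the subspace.
\<close>

lemma closed_subspace_convergent_functionals:
  fixes X :: "nat \<Rightarrow> 'h::real_inner"
  assumes "\<And>n. norm (X n) \<le> B"
  shows "subspace {z. convergent (\<lambda>n. inner (X n) z)}" "closed {z. convergent (\<lambda>n. inner (X n) z)}"
proof -
  let ?D = "{z. convergent (\<lambda>n. inner (X n) z)}"
  show "subspace ?D"
    unfolding subspace_def
    by (auto simp: inner_add_right intro: convergent_add convergent_mult convergent_const)
  have "B \<ge> 0" using assms[of 0] norm_ge_zero order_trans by blast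
  show "closed ?D"
    unfolding closed_sequential_limits
  proof (intro allI impI, elim conjE)
    fix Z z assume Z: "\<forall>k. Z k \<in> ?D" "Z \<longlonglongrightarrow> z"
    have "Cauchy (\<lambda>n. inner (X n) z)"
    proof (rule metric_CauchyI)
      fix e :: real assume e: "e > 0"
      have "e / (3 * (B + 1)) > 0" using e \<open>B \<ge> 0\<close> by simp
      then obtain k where k: "norm (Z k - z) < e / (3 * (B + 1))"
        using LIMSEQ_D[OF Z(2)] by blast
      have near: "\<bar>inner (X n) (Z k) - inner (X n) z\<bar> < e / 3" for n
      proof -
        have "\<bar>inner (X n) (Z k) - inner (X n) z\<bar> \<le> norm (X n) * norm (Z k - z)"
          by (metis Cauchy_Schwarz_ineq2 inner_diff_right)
        also have "\<dots> \<le> B * norm (Z k - z)"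
          by (intro mult_right_mono assms) auto
        also have "\<dots> \<le> (B + 1) * norm (Z k - z)"
          by (intro mult_right_mono) auto
        also have "\<dots> < (B + 1) * (e / (3 * (B + 1)))"
          using k \<open>B \<ge> 0\<close> by (intro mult_strict_left_mono) auto
        also have "\<dots> = e / 3"
          using \<open>B \<ge> 0\<close> by (simp add: field_simps)
        finally show ?thesis .
      qed
      have "Cauchy (\<lambda>n. inner (X n) (Z k))"
        using Z(1) by (auto intro: convergent_Cauchy)
      then obtain M where M: "\<forall>i\<ge>M. \<forall>j\<ge>M. dist (inner (X i) (Z k)) (inner (X j) (Z k)) < e / 3"
        using metric_CauchyD[of _ "e / 3"] e by (metis divide_pos_pos zero_less_numeral)
      have "dist (inner (X i) z) (inner (X j) z) < e" if "i \<ge> M" "j \<ge> M" for i j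
      proof -
        have "\<bar>inner (X i) (Z k) - inner (X j) (Z k)\<bar> < e / 3"
          using M that by (auto simp: dist_real_def)
        then show ?thesis
          using near[of i] near[of j] unfolding dist_real_def by linarith
      qed
      then show "\<exists>M. \<forall>i\<ge>M. \<forall>j\<ge>M. dist (inner (X i) z) (inner (X j) z) < e" by blast
    qed
    then show "z \<in> ?D" by (simp add: Cauchy_convergent)
  qed
qed

text \<open>
  A diagonal subsequence converges against each \<open>X m\<close>. The vectors against which it converges form a
  closed subspace that contains all \<open>X n\<close>; hence any vector may be replaced by its projection
  onto that subspace. The limit functional is represented by Riesz' theorem.
\<close>

theorem bounded_imp_weakly_convergent_subsequence:
  fixes X :: "nat \<Rightarrow> 'h::{real_inner, complete_space}"
  assumes B: "\<And>n. norm (X n) \<le> B"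
  shows "\<exists>r x. strict_mono (r :: nat \<Rightarrow> nat) \<and> weakly_tendsto (X \<circ> r) x"
proof -
  define P where "P m s \<longleftrightarrow> convergent (\<lambda>n. inner (X (s n)) (X m))" for m and s :: "nat \<Rightarrow> nat"
  interpret subseqs P
  proof
    fix m and s :: "nat \<Rightarrow> nat"
    have "bounded (range (\<lambda>n. inner (X (s n)) (X m)))"
    proof (rule boundedI)
      fix y assume "y \<in> range (\<lambda>n. inner (X (s n)) (X m))"
      then obtain n where "y = inner (X (s n)) (X m)" by blast
      then have "norm y \<le> norm (X (s n)) * norm (X m)"
        using Cauchy_Schwarz_ineq2 by simp
      also have "\<dots> \<le> B * norm (X m)"
        by (intro mult_right_mono B) auto
      finally show "norm y \<le> B * norm (X m)" .
    qed
    then obtain l r where "strict_mono r" "((\<lambda>n. inner (X (s n)) (X m)) \<circ> r) \<longlonglongrightarrow> l"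
      using bounded_imp_convergent_subsequence by blast
    then show "\<exists>r'. strict_mono r' \<and> P m (s \<circ> r')"
      unfolding P_def convergent_def o_def by blast
  qed
  define r where "r = diagseq"
  have r: "strict_mono r" by (simp add: r_def subseq_diagseq)
  have conv: "convergent (\<lambda>n. inner (X (r n)) (X m))" for m
  proof -
    have "P m (diagseq \<circ> (+) (Suc m))"
    proof (rule diagseq_holds)
      fix t s n assume "strict_mono (t :: nat \<Rightarrow> nat)" "P n s"
      then show "P n (s \<circ> t)"
        unfolding P_def convergent_def using LIMSEQ_subseq_LIMSEQ by (fastforce simp: o_def)
    qed
    then have "convergent (\<lambda>n. inner (X (r (n + Suc m))) (X m))"
      by (simp add: P_def r_def o_def add.commute)
    then show ?thesis
      using convergent_ignore_initial_segment[of "\<lambda>n. inner (X (r n)) (X m)" "Suc m"] by simp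
  qed
  let ?D = "{z. convergent (\<lambda>n. inner (X (r n)) z)}"
  have D: "subspace ?D" "closed ?D"
    using closed_subspace_convergent_functionals[of "\<lambda>n. X (r n)" B] B by auto
  have conv: "convergent (\<lambda>n. inner (X (r n)) z)" for z
  proof -
    have "inner (X (r n)) z = inner (X (r n)) (proj ?D z)" for n
      using inner_proj[OF D, of "X (r n)" z] conv by (simp add: inner_commute)
    moreover have "convergent (\<lambda>n. inner (X (r n)) (proj ?D z))"
      using proj_mem[OF D, of z] by simp
    ultimately show ?thesis by simp
  qed
  define l where "l z = lim (\<lambda>n. inner (X (r n)) z)" for z
  have lim: "(\<lambda>n. inner (X (r n)) z) \<longlonglongrightarrow> l z" for z
    unfolding l_def using conv convergent_LIMSEQ_iff by blast
  have "bounded_linear l"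
  proof (rule bounded_linear_intro[of _ B])
    show "l (x + y) = l x + l y" for x y
      by (rule LIMSEQ_unique[OF lim]) (unfold inner_add_right, intro tendsto_intros lim)
    show "l (c *\<^sub>R x) = c *\<^sub>R l x" for c x
      by (rule LIMSEQ_unique[OF lim]) (simp, intro tendsto_intros lim)
    show "norm (l x) \<le> norm x * B" for x
    proof (rule LIMSEQ_le_const2[OF tendsto_norm[OF lim]])
      have "norm (inner (X (r n)) x) \<le> norm x * B" for n
      proof -
        have "norm (inner (X (r n)) x) \<le> norm (X (r n)) * norm x"
          using Cauchy_Schwarz_ineq2 by simp
        also have "\<dots> \<le> B * norm x"
          by (intro mult_right_mono B) auto
        finally show ?thesis by (simp add: mult.commute)
      qed
      then show "\<exists>N. \<forall>n\<ge>N. norm (inner (X (r n)) x) \<le> norm x * B" by blast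
    qed
  qed
  then obtain x where "\<And>z. inner x z = l z"
    using riesz_on_closed_subspace[of UNIV l] by auto
  then have "weakly_tendsto (X \<circ> r) x"
    using lim by (simp add: weakly_tendsto_def o_def)
  then show ?thesis using r by blast
qed

section \<open>Infinitely many critical points of an even functional\<close>

text \<open>
  \<open>T\<close> is the gradient of the convex function \<open>\<Phi>\<close> on \<open>S\<close>, stated as a subgradient inequality. The
  critical points of \<open>x \<mapsto> (norm x)\<^sup>2 / 2 - \<Phi> x\<close> on \<open>S\<close> are the fixed points of \<open>T\<close>.
\<close>

locale even_functional =
  fixes S :: "'h::{real_inner, complete_space} set" and T :: "'h \<Rightarrow> 'h" and \<Phi> :: "'h \<Rightarrow> real" and C :: real
  assumes S: "subspace S" "closed S"
    and T_mem: "x \<in> S \<Longrightarrow> T x \<in> S"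
    and T_odd: "x \<in> S \<Longrightarrow> T (- x) = - T x"
    and T_bound: "x \<in> S \<Longrightarrow> norm (T x) \<le> C"
    and T_compact: "(\<And>n. X n \<in> S) \<Longrightarrow> (\<And>n. norm (X n) \<le> B) \<Longrightarrow> weakly_tendsto X x
          \<Longrightarrow> \<exists>r. strict_mono (r :: nat \<Rightarrow> nat) \<and> (\<lambda>n. T (X (r n))) \<longlonglongrightarrow> T x"
    and subgradient: "x \<in> S \<Longrightarrow> y \<in> S \<Longrightarrow> \<Phi> x + inner (T x) (y - x) \<le> \<Phi> y"
    and \<Phi>_0: "\<Phi> 0 = 0"
begin

definition J :: "'h \<Rightarrow> real" where
  "J x = (norm x)\<^sup>2 / 2 - \<Phi> x"

lemma \<Phi>_le: "x \<in> S \<Longrightarrow> \<Phi> x \<le> inner (T x) x"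
  using subgradient[of x 0] subspace_0[OF S(1)] \<Phi>_0 by simp

lemma \<Phi>_lipschitz:
  assumes "x \<in> S" "y \<in> S"
  shows "\<bar>\<Phi> y - \<Phi> x\<bar> \<le> C * norm (y - x)"
proof -
  have "\<bar>inner (T z) (u - v)\<bar> \<le> C * norm (u - v)" if "z \<in> S" for z u v
    using Cauchy_Schwarz_ineq2[of "T z" "u - v"] mult_right_mono[OF T_bound[OF that] norm_ge_zero, of "u - v"]
    by linarith
  from this[of x y x] this[of y x y] show ?thesis
    using subgradient[OF assms] subgradient[OF assms(2,1)] assms by (simp add: norm_minus_commute)
qed

lemma J_tendsto:
  assumes "\<And>n. X n \<in> S" "X \<longlonglongrightarrow> x"
  shows "(\<lambda>n. J (X n)) \<longlonglongrightarrow> J x"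
proof -
  have x: "x \<in> S" by (rule closed_sequentially[OF S(2) assms])
  have "(\<lambda>n. \<Phi> (X n) - \<Phi> x) \<longlonglongrightarrow> 0"
  proof (rule Lim_null_comparison)
    show "\<forall>\<^sub>F n in sequentially. norm (\<Phi> (X n) - \<Phi> x) \<le> C * norm (X n - x)"
      using \<Phi>_lipschitz[OF x assms(1)] by simp
    have "(\<lambda>n. C * norm (X n - x)) \<longlonglongrightarrow> C * norm (x - x)"
      by (intro tendsto_intros assms(2))
    then show "(\<lambda>n. C * norm (X n - x)) \<longlonglongrightarrow> 0" by simp
  qed
  then have "(\<lambda>n. \<Phi> (X n)) \<longlonglongrightarrow> \<Phi> x"
    by (simp only: LIM_zero_iff)
  then show ?thesis
    unfolding J_def by (intro tendsto_intros assms(2)) auto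
qed

lemma continuous_on_J: "continuous_on S J"
  unfolding continuous_on_sequentially using J_tendsto by (auto simp: o_def)

lemma T_tendsto:
  assumes "\<And>n. X n \<in> S" "X \<longlonglongrightarrow> x"
  shows "(\<lambda>n. T (X n)) \<longlonglongrightarrow> T x"
proof (rule ccontr)
  assume "\<not> ?thesis"
  then obtain e where e: "e > 0" "\<forall>N. \<exists>n\<ge>N. \<not> dist (T (X n)) (T x) < e"
    unfolding lim_sequentially by blast
  then have "infinite {n. \<not> dist (T (X n)) (T x) < e}"
    unfolding infinite_nat_iff_unbounded_le by blast
  then obtain s :: "nat \<Rightarrow> nat" where s: "strict_mono s" "\<And>n. s n \<in> {n. \<not> dist (T (X n)) (T x) < e}"
    using infinite_enumerate by blast
  have "weakly_tendsto (X \<circ> s) x"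
    by (intro weakly_tendsto_subseq tendsto_imp_weakly_tendsto assms s)
  moreover obtain B where "\<And>n. norm (X n) \<le> B"
    using convergent_imp_bounded[OF assms(2)] by (auto simp: bounded_iff)
  ultimately obtain r where r: "(\<lambda>n. T ((X \<circ> s) (r n))) \<longlonglongrightarrow> T x"
    using T_compact[of "X \<circ> s" B x] assms(1) by auto
  then obtain n where "dist (T ((X \<circ> s) (r n))) (T x) < e"
    using e(1) unfolding lim_sequentially by blast
  then show False using s(2)[of "r n"] by simp
qed

lemma continuous_on_T: "continuous_on S T"
  unfolding continuous_on_sequentially using T_tendsto by (auto simp: o_def)

text \<open>
  Convexity bounds \<open>\<Phi> (T x)\<close> from below by its tangent at \<open>x\<close>, whose slope is \<open>T x\<close>; completing the
  square yields the gain. A full step of size \<open>1\<close> along the negative gradient \<open>T x - x\<close> thus decreases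
  \<open>J\<close> everywhere.
\<close>

lemma descent:
  assumes "x \<in> S"
  shows "J (T x) \<le> J x - (norm (T x - x))\<^sup>2 / 2"
proof -
  have "(norm (T x - x))\<^sup>2 = (norm (T x))\<^sup>2 - 2 * inner (T x) x + (norm x)\<^sup>2"
    by (simp add: power2_norm_eq_inner inner_diff inner_commute)
  moreover have "inner (T x) (T x - x) = (norm (T x))\<^sup>2 - inner (T x) x"
    by (simp add: power2_norm_eq_inner inner_diff)
  ultimately show ?thesis
    using subgradient[OF assms T_mem[OF assms]] unfolding J_def by (simp add: field_simps)
qed

lemma norm_le_of_J_nonpos:
  assumes "x \<in> S" "J x \<le> 0"
  shows "norm x \<le> 2 * C"
proof -
  have "inner (T x) x \<le> C * norm x"
    using norm_cauchy_schwarz[of "T x" x] mult_right_mono[OF T_bound[OF assms(1)] norm_ge_zero, of x] by linarith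
  then have "norm x * norm x \<le> (2 * C) * norm x"
    using \<Phi>_le[OF assms(1)] assms(2) by (simp add: J_def power2_eq_square)
  moreover have "C \<ge> 0" using T_bound[OF assms(1)] norm_ge_zero order_trans by blast
  ultimately show ?thesis
    by (cases "norm x = 0") auto
qed

text \<open>
  Otherwise one could choose recursively \<open>X n\<close> orthogonal to \<open>T (X m)\<close> for all \<open>m < n\<close>. Along a
  subsequence \<open>T (X n)\<close> converges, so that consecutive images differ by little, whereas
  \<open>inner (T (X n)) (X n) \<ge> e\<close> and the previous image is orthogonal to \<open>X n\<close>.
\<close>

lemma small_on_finite_codimension:
  assumes "e > 0"
  shows "\<exists>Z. finite Z \<and> (\<forall>x\<in>S. norm x \<le> R \<longrightarrow> (\<forall>z\<in>Z. inner z x = 0) \<longrightarrow> inner (T x) x < e)"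
proof (rule ccontr)
  assume neg: "\<not> ?thesis"
  have "\<exists>X. \<forall>n::nat. X n \<in> S \<and> norm (X n) \<le> R \<and> inner (T (X n)) (X n) \<ge> e
      \<and> (\<forall>m<n. inner (T (X m)) (X n) = 0)"
  proof (rule dependent_wellorder_choice)
    fix n :: nat and X :: "nat \<Rightarrow> 'h"
    have "finite ((\<lambda>m. T (X m)) ` {..<n})" by simp
    then obtain x where "x \<in> S" "norm x \<le> R" "\<forall>z\<in>(\<lambda>m. T (X m)) ` {..<n}. inner z x = 0" "\<not> inner (T x) x < e"
      using neg by blast
    then show "\<exists>x. x \<in> S \<and> norm x \<le> R \<and> inner (T x) x \<ge> e \<and> (\<forall>m<n. inner (T (X m)) x = 0)"
      by (intro exI[of _ x]) auto
  qed auto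
  then obtain X where "\<forall>n::nat. X n \<in> S \<and> norm (X n) \<le> R \<and> inner (T (X n)) (X n) \<ge> e
      \<and> (\<forall>m<n. inner (T (X m)) (X n) = 0)"
    by (rule exE)
  then have X: "\<And>n. X n \<in> S" "\<And>n. norm (X n) \<le> R" "\<And>n. inner (T (X n)) (X n) \<ge> e"
    "\<And>m n. m < n \<Longrightarrow> inner (T (X m)) (X n) = 0"
    by simp_all
  obtain r x where r: "strict_mono r" "weakly_tendsto (X \<circ> r) x"
    using bounded_imp_weakly_convergent_subsequence[of X R] X(2) by blast
  obtain s where s: "strict_mono s" "(\<lambda>n. T ((X \<circ> r) (s n))) \<longlonglongrightarrow> T x"
    using T_compact[OF _ _ r(2), of R] X(1,2) by auto
  define Y where "Y n = X (r (s n))" for n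
  have Y: "(\<lambda>n. T (Y n)) \<longlonglongrightarrow> T x"
    using s(2) by (simp add: Y_def)
  have "R > 0 \<or> R = 0"
    using X(2)[of 0] norm_ge_zero[of "X 0"] by linarith
  moreover have "R \<noteq> 0"
    using X(2)[of 0] X(3)[of 0] assms by auto
  ultimately have R: "R > 0" by blast
  have "(\<lambda>n. T (Y (Suc n)) - T (Y n)) \<longlonglongrightarrow> T x - T x"
    by (intro tendsto_diff LIMSEQ_Suc Y)
  then obtain n where n: "norm (T (Y (Suc n)) - T (Y n)) < e / R"
    using LIMSEQ_D[of _ "T x - T x" "e / R"] assms R by fastforce
  have "strict_mono (\<lambda>n. r (s n))"
    using strict_mono_o[OF r(1) s(1)] by (simp add: o_def)
  then have "inner (T (Y n)) (Y (Suc n)) = 0"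
    unfolding Y_def by (intro X(4)) (simp add: strict_mono_Suc_iff)
  then have "inner (T (Y (Suc n))) (Y (Suc n)) = inner (T (Y (Suc n)) - T (Y n)) (Y (Suc n))"
    by (simp add: inner_diff_left)
  also have "\<dots> \<le> norm (T (Y (Suc n)) - T (Y n)) * norm (Y (Suc n))"
    by (rule norm_cauchy_schwarz)
  also have "\<dots> \<le> norm (T (Y (Suc n)) - T (Y n)) * R"
    unfolding Y_def by (intro mult_left_mono X(2)) auto
  also have "\<dots> < e / R * R"
    using n R by (intro mult_strict_right_mono)
  also have "\<dots> = e" using R by simp
  finally show False
    using X(3)[of "r (s (Suc n))"] by (simp add: Y_def)
qed

text \<open>
  Sublevels are bounded, so an almost fixed sequence \<open>X n\<close> has a subsequence along which \<open>T (X n)\<close>, and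
  therefore \<open>X n\<close> itself, converges in norm; the limit is a fixed point at an admissible level.
\<close>

lemma palais_smale:
  assumes "b \<le> 0" "\<And>x. x \<in> S \<Longrightarrow> a \<le> J x \<Longrightarrow> J x \<le> b \<Longrightarrow> T x \<noteq> x"
  shows "\<exists>d>0. \<forall>x\<in>S. a \<le> J x \<longrightarrow> J x \<le> b \<longrightarrow> d \<le> norm (T x - x)"
proof (rule ccontr)
  assume neg: "\<not> ?thesis"
  have "\<exists>x. x \<in> S \<and> a \<le> J x \<and> J x \<le> b \<and> norm (T x - x) < 1 / real (Suc n)" for n
  proof -
    have "1 / real (Suc n) > 0" by simp
    then show ?thesis using neg by (meson not_le)
  qed
  then obtain X where X: "\<And>n. X n \<in> S" "\<And>n. a \<le> J (X n)" "\<And>n. J (X n) \<le> b"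
    "\<And>n. norm (T (X n) - X n) < 1 / real (Suc n)"
    by metis
  have bound: "norm (X n) \<le> 2 * C" for n
    by (rule norm_le_of_J_nonpos[OF X(1)]) (use X(3)[of n] assms(1) in linarith)
  obtain r x where r: "strict_mono r" "weakly_tendsto (X \<circ> r) x"
    using bounded_imp_weakly_convergent_subsequence[of X, OF bound] by blast
  obtain s where s: "strict_mono s" "(\<lambda>n. T ((X \<circ> r) (s n))) \<longlonglongrightarrow> T x"
    using T_compact[OF _ _ r(2), of "2 * C"] X(1) bound by auto
  define Y where "Y n = X (r (s n))" for n
  have mono: "strict_mono (\<lambda>n. r (s n))"
    using strict_mono_o[OF r(1) s(1)] by (simp add: o_def)
  have "(\<lambda>n. T (X n) - X n) \<longlonglongrightarrow> 0"
  proof (rule Lim_null_comparison)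
    show "\<forall>\<^sub>F n in sequentially. norm (T (X n) - X n) \<le> 1 / real (Suc n)"
      using X(4) by (intro always_eventually allI less_imp_le)
    show "(\<lambda>n. 1 / real (Suc n)) \<longlonglongrightarrow> 0"
      by (rule LIMSEQ_Suc[OF lim_1_over_n])
  qed
  then have "((\<lambda>n. T (X n) - X n) \<circ> (\<lambda>n. r (s n))) \<longlonglongrightarrow> 0"
    using mono by (rule LIMSEQ_subseq_LIMSEQ)
  then have "(\<lambda>n. T (Y n) - Y n) \<longlonglongrightarrow> 0"
    by (simp add: Y_def o_def)
  moreover have TY: "(\<lambda>n. T (Y n)) \<longlonglongrightarrow> T x"
    using s(2) by (simp add: Y_def)
  ultimately have "(\<lambda>n. T (Y n) - (T (Y n) - Y n)) \<longlonglongrightarrow> T x - 0"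
    by (intro tendsto_diff)
  then have Y: "Y \<longlonglongrightarrow> T x" by simp
  have YS: "Y n \<in> S" for n by (simp add: Y_def X)
  have "T (T x) = T x"
    by (rule LIMSEQ_unique[OF T_tendsto[OF YS Y] TY])
  moreover have "T x \<in> S"
    by (rule closed_sequentially[OF S(2) YS Y])
  moreover have "a \<le> J (T x)" "J (T x) \<le> b"
    by (rule LIMSEQ_le_const[OF J_tendsto[OF YS Y]], use X(2) in \<open>auto simp: Y_def\<close>)
       (rule LIMSEQ_le_const2[OF J_tendsto[OF YS Y]], use X(3) in \<open>auto simp: Y_def\<close>)
  ultimately show False using assms(2) by blast
qed

lemma iterate:
  assumes "x \<in> S"
  shows iterate_mem: "(T ^^ n) x \<in> S" and iterate_odd: "(T ^^ n) (- x) = - (T ^^ n) x"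
proof -
  have "(T ^^ n) x \<in> S \<and> (T ^^ n) (- x) = - (T ^^ n) x"
    by (induction n) (auto simp: assms T_mem T_odd)
  then show "(T ^^ n) x \<in> S" "(T ^^ n) (- x) = - (T ^^ n) x" by auto
qed

lemma continuous_on_iterate: "continuous_on S (T ^^ n)"
proof (induction n)
  case (Suc n)
  have "continuous_on S (T \<circ> (T ^^ n))"
    by (rule continuous_on_compose[OF Suc]) (rule continuous_on_subset[OF continuous_on_T], use iterate_mem in auto)
  then show ?case by (simp add: o_def)
qed (simp add: id_def)

lemma iterate_descends:
  assumes "x \<in> S" "J x \<le> b" "d > 0" "\<And>x. x \<in> S \<Longrightarrow> a \<le> J x \<Longrightarrow> J x \<le> b \<Longrightarrow> d \<le> norm (T x - x)"
  shows "J ((T ^^ n) x) \<le> max a (b - real n * (d\<^sup>2 / 2))"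
proof (induction n)
  case 0
  then show ?case using assms(2) by simp
next
  case (Suc n)
  let ?y = "(T ^^ n) x"
  have y: "?y \<in> S" by (rule iterate_mem[OF assms(1)])
  have d: "J (T ?y) \<le> J ?y - (norm (T ?y - ?y))\<^sup>2 / 2" by (rule descent[OF y])
  show ?case
  proof (cases "J ?y \<le> a")
    case True
    have "J (T ?y) \<le> a" using d True zero_le_power2[of "norm (T ?y - ?y)"] by linarith
    then show ?thesis by simp
  next
    case False
    then have le: "J ?y \<le> b - real n * (d\<^sup>2 / 2)" using Suc by linarith
    moreover have "0 \<le> real n * (d\<^sup>2 / 2)" by simp
    ultimately have "J ?y \<le> b" by linarith
    then have "d \<le> norm (T ?y - ?y)" using assms(4)[OF y] False by simp
    then have "d\<^sup>2 \<le> (norm (T ?y - ?y))\<^sup>2" using assms(3) by (simp add: power_mono)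
    then have "J (T ?y) \<le> b - real (Suc n) * (d\<^sup>2 / 2)"
      using d le by (simp add: field_simps)
    then show ?thesis by (simp only: max_def) auto
  qed
qed

text \<open>
  If there were finitely many such points, their levels would stay below some \<open>- \<epsilon>\<close>. Let the finite
  set \<open>Z\<close> be such that \<open>J > - \<epsilon>\<close> at the points of nonpositive level orthogonal to \<open>Z\<close>, and let
  \<open>m\<close> be its size. An iterate of \<open>T\<close> moves an \<open>m\<close>-dimensional cross-polytope with \<open>J < 0\<close> into
  \<open>{J \<le> - \<epsilon>}\<close>, as no fixed point lies at a level in between. By Borsuk--Ulam the odd map
  \<open>x \<mapsto> (inner z ((T ^^ n) x))\<close>, with \<open>z\<close> ranging over \<open>Z\<close>, has a zero, which is impossible.
\<close>

theorem infinitely_many_negative_fixed_points: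
  assumes neg: "\<And>k. \<exists>e. (\<forall>i\<le>k. e i \<in> S) \<and> (\<forall>x\<in>cross_polytope e k. J x < 0)"
  shows "infinite {x \<in> S. T x = x \<and> J x < 0}"
proof
  assume fin: "finite {x \<in> S. T x = x \<and> J x < 0}"
  have "\<exists>\<epsilon>>0. \<forall>x\<in>S. T x = x \<longrightarrow> J x < 0 \<longrightarrow> J x < - \<epsilon>"
  proof -
    let ?M = "insert 1 ((\<lambda>x. - J x) ` {x \<in> S. T x = x \<and> J x < 0})"
    have M: "finite ?M" "?M \<noteq> {}" using fin by auto
    have "Min ?M > 0"
      using M by (subst Min_gr_iff) auto
    moreover have "J x < - (Min ?M / 2)" if "x \<in> S" "T x = x" "J x < 0" for x
    proof -
      have "Min ?M \<le> - J x" by (rule Min_le) (use that M in auto)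
      then show ?thesis using \<open>Min ?M > 0\<close> by simp
    qed
    ultimately show ?thesis by (intro exI[of _ "Min ?M / 2"]) auto
  qed
  then obtain \<epsilon> where \<epsilon>: "\<epsilon> > 0" "\<And>x. x \<in> S \<Longrightarrow> T x = x \<Longrightarrow> J x < 0 \<Longrightarrow> J x < - \<epsilon>"
    by blast
  obtain Z where Z: "finite Z" "\<And>x. x \<in> S \<Longrightarrow> norm x \<le> 2 * C \<Longrightarrow> \<forall>z\<in>Z. inner z x = 0 \<Longrightarrow> inner (T x) x < \<epsilon>"
    using small_on_finite_codimension[OF \<epsilon>(1), of "2 * C"] by blast
  obtain m z where z: "Z = z ` {..<m::nat}"
    using finite_imp_nat_seg_image_inj_on[OF Z(1)] by (auto simp: lessThan_def)
  obtain e where e: "\<And>i. i \<le> m \<Longrightarrow> e i \<in> S" "\<And>x. x \<in> cross_polytope e m \<Longrightarrow> J x < 0"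
    using neg by metis
  let ?K = "cross_polytope e m"
  have KS: "?K \<subseteq> S"
    unfolding cross_polytope_def using e(1) S(1)
    by (auto intro!: subspace_sum subspace_scale)
  have ne: "?K \<noteq> {}"
    using hemisphere_subset_cross_polytope[of "[e 0]" e 0 m] by auto
  obtain x0 where x0: "x0 \<in> ?K" "\<And>x. x \<in> ?K \<Longrightarrow> J x \<le> J x0"
    using continuous_attains_sup[OF compact_cross_polytope ne continuous_on_subset[OF continuous_on_J KS]] by blast
  define b where "b = J x0"
  have b: "b < 0" using e(2) x0(1) by (simp add: b_def)
  have "\<exists>d>0. \<forall>x\<in>S. - \<epsilon> \<le> J x \<longrightarrow> J x \<le> b \<longrightarrow> d \<le> norm (T x - x)"
  proof (rule palais_smale)
    show "T x \<noteq> x" if "x \<in> S" "- \<epsilon> \<le> J x" "J x \<le> b" for x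
      using \<epsilon>(2)[OF that(1)] that b by linarith
  qed (use b in simp)
  then obtain d where d: "d > 0" "\<And>x. x \<in> S \<Longrightarrow> - \<epsilon> \<le> J x \<Longrightarrow> J x \<le> b \<Longrightarrow> d \<le> norm (T x - x)"
    by blast
  have "d\<^sup>2 / 2 > 0" using d(1) by simp
  then obtain n where n: "b + \<epsilon> < real n * (d\<^sup>2 / 2)"
    using reals_Archimedean3 by blast
  have "\<exists>x\<in>?K. \<forall>j<m. inner (z j) ((T ^^ n) x) = 0"
  proof (rule borsuk_ulam_cross_polytope)
    show "continuous_on ?K (\<lambda>x. inner (z j) ((T ^^ n) x))" for j
      by (intro continuous_intros continuous_on_subset[OF continuous_on_iterate KS])
    show "inner (z j) ((T ^^ n) (- x)) = - inner (z j) ((T ^^ n) x)" if "x \<in> ?K" for j x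
      using iterate_odd[of x n] KS that by auto
  qed
  then obtain x where x: "x \<in> ?K" "\<And>j. j < m \<Longrightarrow> inner (z j) ((T ^^ n) x) = 0"
    by blast
  let ?y = "(T ^^ n) x"
  have xS: "x \<in> S" using x(1) KS by blast
  have yS: "?y \<in> S" by (rule iterate_mem[OF xS])
  have "J ?y \<le> max (- \<epsilon>) (b - real n * (d\<^sup>2 / 2))"
    by (rule iterate_descends[OF xS _ d]) (use x0(2)[OF x(1)] in \<open>simp_all add: b_def\<close>)
  then have Jy: "J ?y \<le> - \<epsilon>" using n by simp
  have "inner (T ?y) ?y < \<epsilon>"
    by (rule Z(2)[OF yS norm_le_of_J_nonpos[OF yS]]) (use Jy \<epsilon>(1) x(2) z in auto)
  moreover have "J ?y \<ge> - \<Phi> ?y"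
    by (simp add: J_def)
  ultimately show False
    using Jy \<Phi>_le[OF yS] by simp
qed

end

section \<open>The Hilbert space of square integrable vector-valued functions\<close>

definition square_integrable :: "('a::euclidean_space \<Rightarrow> 'b::euclidean_space) \<Rightarrow> bool" where
  "square_integrable f \<longleftrightarrow> f \<in> borel_measurable lborel \<and> integrable lborel (\<lambda>x. (norm (f x))\<^sup>2)"

lemma square_integrableD [measurable_dest]: "square_integrable f \<Longrightarrow> f \<in> borel_measurable lborel"
  by (simp add: square_integrable_def)

lemma square_integrable_norm: "square_integrable f \<Longrightarrow> integrable lborel (\<lambda>x. (norm (f x))\<^sup>2)"
  by (simp add: square_integrable_def)

lemma square_integrable_bound:
  assumes "f \<in> borel_measurable lborel" "integrable lborel g"
    and "AE x in lborel. (norm (f x))\<^sup>2 \<le> g x"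
  shows "square_integrable f"
proof -
  have [measurable]: "f \<in> borel_measurable lborel" by fact
  have "integrable lborel (\<lambda>x. (norm (f x))\<^sup>2)"
    by (rule Bochner_Integration.integrable_bound[OF assms(2)])
       (measurable, use assms(3) in \<open>auto elim!: eventually_mono\<close>)
  then show ?thesis using assms(1) by (simp add: square_integrable_def)
qed

lemma norm_add_square_le: "(norm (a + b))\<^sup>2 \<le> 2 * (norm a)\<^sup>2 + 2 * (norm (b::'a::real_inner))\<^sup>2"
  using zero_le_power2[of "norm (a - b)"] unfolding power2_norm_eq_inner
  by (simp add: inner_add inner_diff inner_commute)

lemma square_integrable_add:
  assumes "square_integrable f" "square_integrable g"
  shows "square_integrable (\<lambda>x. f x + g x)"
proof (rule square_integrable_bound)
  show "(\<lambda>x. f x + g x) \<in> borel_measurable lborel" using assms by (auto simp: square_integrable_def)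
  show "integrable lborel (\<lambda>x. 2 * (norm (f x))\<^sup>2 + 2 * (norm (g x))\<^sup>2)"
    using assms by (auto simp: square_integrable_def)
qed (simp add: norm_add_square_le)

lemma square_integrable_scaleR: "square_integrable f \<Longrightarrow> square_integrable (\<lambda>x. c *\<^sub>R f x)"
  by (auto simp: square_integrable_def power_mult_distrib)

lemma square_integrable_uminus: "square_integrable f \<Longrightarrow> square_integrable (\<lambda>x. - f x)"
  by (auto simp: square_integrable_def)

lemma square_integrable_diff:
  "square_integrable f \<Longrightarrow> square_integrable g \<Longrightarrow> square_integrable (\<lambda>x. f x - g x)"
  using square_integrable_add[of f "\<lambda>x. - g x"] square_integrable_uminus[of g] by simp

lemma square_integrable_0: "square_integrable (\<lambda>_. 0)"
  by (simp add: square_integrable_def)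

lemma integrable_inner_square_integrable:
  assumes "square_integrable f" "square_integrable g"
  shows "integrable lborel (\<lambda>x. inner (f x) (g x))"
proof (rule Bochner_Integration.integrable_bound)
  show "integrable lborel (\<lambda>x. (norm (f x))\<^sup>2 + (norm (g x))\<^sup>2)"
    using assms by (auto simp: square_integrable_def)
  show "(\<lambda>x. inner (f x) (g x)) \<in> borel_measurable lborel"
    using assms by (auto simp: square_integrable_def)
  have "norm (inner a b) \<le> norm ((norm a)\<^sup>2 + (norm b)\<^sup>2)" for a b :: 'b
  proof -
    have "norm (inner a b) \<le> norm a * norm b"
      using Cauchy_Schwarz_ineq2 by simp
    also have "\<dots> \<le> (norm a)\<^sup>2 + (norm b)\<^sup>2"
      using sum_squares_bound[of "norm a" "norm b"] mult_nonneg_nonneg[OF norm_ge_zero norm_ge_zero, of a b]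
      by linarith
    finally show ?thesis by simp
  qed
  then show "AE x in lborel. norm (inner (f x) (g x)) \<le> norm ((norm (f x))\<^sup>2 + (norm (g x))\<^sup>2)"
    by simp
qed

definition l2_rel :: "('a::euclidean_space \<Rightarrow> 'b::euclidean_space) \<Rightarrow> ('a \<Rightarrow> 'b) \<Rightarrow> bool" where
  "l2_rel f g \<longleftrightarrow> square_integrable f \<and> square_integrable g \<and> (AE x in lborel. f x = g x)"

text \<open>
  Functions equal almost everywhere are identified, which makes \<open>norm x = 0\<close> equivalent to \<open>x = 0\<close>.
\<close>

quotient_type (overloaded) ('a, 'b) l2 = "'a::euclidean_space \<Rightarrow> 'b::euclidean_space" / partial: l2_rel
proof (rule part_equivpI)
  show "\<exists>f::'a \<Rightarrow> 'b. l2_rel f f"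
    using square_integrable_0 by (auto simp: l2_rel_def)
  show "symp (l2_rel :: ('a \<Rightarrow> 'b) \<Rightarrow> _)"
    by (auto simp: symp_def l2_rel_def elim: eventually_mono)
  show "transp (l2_rel :: ('a \<Rightarrow> 'b) \<Rightarrow> _)"
    unfolding transp_def l2_rel_def by (auto elim: eventually_elim2)
qed

definition l2_of :: "('a::euclidean_space \<Rightarrow> 'b::euclidean_space) \<Rightarrow> ('a, 'b) l2" where
  "l2_of = abs_l2"

definition l2_fun :: "('a::euclidean_space, 'b::euclidean_space) l2 \<Rightarrow> 'a \<Rightarrow> 'b" where
  "l2_fun = rep_l2"

lemma square_integrable_l2_fun [simp]: "square_integrable (l2_fun x)"
  using Quotient3_rep_reflp[OF Quotient3_l2, of x] by (simp add: l2_fun_def l2_rel_def)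

lemma borel_measurable_l2_fun [measurable]: "l2_fun x \<in> borel_measurable lborel"
  by (rule square_integrableD) simp

lemma l2_of_l2_fun [simp]: "l2_of (l2_fun x) = x"
  using Quotient3_abs_rep[OF Quotient3_l2, of x] by (simp add: l2_fun_def l2_of_def)

lemma AE_l2_fun_l2_of: "square_integrable f \<Longrightarrow> AE x in lborel. l2_fun (l2_of f) x = f x"
  using Quotient3_rep_abs[OF Quotient3_l2, of f] by (simp add: l2_fun_def l2_of_def l2_rel_def)

lemma l2_eq_iff: "x = y \<longleftrightarrow> (AE t in lborel. l2_fun x t = l2_fun y t)"
  using Quotient3_rel_rep[OF Quotient3_l2, of x y] square_integrable_l2_fun[of x] square_integrable_l2_fun[of y]
  by (simp add: l2_fun_def l2_rel_def)

lemma l2_of_eqI: "square_integrable f \<Longrightarrow> AE t in lborel. l2_fun x t = f t \<Longrightarrow> x = l2_of f"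
  unfolding l2_eq_iff by (drule AE_l2_fun_l2_of) (erule (1) eventually_elim2, simp)

instantiation l2 :: (euclidean_space, euclidean_space) real_vector
begin

definition "0 = l2_of (\<lambda>_. 0)"
definition "x + y = l2_of (\<lambda>t. l2_fun x t + l2_fun y t)"
definition "- x = l2_of (\<lambda>t. - l2_fun x t)" for x :: "('a, 'b) l2"
definition "x - y = l2_of (\<lambda>t. l2_fun x t - l2_fun y t)"
definition "c *\<^sub>R x = l2_of (\<lambda>t. c *\<^sub>R l2_fun x t)"

lemma AE_l2_ops:
  fixes x y :: "('a, 'b) l2"
  shows "AE t in lborel. l2_fun (0 :: ('a, 'b) l2) t = 0"
    and "AE t in lborel. l2_fun (x + y) t = l2_fun x t + l2_fun y t"
    and "AE t in lborel. l2_fun (- x) t = - l2_fun x t"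
    and "AE t in lborel. l2_fun (x - y) t = l2_fun x t - l2_fun y t"
    and "AE t in lborel. l2_fun (c *\<^sub>R x) t = c *\<^sub>R l2_fun x t"
  unfolding zero_l2_def plus_l2_def uminus_l2_def minus_l2_def scaleR_l2_def
  by (intro AE_l2_fun_l2_of square_integrable_0 square_integrable_add square_integrable_uminus
      square_integrable_diff square_integrable_scaleR square_integrable_l2_fun)+

instance
proof
  fix x y z :: "('a, 'b) l2" and a b :: real
  show "x + y + z = x + (y + z)"
    unfolding l2_eq_iff using AE_l2_ops(2)[of "x + y" z] AE_l2_ops(2)[of x y] AE_l2_ops(2)[of x "y + z"] AE_l2_ops(2)[of y z]
    by eventually_elim (simp add: algebra_simps)
  show "x + y = y + x"
    unfolding l2_eq_iff using AE_l2_ops(2)[of x y] AE_l2_ops(2)[of y x]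
    by eventually_elim (simp add: algebra_simps)
  show "0 + x = x"
    unfolding l2_eq_iff using AE_l2_ops(2)[of 0 x] AE_l2_ops(1)
    by eventually_elim (simp add: algebra_simps)
  show "- x + x = 0"
    unfolding l2_eq_iff using AE_l2_ops(2)[of "- x" x] AE_l2_ops(1) AE_l2_ops(3)[of x]
    by eventually_elim (simp add: algebra_simps)
  show "x - y = x + - y"
    unfolding l2_eq_iff using AE_l2_ops(2)[of x "- y"] AE_l2_ops(4)[of x y] AE_l2_ops(3)[of y]
    by eventually_elim simp
  show "a *\<^sub>R (x + y) = a *\<^sub>R x + a *\<^sub>R y"
    unfolding l2_eq_iff using AE_l2_ops(5)[of a "x + y"] AE_l2_ops(2)[of x y] AE_l2_ops(2)[of "a *\<^sub>R x" "a *\<^sub>R y"]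
      AE_l2_ops(5)[of a x] AE_l2_ops(5)[of a y]
    by eventually_elim (simp add: algebra_simps)
  show "(a + b) *\<^sub>R x = a *\<^sub>R x + b *\<^sub>R x"
    unfolding l2_eq_iff using AE_l2_ops(5)[of "a + b" x] AE_l2_ops(2)[of "a *\<^sub>R x" "b *\<^sub>R x"]
      AE_l2_ops(5)[of a x] AE_l2_ops(5)[of b x]
    by eventually_elim (simp add: algebra_simps)
  show "a *\<^sub>R b *\<^sub>R x = (a * b) *\<^sub>R x"
    unfolding l2_eq_iff using AE_l2_ops(5)[of a "b *\<^sub>R x"] AE_l2_ops(5)[of b x] AE_l2_ops(5)[of "a * b" x]
    by eventually_elim (simp add: algebra_simps)
  show "1 *\<^sub>R x = x"
    unfolding l2_eq_iff using AE_l2_ops(5)[of 1 x]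
    by eventually_elim simp
qed

end

instantiation l2 :: (euclidean_space, euclidean_space) real_inner
begin

definition "inner x y = (LINT t|lborel. inner (l2_fun x t) (l2_fun y t))" for x y :: "('a, 'b) l2"
definition "norm x = sqrt (inner x x)" for x :: "('a, 'b) l2"
definition "dist x y = norm (x - y)" for x y :: "('a, 'b) l2"
definition "sgn x = x /\<^sub>R norm x" for x :: "('a, 'b) l2"
definition [code del]: "uniformity = (INF e\<in>{0<..}. principal {(x, y::('a, 'b) l2). dist x y < e})"
definition [code del]: "open U = (\<forall>x::('a, 'b) l2\<in>U. \<forall>\<^sub>F (x', y) in uniformity. x' = x \<longrightarrow> y \<in> U)"

instance
proof
  fix x y z :: "('a, 'b) l2" and r :: real and U :: "('a, 'b) l2 set"
  show "dist x y = norm (x - y)" "sgn x = x /\<^sub>R norm x" "norm x = sqrt (inner x x)"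
    by (fact dist_l2_def sgn_l2_def norm_l2_def)+
  show "uniformity = (INF e\<in>{0<..}. principal {(x, y::('a, 'b) l2). dist x y < e})"
    by (fact uniformity_l2_def)
  show "open U = (\<forall>x\<in>U. \<forall>\<^sub>F (x', y) in uniformity. x' = x \<longrightarrow> y \<in> U)"
    by (fact open_l2_def)
  show "inner x y = inner y x"
    by (simp add: inner_l2_def inner_commute)
  have int: "integrable lborel (\<lambda>t. inner (l2_fun u t) (l2_fun v t))" for u v :: "('a, 'b) l2"
    by (rule integrable_inner_square_integrable) simp_all
  have "inner (x + y) z = (LINT t|lborel. inner (l2_fun x t) (l2_fun z t) + inner (l2_fun y t) (l2_fun z t))"
    unfolding inner_l2_def
    by (rule integral_cong_AE) (measurable, use AE_l2_ops(2)[of x y] in eventually_elim, simp add: inner_add_left)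
  then show "inner (x + y) z = inner x z + inner y z"
    using int by (simp add: inner_l2_def)
  have "inner (r *\<^sub>R x) y = (LINT t|lborel. r * inner (l2_fun x t) (l2_fun y t))"
    unfolding inner_l2_def
    by (rule integral_cong_AE) (measurable, use AE_l2_ops(5)[of r x] in eventually_elim, simp)
  then show "inner (r *\<^sub>R x) y = r * inner x y"
    using int by (simp add: inner_l2_def)
  show "0 \<le> inner x x"
    by (simp add: inner_l2_def)
  show "inner x x = 0 \<longleftrightarrow> x = 0"
  proof -
    have "inner x x = 0 \<longleftrightarrow> (AE t in lborel. inner (l2_fun x t) (l2_fun x t) = 0)"
      unfolding inner_l2_def by (rule integral_nonneg_eq_0_iff_AE[OF int]) simp
    also have "\<dots> \<longleftrightarrow> (AE t in lborel. l2_fun x t = l2_fun 0 t)"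
      using AE_l2_ops(1) by (intro eventually_subst) (auto elim: eventually_mono)
    finally show ?thesis by (simp add: l2_eq_iff)
  qed
qed

end

lemma inner_l2_of:
  assumes "square_integrable f"
  shows "inner (l2_of f) x = (LINT t|lborel. inner (f t) (l2_fun x t))"
  unfolding inner_l2_def
  by (rule integral_cong_AE) (use assms in measurable, use AE_l2_fun_l2_of[OF assms] in eventually_elim, simp)

lemma norm_l2_square: "(norm x)\<^sup>2 = (LINT t|lborel. (norm (l2_fun x t))\<^sup>2)"
  for x :: "('a::euclidean_space, 'b::euclidean_space) l2"
  unfolding power2_norm_eq_inner by (simp add: inner_l2_def)

lemma norm_l2_diff_square:
  "(norm (x - y))\<^sup>2 = (LINT t|lborel. (norm (l2_fun x t - l2_fun y t))\<^sup>2)"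
  for x y :: "('a::euclidean_space, 'b::euclidean_space) l2"
  unfolding norm_l2_square
  by (rule integral_cong_AE) (measurable, use AE_l2_ops(4)[of x y] in eventually_elim, simp)

lemma nn_integral_l2_diff:
  "(\<integral>\<^sup>+t. ennreal ((norm (l2_fun x t - l2_fun y t))\<^sup>2) \<partial>lborel) = ennreal ((norm (x - y))\<^sup>2)"
  for x y :: "('a::euclidean_space, 'b::euclidean_space) l2"
  unfolding norm_l2_diff_square
  by (rule nn_integral_eq_integral[OF square_integrable_norm[OF square_integrable_diff]]) simp_all

lemma Cauchy_rapid_subsequence:
  fixes X :: "nat \<Rightarrow> 'a::metric_space"
  assumes "Cauchy X" "\<And>k. (e::nat \<Rightarrow> real) k > 0"
  shows "\<exists>r. strict_mono (r :: nat \<Rightarrow> nat) \<and> (\<forall>k. \<forall>n\<ge>r k. dist (X n) (X (r k)) < e k)"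
proof -
  have M: "\<exists>M. \<forall>m\<ge>M. \<forall>n\<ge>M. dist (X m) (X n) < e k" for k
    using assms unfolding Cauchy_def by blast
  have "\<exists>r. \<forall>k. (\<forall>n\<ge>r k. dist (X n) (X (r k)) < e k) \<and> (r k :: nat) < r (Suc k)"
  proof (rule dependent_nat_choice)
    show "\<exists>x. \<forall>n\<ge>x. dist (X n) (X x) < e 0"
      using M[of 0] by blast
    fix x k :: nat
    obtain N where "\<forall>m\<ge>N. \<forall>n\<ge>N. dist (X m) (X n) < e (Suc k)"
      using M[of "Suc k"] by blast
    then show "\<exists>y. (\<forall>n\<ge>y. dist (X n) (X y) < e (Suc k)) \<and> x < y"
      by (intro exI[of _ "max N (Suc x)"]) auto
  qed
  then show ?thesis by (auto simp: strict_mono_Suc_iff)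
qed

text \<open>
  The weighted series \<open>\<Sum> 2 ^ k * \<bar>d k\<bar>\<^sup>2\<close> of the squared increments has a finite integral, hence
  converges almost everywhere; since \<open>\<bar>d k\<bar> \<le> 2 ^ k * \<bar>d k\<bar>\<^sup>2 + (1/2) ^ k\<close>, so does \<open>\<Sum> \<bar>d k\<bar>\<close>.
\<close>

lemma rapid_l2_sequence_converges_AE:
  fixes X :: "nat \<Rightarrow> ('a::euclidean_space, 'b::euclidean_space) l2"
  assumes rapid: "\<And>k. norm (X (Suc k) - X k) \<le> (1/4) ^ k"
  shows "AE t in lborel. convergent (\<lambda>k. l2_fun (X k) t)"
proof -
  let ?d = "\<lambda>k t. norm (l2_fun (X (Suc k)) t - l2_fun (X k) t)"
  have "(\<integral>\<^sup>+t. (\<Sum>k. ennreal (2 ^ k * (?d k t)\<^sup>2)) \<partial>lborel)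
      = (\<Sum>k. \<integral>\<^sup>+t. ennreal (2 ^ k * (?d k t)\<^sup>2) \<partial>lborel)"
    by (rule nn_integral_suminf) measurable
  also have "\<dots> = (\<Sum>k. ennreal (2 ^ k * (norm (X (Suc k) - X k))\<^sup>2))"
    by (simp add: ennreal_mult nn_integral_cmult nn_integral_l2_diff)
  also have "\<dots> \<le> (\<Sum>k. ennreal ((1/8) ^ k))"
  proof (intro suminf_le ennreal_leI)
    fix k
    have "2 ^ k * (norm (X (Suc k) - X k))\<^sup>2 \<le> 2 ^ k * ((1/4) ^ k)\<^sup>2"
      by (intro mult_left_mono power_mono rapid) auto
    also have "\<dots> = (2 * ((1/4) * (1/4))) ^ k"
      by (simp only: power_mult_distrib power2_eq_square)
    also have "\<dots> = (1/8) ^ k" by simp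
    finally show "2 ^ k * (norm (X (Suc k) - X k))\<^sup>2 \<le> (1/8) ^ k" .
  qed auto
  also have "\<dots> = ennreal (\<Sum>k. (1/8) ^ k)"
    by (intro suminf_ennreal2) auto
  also have "\<dots> < \<infinity>" by simp
  finally have "AE t in lborel. (\<Sum>k. ennreal (2 ^ k * (?d k t)\<^sup>2)) \<noteq> \<infinity>"
    by (intro nn_integral_noteq_infinite) auto
  then show ?thesis
  proof eventually_elim
    fix t assume "(\<Sum>k. ennreal (2 ^ k * (?d k t)\<^sup>2)) \<noteq> \<infinity>"
    then have s: "summable (\<lambda>k. 2 ^ k * (?d k t)\<^sup>2)"
      by (intro summable_suminf_not_top) auto
    have "summable (\<lambda>k. ?d k t)"
    proof (rule summable_comparison_test_ev)
      show "summable (\<lambda>k. 2 ^ k * (?d k t)\<^sup>2 + (1/2) ^ k)"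
        by (intro summable_add s summable_geometric) auto
      have "x \<le> 2 ^ k * x\<^sup>2 + (1/2) ^ k" if "x \<ge> 0" for x :: real and k :: nat
      proof -
        have "0 \<le> (2 ^ k * x - 1)\<^sup>2" by simp
        then have "2 * (2 ^ k * x) \<le> 2 ^ k * (2 ^ k * x\<^sup>2) + 1"
          by (simp add: power2_eq_square algebra_simps)
        moreover have "(1::real) = 2 ^ k * (1/2) ^ k"
          by (simp flip: power_mult_distrib)
        ultimately have "2 ^ k * (2 * x) \<le> 2 ^ k * (2 ^ k * x\<^sup>2 + (1/2) ^ k)"
          by (simp add: algebra_simps)
        then have "2 * x \<le> 2 ^ k * x\<^sup>2 + (1/2) ^ k" by (simp only: mult_le_cancel_left_pos zero_less_power zero_less_numeral)
        then show ?thesis using that by linarith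
      qed
      then show "\<forall>\<^sub>F k in sequentially. norm (?d k t) \<le> 2 ^ k * (?d k t)\<^sup>2 + (1/2) ^ k" by simp
    qed
    then have "summable (\<lambda>k. l2_fun (X (Suc k)) t - l2_fun (X k) t)"
      by (rule summable_norm_cancel)
    then have "convergent (\<lambda>n. \<Sum>k<n. l2_fun (X (Suc k)) t - l2_fun (X k) t)"
      by (simp add: summable_iff_convergent)
    then have "convergent (\<lambda>n. l2_fun (X n) t - l2_fun (X 0) t)"
      by (simp only: sum_lessThan_telescope[of "\<lambda>k. l2_fun (X k) t"])
    then have "convergent (\<lambda>n. (l2_fun (X n) t - l2_fun (X 0) t) + l2_fun (X 0) t)"
      by (intro convergent_add convergent_const)
    then show "convergent (\<lambda>k. l2_fun (X k) t)" by simp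
  qed
qed

text \<open>
  A rapidly convergent subsequence has a pointwise limit almost everywhere; Fatou's lemma shows
  that this limit is square integrable and is the limit in norm.
\<close>

instance l2 :: (euclidean_space, euclidean_space) complete_space
proof
  fix X :: "nat \<Rightarrow> ('a, 'b) l2" assume X: "Cauchy X"
  obtain r where r: "strict_mono r" "\<And>k n. n \<ge> r k \<Longrightarrow> dist (X n) (X (r k)) < (1/4) ^ k"
    using Cauchy_rapid_subsequence[OF X, of "\<lambda>k. (1/4) ^ k"] by auto
  define Y where "Y k = X (r k)" for k
  have Y: "norm (Y n - Y k) \<le> (1/4) ^ k" if "n \<ge> k" for n k
    using r(2)[of k "r n"] strict_mono_less_eq[OF r(1)] that by (simp add: Y_def dist_norm less_imp_le)
  define f where "f t = lim (\<lambda>k. l2_fun (Y k) t)" for t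
  have f_meas [measurable]: "f \<in> borel_measurable lborel"
    unfolding f_def[abs_def] by (rule borel_measurable_lim_metric) measurable
  have AE: "AE t in lborel. (\<lambda>k. l2_fun (Y k) t) \<longlonglongrightarrow> f t"
    using rapid_l2_sequence_converges_AE[of Y] Y unfolding f_def
    by (auto elim!: eventually_mono simp: convergent_LIMSEQ_iff)
  have fatou: "(\<integral>\<^sup>+t. ennreal ((norm (f t - l2_fun (Y k) t))\<^sup>2) \<partial>lborel) \<le> ennreal (((1/4) ^ k)\<^sup>2)" for k
  proof -
    have "(\<integral>\<^sup>+t. ennreal ((norm (f t - l2_fun (Y k) t))\<^sup>2) \<partial>lborel)
        = (\<integral>\<^sup>+t. liminf (\<lambda>n. ennreal ((norm (l2_fun (Y n) t - l2_fun (Y k) t))\<^sup>2)) \<partial>lborel)"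
    proof (rule nn_integral_cong_AE)
      show "AE t in lborel. ennreal ((norm (f t - l2_fun (Y k) t))\<^sup>2)
          = liminf (\<lambda>n. ennreal ((norm (l2_fun (Y n) t - l2_fun (Y k) t))\<^sup>2))"
        using AE
      proof eventually_elim
        fix t assume "(\<lambda>k. l2_fun (Y k) t) \<longlonglongrightarrow> f t"
        then have "(\<lambda>n. ennreal ((norm (l2_fun (Y n) t - l2_fun (Y k) t))\<^sup>2))
            \<longlonglongrightarrow> ennreal ((norm (f t - l2_fun (Y k) t))\<^sup>2)"
          by (intro tendsto_intros)
        then show "ennreal ((norm (f t - l2_fun (Y k) t))\<^sup>2)
            = liminf (\<lambda>n. ennreal ((norm (l2_fun (Y n) t - l2_fun (Y k) t))\<^sup>2))"
          by (intro lim_imp_Liminf[symmetric]) auto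
      qed
    qed
    also have "\<dots> \<le> liminf (\<lambda>n. \<integral>\<^sup>+t. ennreal ((norm (l2_fun (Y n) t - l2_fun (Y k) t))\<^sup>2) \<partial>lborel)"
      by (rule nn_integral_liminf) measurable
    also have "\<dots> \<le> ennreal (((1/4) ^ k)\<^sup>2)"
      unfolding nn_integral_l2_diff
    proof (rule Liminf_le)
      show "\<forall>\<^sub>F n in sequentially. ennreal ((norm (Y n - Y k))\<^sup>2) \<le> ennreal (((1/4) ^ k)\<^sup>2)"
        using Y by (intro eventually_sequentiallyI[of k] ennreal_leI power_mono) auto
    qed simp
    finally show ?thesis .
  qed
  have sq: "square_integrable (\<lambda>t. f t - l2_fun (Y k) t)" for k
  proof -
    have "(\<integral>\<^sup>+t. ennreal ((norm (f t - l2_fun (Y k) t))\<^sup>2) \<partial>lborel) < \<infinity>"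
      using fatou[of k] by (rule le_less_trans) simp
    then show ?thesis
      unfolding square_integrable_def by (auto intro!: integrableI_nonneg)
  qed
  have sqf: "square_integrable f"
    using square_integrable_add[OF sq[of 0] square_integrable_l2_fun[of "Y 0"]] by simp
  have "norm (Y k - l2_of f) \<le> (1/4) ^ k" for k
  proof -
    have "(norm (l2_of f - Y k))\<^sup>2 = (LINT t|lborel. (norm (f t - l2_fun (Y k) t))\<^sup>2)"
      unfolding norm_l2_diff_square
      by (rule integral_cong_AE) (measurable, use AE_l2_fun_l2_of[OF sqf] in eventually_elim, simp)
    also have "ennreal \<dots> \<le> ennreal (((1/4) ^ k)\<^sup>2)"
      using fatou[of k] nn_integral_eq_integral[OF square_integrable_norm[OF sq[of k]]] by simp
    finally have "(norm (l2_of f - Y k))\<^sup>2 \<le> ((1/4) ^ k)\<^sup>2"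
      by (simp add: ennreal_le_iff)
    then have "norm (l2_of f - Y k) \<le> (1/4) ^ k"
      by (rule power2_le_imp_le) simp
    then show ?thesis by (simp only: norm_minus_commute)
  qed
  then have "(\<lambda>k. Y k - l2_of f) \<longlonglongrightarrow> 0"
  proof (rule Lim_null_comparison[OF always_eventually[OF allI]])
    show "(\<lambda>k. (1/4) ^ k :: real) \<longlonglongrightarrow> 0"
      by (rule LIMSEQ_power_zero) simp
  qed
  then have "Y \<longlonglongrightarrow> l2_of f" by (simp only: LIM_zero_iff)
  then have "(X \<circ> r) \<longlonglongrightarrow> l2_of f" by (simp add: Y_def[abs_def] o_def)
  then show "convergent X"
    using Cauchy_converges_subseq[OF X r(1)] unfolding convergent_def by blast
qed

section \<open>Test functions\<close>

text \<open>
  These functions are smooth on the whole line, and their derivatives are combinations of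
  functions of the same family.
\<close>

definition flat_exp :: "nat \<Rightarrow> real \<Rightarrow> real" where
  "flat_exp j t = (if t > 0 then exp (- 1 / t) / t ^ j else 0)"

lemma power_le_fact_exp:
  fixes s :: real assumes "s \<ge> 0"
  shows "s ^ k \<le> fact k * exp s"
proof -
  have "(\<Sum>n\<in>{k}. s ^ n /\<^sub>R fact n) \<le> (\<Sum>n. s ^ n /\<^sub>R fact n)"
    by (rule sum_le_suminf[OF summable_exp_generic]) (use assms in auto)
  then have "s ^ k / fact k \<le> exp s"
    by (simp add: exp_def divide_inverse_commute)
  then show ?thesis by (simp add: field_simps)
qed

lemma flat_exp_nonneg: "0 \<le> flat_exp j t"
  by (simp add: flat_exp_def)

lemma flat_exp_power_le:
  assumes "t > 0"
  shows "flat_exp j t \<le> fact (j + k) * t ^ k"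
proof -
  have "exp (- 1 / t) * (1 / t) ^ (j + k) \<le> exp (- 1 / t) * (fact (j + k) * exp (1 / t))"
    using assms by (intro mult_left_mono power_le_fact_exp) auto
  also have "\<dots> = fact (j + k)"
    by (simp add: exp_minus)
  finally have "t ^ k * (exp (- 1 / t) * (1 / t) ^ (j + k)) \<le> t ^ k * fact (j + k)"
    using assms by (intro mult_left_mono) auto
  also have "t ^ k * (exp (- 1 / t) * (1 / t) ^ (j + k)) = exp (- 1 / t) / t ^ j"
    using assms by (simp add: power_add power_divide)
  finally show ?thesis
    using assms by (simp add: flat_exp_def mult.commute)
qed

lemma flat_exp_bounded: "flat_exp j t \<le> fact j"
  using flat_exp_power_le[of t j 0] by (cases "t > 0") (auto simp: flat_exp_def)

lemma flat_exp_Suc: "flat_exp (Suc j) t = flat_exp j t / t"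
  by (simp add: flat_exp_def)

lemma flat_exp_has_derivative:
  "(flat_exp j has_real_derivative flat_exp (j + 2) t - real j * flat_exp (Suc j) t) (at t)"
proof -
  consider "t > 0" | "t < 0" | "t = 0" by linarith
  then show ?thesis
  proof cases
    case 1
    then show ?thesis
    proof (induction j)
      case 0
      have "((\<lambda>t. exp (- 1 / t)) has_real_derivative flat_exp 2 t) (at t)"
        using 0 by (auto intro!: derivative_eq_intros simp: flat_exp_def power2_eq_square)
      then have "(flat_exp 0 has_real_derivative flat_exp 2 t) (at t)"
        by (rule has_field_derivative_transform_within_open[of _ _ _ "{0<..}"])
           (use 0 in \<open>auto simp: flat_exp_def\<close>)
      then show ?case by (simp add: numeral_2_eq_2)
    next
      case (Suc j)
      have "((\<lambda>t. flat_exp j t / t) has_real_derivative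
          ((flat_exp (j + 2) t - real j * flat_exp (Suc j) t) * t - flat_exp j t * 1) / (t * t)) (at t)"
        using Suc by (intro DERIV_divide DERIV_ident) auto
      moreover have "((flat_exp (j + 2) t - real j * flat_exp (Suc j) t) * t - flat_exp j t * 1) / (t * t)
          = flat_exp (Suc j + 2) t - real (Suc j) * flat_exp (Suc (Suc j)) t"
        using Suc.prems by (simp add: flat_exp_Suc numeral_2_eq_2 field_simps)
      moreover have "(\<lambda>t. flat_exp j t / t) = flat_exp (Suc j)"
        by (rule ext) (rule flat_exp_Suc[symmetric])
      ultimately show ?case by (simp only:)
    qed
  next
    case 2
    have "((\<lambda>t. 0) has_real_derivative flat_exp (j + 2) t - real j * flat_exp (Suc j) t) (at t)"
      using 2 by (simp add: flat_exp_def)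
    then show ?thesis
      by (rule has_field_derivative_transform_within_open[of _ _ _ "{..<0}"]) (use 2 in \<open>auto simp: flat_exp_def\<close>)
  next
    case 3
    have "((\<lambda>h. flat_exp j h / h) \<longlongrightarrow> 0) (at 0)"
    proof (rule Lim_null_comparison)
      have "norm (flat_exp j h / h) \<le> fact (Suc (Suc j)) * \<bar>h\<bar>" for h
        using flat_exp_power_le[of h "Suc j" 1] flat_exp_nonneg[of "Suc j" h]
        by (cases "h > 0") (simp_all add: flat_exp_Suc flat_exp_def[of j h] mult_nonneg_nonpos not_less del: fact_Suc)
      then show "\<forall>\<^sub>F h in at 0. norm (flat_exp j h / h) \<le> fact (Suc (Suc j)) * \<bar>h\<bar>" by simp
      have "((\<lambda>h::real. fact (Suc (Suc j)) * \<bar>h\<bar>) \<longlongrightarrow> fact (Suc (Suc j)) * \<bar>0\<bar>) (at 0)"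
        by (intro tendsto_intros)
      then show "((\<lambda>h::real. fact (Suc (Suc j)) * \<bar>h\<bar>) \<longlongrightarrow> 0) (at 0)" by simp
    qed
    then show ?thesis
      unfolding 3 DERIV_def by (simp add: flat_exp_def)
  qed
qed

lemma continuous_on_flat_exp: "continuous_on UNIV (flat_exp j)"
  by (rule continuous_at_imp_continuous_on) (use DERIV_isCont[OF flat_exp_has_derivative[of j]] in simp)

lemma borel_measurable_flat_exp [measurable]: "flat_exp j \<in> borel_measurable borel"
  by (rule borel_measurable_continuous_onI[OF continuous_on_flat_exp])

text \<open>
  This algebra of functions contains a bump and is closed under partial derivatives, so that all
  its members have continuous derivatives of every order.
\<close>

inductive bump_algebra :: "'a::euclidean_space \<Rightarrow> real \<Rightarrow> ('a \<Rightarrow> real) \<Rightarrow> bool" for c r where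
  const: "bump_algebra c r (\<lambda>_. a)"
| coord: "bump_algebra c r (\<lambda>x. inner (x - c) i)"
| bump: "bump_algebra c r (\<lambda>x. flat_exp j (r\<^sup>2 - inner (x - c) (x - c)))"
| add: "bump_algebra c r f \<Longrightarrow> bump_algebra c r g \<Longrightarrow> bump_algebra c r (\<lambda>x. f x + g x)"
| mult: "bump_algebra c r f \<Longrightarrow> bump_algebra c r g \<Longrightarrow> bump_algebra c r (\<lambda>x. f x * g x)"

lemma bump_algebra_derivative:
  assumes "bump_algebra c r f"
  shows "\<exists>D. \<forall>x. (f has_derivative D x) (at x) \<and> (\<forall>i. bump_algebra c r (\<lambda>x. D x i))"
  using assms
proof induction
  case (const a)
  show ?case
    by (intro exI[of _ "\<lambda>_ _. 0"]) (auto intro: bump_algebra.const)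
next
  case (coord i)
  show ?case
    by (intro exI[of _ "\<lambda>_ h. inner h i"]) (auto intro!: bump_algebra.const derivative_eq_intros)
next
  case (bump j)
  let ?s = "\<lambda>x. r\<^sup>2 - inner (x - c) (x - c)"
  let ?D = "\<lambda>x h. (flat_exp (j + 2) (?s x) + (- real j) * flat_exp (Suc j) (?s x)) * (- 2 * inner (x - c) h)"
  have D1: "((\<lambda>x. flat_exp j (?s x)) has_derivative ?D x) (at x)" for x
  proof -
    have s: "(?s has_derivative (\<lambda>h. - 2 * inner (x - c) h)) (at x)"
      by (auto intro!: derivative_eq_intros simp: inner_commute)
    have "(flat_exp j has_derivative (*) (flat_exp (j + 2) (?s x) + (- real j) * flat_exp (Suc j) (?s x))) (at (?s x))"
      using flat_exp_has_derivative[of j "?s x"] by (simp add: has_field_derivative_def)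
    from diff_chain_at[OF s this] show ?thesis by (simp add: o_def)
  qed
  have D2: "bump_algebra c r (\<lambda>x. ?D x i)" for i
    by (intro bump_algebra.intros)
  show ?case
    by (intro exI[of _ ?D] allI conjI D1 D2)
next
  case (add f g)
  obtain D where D: "\<And>x. (f has_derivative D x) (at x)" "\<And>i. bump_algebra c r (\<lambda>x. D x i)"
    using add.IH(1) by blast
  obtain E where E: "\<And>x. (g has_derivative E x) (at x)" "\<And>i. bump_algebra c r (\<lambda>x. E x i)"
    using add.IH(2) by blast
  show ?case
    by (intro exI[of _ "\<lambda>x h. D x h + E x h"] allI conjI has_derivative_add bump_algebra.add D E)
next
  case (mult f g)
  obtain D where D: "\<And>x. (f has_derivative D x) (at x)" "\<And>i. bump_algebra c r (\<lambda>x. D x i)"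
    using mult.IH(1) by blast
  obtain E where E: "\<And>x. (g has_derivative E x) (at x)" "\<And>i. bump_algebra c r (\<lambda>x. E x i)"
    using mult.IH(2) by blast
  show ?case
    by (intro exI[of _ "\<lambda>x h. f x * E x h + D x h * g x"] allI conjI has_derivative_mult
        bump_algebra.add bump_algebra.mult D E mult.hyps)
qed

lemma bump_algebra_Ck: "bump_algebra c r f \<Longrightarrow> Ck k f"
proof (induction k arbitrary: f)
  case 0
  obtain D where "\<And>x. (f has_derivative D x) (at x)"
    using bump_algebra_derivative[OF 0] by blast
  then show ?case
    by (auto intro!: continuous_at_imp_continuous_on has_derivative_continuous)
next
  case (Suc k)
  obtain D where D: "\<And>x. (f has_derivative D x) (at x)" "\<And>i. bump_algebra c r (\<lambda>x. D x i)"
    using bump_algebra_derivative[OF Suc.prems] by blast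
  have "frechet_derivative f (at x) = D x" for x
    by (rule frechet_derivative_at[OF D(1), symmetric])
  then show ?case
    using D Suc.IH by (auto simp: differentiable_def)
qed

definition bump :: "'a::euclidean_space \<Rightarrow> real \<Rightarrow> 'a \<Rightarrow> real" where
  "bump c r x = flat_exp 0 (r\<^sup>2 - inner (x - c) (x - c))"

lemma bump_pos_iff: "r > 0 \<Longrightarrow> 0 < bump c r x \<longleftrightarrow> dist c x < r"
proof -
  assume r: "r > 0"
  have "0 < bump c r x \<longleftrightarrow> (norm (x - c))\<^sup>2 < r\<^sup>2"
    by (simp add: bump_def flat_exp_def power2_norm_eq_inner)
  also have "\<dots> \<longleftrightarrow> norm (x - c) < r"
    using r power_mono_iff[of r "norm (x - c)" 2] by (simp add: not_le[symmetric])
  finally show ?thesis by (simp add: dist_norm norm_minus_commute)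
qed

lemma bump_nonneg: "0 \<le> bump c r x"
  by (simp add: bump_def flat_exp_nonneg)

lemma bump_le_1: "bump c r x \<le> 1"
  by (simp add: bump_def flat_exp_def)

lemma bump_eq_0: "r > 0 \<Longrightarrow> r \<le> dist c x \<Longrightarrow> bump c r x = 0"
  using bump_pos_iff[of r c x] bump_nonneg[of c r x] by linarith

lemma bump_translate: "bump c r (x + c) = bump 0 r x"
  by (simp add: bump_def)

lemma test_fun_bump: "r > 0 \<Longrightarrow> test_fun (bump c r)"
proof -
  assume r: "r > 0"
  have "bump_algebra c r (bump c r)"
    unfolding bump_def[abs_def] by (rule bump_algebra.bump)
  moreover have "{x. bump c r x \<noteq> 0} \<subseteq> cball c r"
    using bump_eq_0[OF r, of c] by (force simp: not_le)
  then have "compact (closure {x. bump c r x \<noteq> 0})"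
    by (meson bounded_cball bounded_subset compact_closure)
  ultimately show ?thesis
    unfolding test_fun_def using bump_algebra_Ck by blast
qed

context
  fixes \<phi> :: "'a::euclidean_space \<Rightarrow> real"
  assumes \<phi>: "test_fun \<phi>"
begin

lemma test_fun_has_derivative: "(\<phi> has_derivative frechet_derivative \<phi> (at x)) (at x)"
proof -
  have "Ck (Suc 0) \<phi>" using \<phi> unfolding test_fun_def by blast
  then show ?thesis by (simp add: frechet_derivative_works)
qed

lemma continuous_on_test_fun: "continuous_on A \<phi>"
  by (auto intro!: continuous_at_imp_continuous_on has_derivative_continuous test_fun_has_derivative)

lemma borel_measurable_test_fun: "\<phi> \<in> borel_measurable lborel"
  using borel_measurable_continuous_onI[OF continuous_on_test_fun] by simp

lemma test_fun_derivative_expand: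
  "frechet_derivative \<phi> (at x) y = (\<Sum>i\<in>Basis. (y \<bullet> i) * frechet_derivative \<phi> (at x) i)"
proof -
  interpret linear "frechet_derivative \<phi> (at x)"
    using test_fun_has_derivative by (rule has_derivative_linear)
  have "frechet_derivative \<phi> (at x) (\<Sum>i\<in>Basis. (y \<bullet> i) *\<^sub>R i)
      = (\<Sum>i\<in>Basis. (y \<bullet> i) * frechet_derivative \<phi> (at x) i)"
    unfolding sum scale by simp
  then show ?thesis by (simp only: euclidean_representation)
qed

lemma continuous_on_test_fun_derivative: "continuous_on A (\<lambda>x. frechet_derivative \<phi> (at x) y)"
proof -
  have "Ck (Suc (Suc 0)) \<phi>" using \<phi> unfolding test_fun_def by blast
  then have "continuous_on A (\<lambda>x. frechet_derivative \<phi> (at x) i)" if "i \<in> Basis" for i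
    using that by (auto intro!: continuous_at_imp_continuous_on differentiable_imp_continuous_within)
  then show ?thesis
    unfolding test_fun_derivative_expand[of _ y] by (intro continuous_intros)
qed

lemma borel_measurable_test_fun_derivative:
  "(\<lambda>x. frechet_derivative \<phi> (at x) y) \<in> borel_measurable lborel"
  using borel_measurable_continuous_onI[OF continuous_on_test_fun_derivative] by simp

lemma compact_test_fun_support: "compact (closure {x. \<phi> x \<noteq> 0})"
  using \<phi> by (simp add: test_fun_def)

lemma test_fun_eq_0: "x \<notin> closure {x. \<phi> x \<noteq> 0} \<Longrightarrow> \<phi> x = 0"
  using closure_subset[of "{x. \<phi> x \<noteq> 0}"] by auto

lemma test_fun_derivative_eq_0:
  assumes "x \<notin> closure {x. \<phi> x \<noteq> 0}"
  shows "frechet_derivative \<phi> (at x) y = 0"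
proof -
  have "((\<lambda>_. 0) has_derivative (\<lambda>_. 0)) (at x)" by simp
  then have "(\<phi> has_derivative (\<lambda>_. 0)) (at x)"
  proof (rule has_derivative_transform_within_open)
    show "open (- closure {x. \<phi> x \<noteq> 0})" by (rule open_Compl[OF closed_closure])
    show "x \<in> - closure {x. \<phi> x \<noteq> 0}" using assms by simp
    show "0 = \<phi> z" if "z \<in> - closure {x. \<phi> x \<noteq> 0}" for z
      by (rule test_fun_eq_0[symmetric]) (use that in blast)
  qed
  from frechet_derivative_at[OF this] show ?thesis by (simp add: fun_eq_iff)
qed

end

lemma continuous_compact_support_bounded:
  fixes f :: "'a::euclidean_space \<Rightarrow> real"
  assumes "continuous_on UNIV f" "compact K" "\<And>x. x \<notin> K \<Longrightarrow> f x = 0"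
  shows "\<exists>B\<ge>0. \<forall>x. \<bar>f x\<bar> \<le> B"
proof -
  have "bounded (f ` K)"
    by (intro compact_imp_bounded compact_continuous_image assms(2) continuous_on_subset[OF assms(1)]) simp
  then obtain B where "\<forall>x\<in>K. \<bar>f x\<bar> \<le> B"
    by (auto simp: bounded_iff)
  then have "\<bar>f x\<bar> \<le> max B 0" for x
    using assms(3)[of x] by (cases "x \<in> K") (auto simp: le_max_iff_disj)
  then show ?thesis by (intro exI[of _ "max B 0"]) auto
qed

lemma test_fun_bounded:
  assumes "test_fun \<phi>"
  shows "\<exists>B\<ge>0. \<forall>x. \<bar>\<phi> x\<bar> \<le> B" "\<exists>B\<ge>0. \<forall>x. \<bar>frechet_derivative \<phi> (at x) y\<bar> \<le> B"
proof -
  show "\<exists>B\<ge>0. \<forall>x. \<bar>\<phi> x\<bar> \<le> B"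
    using continuous_on_test_fun[OF assms] compact_test_fun_support[OF assms] test_fun_eq_0[OF assms]
    by (rule continuous_compact_support_bounded)
  show "\<exists>B\<ge>0. \<forall>x. \<bar>frechet_derivative \<phi> (at x) y\<bar> \<le> B"
    using continuous_on_test_fun_derivative[OF assms] compact_test_fun_support[OF assms]
      test_fun_derivative_eq_0[OF assms]
    by (rule continuous_compact_support_bounded)
qed

section \<open>Translations, averages and the fundamental lemma\<close>

lemma nn_integral_translate:
  fixes f :: "'a::euclidean_space \<Rightarrow> ennreal"
  assumes [measurable]: "f \<in> borel_measurable lborel"
  shows "(\<integral>\<^sup>+x. f (x + y) \<partial>lborel) = (\<integral>\<^sup>+x. f x \<partial>lborel)"
proof -
  have "(\<integral>\<^sup>+x. f x \<partial>lborel) = (\<integral>\<^sup>+x. f x \<partial>distr lborel borel ((+) y))"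
    by (simp add: lborel_distr_plus)
  also have "\<dots> = (\<integral>\<^sup>+x. f (y + x) \<partial>lborel)"
    by (subst nn_integral_distr) auto
  finally show ?thesis by (simp add: add.commute)
qed

lemma integrable_translate:
  fixes f :: "'a::euclidean_space \<Rightarrow> 'b::{banach, second_countable_topology}"
  assumes "integrable lborel f"
  shows "integrable lborel (\<lambda>x. f (x + y))"
proof -
  have "integrable (distr lborel borel ((+) y)) f"
    using assms by (simp add: lborel_distr_plus)
  then show ?thesis
    using assms by (subst (asm) integrable_distr_eq) (auto simp: add.commute)
qed

lemma integral_translate:
  fixes f :: "'a::euclidean_space \<Rightarrow> 'b::{banach, second_countable_topology}"
  assumes [measurable]: "f \<in> borel_measurable lborel"
  shows "(LINT x|lborel. f (x + y)) = (LINT x|lborel. f x)"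
proof -
  have "(LINT x|lborel. f x) = (LINT x|distr lborel borel ((+) y). f x)"
    by (simp add: lborel_distr_plus)
  also have "\<dots> = (LINT x|lborel. f (y + x))"
    by (subst integral_distr) auto
  finally show ?thesis by (simp add: add.commute)
qed

definition translation_continuous :: "('a::euclidean_space \<Rightarrow> real) \<Rightarrow> bool" where
  "translation_continuous f \<longleftrightarrow>
     (\<forall>Y. Y \<longlonglongrightarrow> 0 \<longrightarrow> (\<lambda>n. LINT x|lborel. \<bar>f (x + Y n) - f x\<bar>) \<longlonglongrightarrow> 0)"

lemma translation_continuous_limit:
  fixes f :: "'a::euclidean_space \<Rightarrow> real"
  assumes f: "integrable lborel f"
    and approx: "\<And>\<epsilon>. \<epsilon> > 0 \<Longrightarrow> \<exists>g. integrable lborel g \<and> translation_continuous g \<and> (LINT x|lborel. \<bar>f x - g x\<bar>) < \<epsilon>"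
  shows "translation_continuous f"
  unfolding translation_continuous_def
proof (intro allI impI)
  fix Y :: "nat \<Rightarrow> 'a" assume Y: "Y \<longlonglongrightarrow> 0"
  show "(\<lambda>n. LINT x|lborel. \<bar>f (x + Y n) - f x\<bar>) \<longlonglongrightarrow> 0"
  proof (rule LIMSEQ_I)
    fix \<epsilon> :: real assume "\<epsilon> > 0"
    then obtain g where g: "integrable lborel g" "translation_continuous g" "(LINT x|lborel. \<bar>f x - g x\<bar>) < \<epsilon> / 3"
      using approx[of "\<epsilon> / 3"] by auto
    have fm[measurable]: "f \<in> borel_measurable lborel" "g \<in> borel_measurable lborel"
      using f g(1) by auto
    have "(\<lambda>n. LINT x|lborel. \<bar>g (x + Y n) - g x\<bar>) \<longlonglongrightarrow> 0"
      using g(2) Y by (auto simp: translation_continuous_def)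
    from LIMSEQ_D[OF this, of "\<epsilon> / 3"] \<open>\<epsilon> > 0\<close>
    obtain N where N: "\<And>n. n \<ge> N \<Longrightarrow> norm ((LINT x|lborel. \<bar>g (x + Y n) - g x\<bar>) - 0) < \<epsilon> / 3"
      by auto
    have "norm ((LINT x|lborel. \<bar>f (x + Y n) - f x\<bar>) - 0) < \<epsilon>" if "n \<ge> N" for n
    proof -
      have int: "integrable lborel (\<lambda>x. f (x + Y n))" "integrable lborel (\<lambda>x. g (x + Y n))"
        by (intro integrable_translate f g)+
      have "(LINT x|lborel. \<bar>f (x + Y n) - f x\<bar>)
          \<le> (LINT x|lborel. \<bar>f (x + Y n) - g (x + Y n)\<bar> + \<bar>g (x + Y n) - g x\<bar> + \<bar>f x - g x\<bar>)"
        using int f g(1) by (intro integral_mono) auto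
      also have "\<dots> = (LINT x|lborel. \<bar>f (x + Y n) - g (x + Y n)\<bar>) + (LINT x|lborel. \<bar>g (x + Y n) - g x\<bar>)
          + (LINT x|lborel. \<bar>f x - g x\<bar>)"
        using int f g(1) by simp
      also have "(LINT x|lborel. \<bar>f (x + Y n) - g (x + Y n)\<bar>) = (LINT x|lborel. \<bar>f x - g x\<bar>)"
        by (rule integral_translate[of "\<lambda>x. \<bar>f x - g x\<bar>"]) simp
      also have "\<dots> + (LINT x|lborel. \<bar>g (x + Y n) - g x\<bar>) + (LINT x|lborel. \<bar>f x - g x\<bar>) < \<epsilon>"
        using g(3) N[OF that] by simp
      finally show ?thesis by simp
    qed
    then show "\<exists>N. \<forall>n\<ge>N. norm ((LINT x|lborel. \<bar>f (x + Y n) - f x\<bar>) - 0) < \<epsilon>" by blast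
  qed
qed

text \<open>
  The positive and negative parts of \<open>indicator U (x + y) - indicator U x\<close> have the same integral
  by translation invariance. Only points of \<open>U\<close> contribute to one of them, and \<open>U\<close> is open, so
  dominated convergence applies to that part.
\<close>

lemma translation_continuous_open:
  fixes U :: "'a::euclidean_space set"
  assumes U: "open U" "emeasure lborel U < \<infinity>"
  shows "translation_continuous (indicator U)"
  unfolding translation_continuous_def
proof (intro allI impI)
  fix Y :: "nat \<Rightarrow> 'a" assume Y: "Y \<longlonglongrightarrow> 0"
  let ?i = "indicator U :: 'a \<Rightarrow> real"
  have [measurable]: "U \<in> sets borel" using U(1) by simp
  have i: "integrable lborel ?i" using U(2) by simp
  have i': "integrable lborel (\<lambda>x. ?i (x + y))" for y
    by (rule integrable_translate[OF i])
  have "(LINT x|lborel. \<bar>?i (x + y) - ?i x\<bar>) = 2 * (LINT x|lborel. max 0 (?i x - ?i (x + y)))" for y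
  proof -
    have "(LINT x|lborel. \<bar>?i (x + y) - ?i x\<bar>)
        = (LINT x|lborel. 2 * max 0 (?i x - ?i (x + y)) + (?i (x + y) - ?i x))"
      by (intro Bochner_Integration.integral_cong) (auto simp: indicator_def)
    also have "\<dots> = 2 * (LINT x|lborel. max 0 (?i x - ?i (x + y))) + ((LINT x|lborel. ?i (x + y)) - (LINT x|lborel. ?i x))"
      using i i'[of y] by simp
    also have "(LINT x|lborel. ?i (x + y)) = (LINT x|lborel. ?i x)"
      by (rule integral_translate) simp
    finally show ?thesis by simp
  qed
  moreover have "(\<lambda>n. LINT x|lborel. max 0 (?i x - ?i (x + Y n))) \<longlonglongrightarrow> (LINT x|(lborel::'a measure). (0::real))"
  proof (rule integral_dominated_convergence[where w = ?i])
    show "AE x in lborel. (\<lambda>n. max 0 (?i x - ?i (x + Y n))) \<longlonglongrightarrow> 0"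
    proof (rule AE_I2)
      fix x
      show "(\<lambda>n. max 0 (?i x - ?i (x + Y n))) \<longlonglongrightarrow> 0"
      proof (cases "x \<in> U")
        case True
        have "(\<lambda>n. x + Y n) \<longlonglongrightarrow> x + 0" by (intro tendsto_intros Y)
        then have "\<forall>\<^sub>F n in sequentially. x + Y n \<in> U"
          using U(1) True by (auto intro: topological_tendstoD)
        then have "\<forall>\<^sub>F n in sequentially. max 0 (?i x - ?i (x + Y n)) = 0"
          by eventually_elim (use True in auto)
        then show ?thesis by (rule tendsto_eventually)
      next
        case False
        then have "max 0 (?i x - ?i (x + Y n)) = 0" for n by auto
        then show ?thesis by simp
      qed
    qed
    show "AE x in lborel. norm (max 0 (?i x - ?i (x + Y n))) \<le> ?i x" for n
      by (rule AE_I2) (auto simp: indicator_def)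
  qed (use i in auto)
  then have "(\<lambda>n. 2 * (LINT x|lborel. max 0 (?i x - ?i (x + Y n)))) \<longlonglongrightarrow> 2 * (LINT x|(lborel::'a measure). (0::real))"
    by (rule tendsto_mult_left)
  ultimately show "(\<lambda>n. LINT x|lborel. \<bar>?i (x + Y n) - ?i x\<bar>) \<longlonglongrightarrow> 0" by simp
qed

lemma translation_continuous_scale:
  assumes "translation_continuous f"
  shows "translation_continuous (\<lambda>x. f x * c)"
  unfolding translation_continuous_def
proof (intro allI impI)
  fix Y :: "nat \<Rightarrow> 'a" assume Y: "Y \<longlonglongrightarrow> 0"
  have eq: "\<bar>f (x + y) * c - f x * c\<bar> = \<bar>c\<bar> * \<bar>f (x + y) - f x\<bar>" for x y
    by (simp add: abs_mult flip: left_diff_distrib)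
  have "(\<lambda>n. \<bar>c\<bar> * (LINT x|lborel. \<bar>f (x + Y n) - f x\<bar>)) \<longlonglongrightarrow> \<bar>c\<bar> * 0"
    using assms Y by (intro tendsto_intros) (auto simp: translation_continuous_def)
  then show "(\<lambda>n. LINT x|lborel. \<bar>f (x + Y n) * c - f x * c\<bar>) \<longlonglongrightarrow> 0"
    unfolding eq by simp
qed

text \<open>
  Open sets approximate Borel sets of finite measure by outer regularity, and simple functions
  approximate integrable ones.
\<close>

theorem integrable_translation_continuous:
  fixes f :: "'a::euclidean_space \<Rightarrow> real"
  assumes "integrable lborel f"
  shows "translation_continuous f"
  using assms
proof (induction rule: integrable_induct)
  case (base A c)
  have A[measurable]: "A \<in> sets borel" using base by simp
  show ?case
  proof (rule translation_continuous_limit)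
    show "integrable lborel (\<lambda>x. indicator A x *\<^sub>R c)" using base by simp
    fix \<epsilon> :: real assume "\<epsilon> > 0"
    define d where "d = \<epsilon> / (\<bar>c\<bar> + 1)"
    have d: "d > 0" using \<open>\<epsilon> > 0\<close> by (simp add: d_def add_pos_nonneg)
    obtain U where U: "open U" "A \<subseteq> U" "emeasure lborel (U - A) < ennreal d"
      using outer_regular_lborel[OF A, of d] d by blast
    have [measurable]: "U \<in> sets borel" using U(1) by simp
    have "emeasure lborel U = emeasure lborel A + emeasure lborel (U - A)"
      using U(2) by (subst plus_emeasure) (auto simp: Un_absorb1)
    also have "\<dots> < \<infinity>"
      using base(2) U(3) by (auto simp: less_top intro: order.strict_trans)
    finally have fin: "emeasure lborel U < \<infinity>" .
    have eq: "\<bar>indicator A x *\<^sub>R c - indicator U x * c\<bar> = \<bar>c\<bar> * indicator (U - A) x" for x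
      using U(2) by (auto simp: indicator_def)
    have "emeasure lborel (U - A) < \<infinity>"
      using U(3) by (rule order.strict_trans) simp
    then have "(LINT x|lborel. \<bar>indicator A x *\<^sub>R c - indicator U x * c\<bar>) = \<bar>c\<bar> * measure lborel (U - A)"
      unfolding eq by simp
    also have "measure lborel (U - A) < d"
      using U(3) d emeasure_eq_ennreal_measure[of lborel "U - A"] \<open>emeasure lborel (U - A) < \<infinity>\<close>
      by (auto simp: ennreal_less_iff less_top)
    then have "\<bar>c\<bar> * measure lborel (U - A) \<le> \<bar>c\<bar> * d"
      by (intro mult_left_mono) auto
    also have "\<bar>c\<bar> * d < \<epsilon>"
      using \<open>\<epsilon> > 0\<close> by (simp add: d_def field_simps add_pos_nonneg)
    finally show "\<exists>g. integrable lborel g \<and> translation_continuous g \<and>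
        (LINT x|lborel. \<bar>indicator A x *\<^sub>R c - g x\<bar>) < \<epsilon>"
      using fin by (intro exI[of _ "\<lambda>x. indicator U x * c"] conjI translation_continuous_scale
          translation_continuous_open U) auto
  qed
next
  case (add f g)
  show ?case
    unfolding translation_continuous_def
  proof (intro allI impI)
    fix Y :: "nat \<Rightarrow> 'a" assume Y: "Y \<longlonglongrightarrow> 0"
    have int: "integrable lborel (\<lambda>x. f (x + Y n))" "integrable lborel (\<lambda>x. g (x + Y n))" for n
      using add by (auto intro: integrable_translate)
    show "(\<lambda>n. LINT x|lborel. \<bar>f (x + Y n) + g (x + Y n) - (f x + g x)\<bar>) \<longlonglongrightarrow> 0"
    proof (rule Lim_null_comparison)
      have "norm (LINT x|lborel. \<bar>f (x + Y n) + g (x + Y n) - (f x + g x)\<bar>)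
          \<le> (LINT x|lborel. \<bar>f (x + Y n) - f x\<bar>) + (LINT x|lborel. \<bar>g (x + Y n) - g x\<bar>)" for n
      proof -
        have "(LINT x|lborel. \<bar>f (x + Y n) + g (x + Y n) - (f x + g x)\<bar>)
            \<le> (LINT x|lborel. \<bar>f (x + Y n) - f x\<bar> + \<bar>g (x + Y n) - g x\<bar>)"
          using int[of n] add by (intro integral_mono) auto
        then show ?thesis using int[of n] add by simp
      qed
      then show "\<forall>\<^sub>F n in sequentially. norm (LINT x|lborel. \<bar>f (x + Y n) + g (x + Y n) - (f x + g x)\<bar>)
          \<le> (LINT x|lborel. \<bar>f (x + Y n) - f x\<bar>) + (LINT x|lborel. \<bar>g (x + Y n) - g x\<bar>)" by simp
      have "(\<lambda>n. (LINT x|lborel. \<bar>f (x + Y n) - f x\<bar>) + (LINT x|lborel. \<bar>g (x + Y n) - g x\<bar>)) \<longlonglongrightarrow> 0 + 0"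
        using add Y by (intro tendsto_add) (auto simp: translation_continuous_def)
      then show "(\<lambda>n. (LINT x|lborel. \<bar>f (x + Y n) - f x\<bar>) + (LINT x|lborel. \<bar>g (x + Y n) - g x\<bar>)) \<longlonglongrightarrow> 0" by simp
    qed
  qed
next
  case (lim f s)
  show ?case
  proof (rule translation_continuous_limit)
    fix \<epsilon> :: real assume "\<epsilon> > 0"
    have "(\<lambda>i. LINT x|lborel. \<bar>f x - s i x\<bar>) \<longlonglongrightarrow> (LINT x|(lborel::'a measure). (0::real))"
    proof (rule integral_dominated_convergence[where w = "\<lambda>x. 3 * \<bar>f x\<bar>"])
      show "AE x in lborel. (\<lambda>i. \<bar>f x - s i x\<bar>) \<longlonglongrightarrow> 0"
      proof (rule AE_I2)
        fix x
        have "(\<lambda>i. \<bar>f x - s i x\<bar>) \<longlonglongrightarrow> \<bar>f x - f x\<bar>"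
          using lim by (intro tendsto_intros) auto
        then show "(\<lambda>i. \<bar>f x - s i x\<bar>) \<longlonglongrightarrow> 0" by simp
      qed
      show "AE x in lborel. norm \<bar>f x - s i x\<bar> \<le> 3 * \<bar>f x\<bar>" for i
      proof (rule AE_I2)
        fix x
        have "norm (s i x) \<le> 2 * norm (f x)" by (rule lim) simp
        then show "norm \<bar>f x - s i x\<bar> \<le> 3 * \<bar>f x\<bar>" by simp
      qed
    qed (use lim in auto)
    then have "\<forall>\<^sub>F i in sequentially. (LINT x|lborel. \<bar>f x - s i x\<bar>) < \<epsilon>"
      using \<open>\<epsilon> > 0\<close> by (intro order_tendstoD(2)) auto
    then have "\<exists>i. (LINT x|lborel. \<bar>f x - s i x\<bar>) < \<epsilon>"
      by (rule eventually_happens'[OF sequentially_bot])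
    then show "\<exists>g. integrable lborel g \<and> translation_continuous g \<and> (LINT x|lborel. \<bar>f x - g x\<bar>) < \<epsilon>"
      using lim by blast
  qed (use lim in auto)
qed

text \<open>
  Convergence of these seminorms to \<open>0\<close> for all \<open>R\<close> is convergence in \<open>L\<^sup>1\<close> on bounded sets. Values
  in \<open>ennreal\<close> make Tonelli's theorem and the triangle inequality available without integrability
  conditions.
\<close>

definition local_norm :: "real \<Rightarrow> ('a::euclidean_space \<Rightarrow> real) \<Rightarrow> ennreal" where
  "local_norm R f = (\<integral>\<^sup>+x. ennreal \<bar>f x\<bar> * indicator (cball 0 R) x \<partial>lborel)"

lemma cball_sets_borel [measurable]: "cball c R \<in> sets borel"
  by simp

lemma compact_subset_cball:
  fixes K :: "'a::euclidean_space set"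
  assumes "compact K"
  shows "\<exists>R. K \<subseteq> cball 0 R"
  using compact_imp_bounded[OF assms] by (auto simp: bounded_iff subset_iff)

lemma local_norm_triangle:
  assumes [measurable]: "f \<in> borel_measurable lborel" "g \<in> borel_measurable lborel"
  shows "local_norm R (\<lambda>x. f x + g x) \<le> local_norm R f + local_norm R g"
proof -
  have "local_norm R (\<lambda>x. f x + g x)
      \<le> (\<integral>\<^sup>+x. ennreal \<bar>f x\<bar> * indicator (cball 0 R) x + ennreal \<bar>g x\<bar> * indicator (cball 0 R) x \<partial>lborel)"
    unfolding local_norm_def
    by (intro nn_integral_mono) (auto simp: indicator_def simp flip: ennreal_plus intro!: ennreal_leI)
  also have "\<dots> = local_norm R f + local_norm R g"
    unfolding local_norm_def by (rule nn_integral_add) measurable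
  finally show ?thesis .
qed

lemma local_norm_mono: "(\<And>x. \<bar>f x\<bar> \<le> \<bar>g x\<bar>) \<Longrightarrow> local_norm R f \<le> local_norm R g"
  unfolding local_norm_def by (intro nn_integral_mono mult_right_mono ennreal_leI) auto

lemma local_norm_zero_AE:
  assumes [measurable]: "f \<in> borel_measurable lborel" and "\<And>R. local_norm R f = 0"
  shows "AE x in lborel. f x = 0"
proof -
  have "AE x in lborel. ennreal \<bar>f x\<bar> * indicator (cball 0 (real n)) x = 0" for n
    using assms(2)[of "real n"] unfolding local_norm_def by (subst (asm) nn_integral_0_iff_AE) measurable
  then have "AE x in lborel. \<forall>n. ennreal \<bar>f x\<bar> * indicator (cball 0 (real n)) x = 0"
    unfolding AE_all_countable by blast
  then show ?thesis
  proof eventually_elim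
    fix x assume *: "\<forall>n. ennreal \<bar>f x\<bar> * indicator (cball 0 (real n)) x = 0"
    obtain n where "norm x \<le> real n" using real_arch_simple by blast
    then show "f x = 0" using spec[OF *, of n] by (simp add: indicator_def)
  qed
qed

lemma locally_integrable_measurable [measurable_dest]:
  "locally_integrable f \<Longrightarrow> f \<in> borel_measurable lborel"
  by (simp add: locally_integrable_def)

lemma locally_integrable_cball:
  fixes f :: "'a::euclidean_space \<Rightarrow> real"
  assumes "locally_integrable f"
  shows "integrable lborel (\<lambda>x. indicator (cball c R) x * f x)"
  using assms compact_cball[of c R] unfolding locally_integrable_def set_integrable_def by force

lemma local_norm_finite:
  assumes "locally_integrable f"
  shows "local_norm R f < \<infinity>"
proof -
  have "local_norm R f = (\<integral>\<^sup>+x. ennreal (norm (indicator (cball 0 R) x * f x)) \<partial>lborel)"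
    unfolding local_norm_def by (intro nn_integral_cong) (auto simp: indicator_def)
  then show ?thesis
    using locally_integrable_cball[OF assms, of 0 R] by (simp add: integrable_iff_bounded)
qed

text \<open>
  Cutting \<open>f\<close> off outside a ball of radius \<open>R + 1\<close> does not change translates by at most \<open>1\<close> inside
  \<open>cball 0 R\<close>, which reduces the claim to integrable functions.
\<close>

theorem local_translation_continuity:
  assumes f: "locally_integrable f" and "\<epsilon> > 0"
  shows "\<exists>\<delta>>0. \<forall>y. norm y \<le> \<delta> \<longrightarrow> local_norm R (\<lambda>x. f (x + y) - f x) \<le> ennreal \<epsilon>"
proof (rule ccontr)
  assume neg: "\<not> ?thesis"
  have "\<exists>y. norm y \<le> inverse (real (Suc n)) \<and> \<not> local_norm R (\<lambda>x. f (x + y) - f x) \<le> ennreal \<epsilon>" for n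
    using neg by (metis inverse_positive_iff_positive of_nat_0_less_iff zero_less_Suc)
  then obtain Y where Y: "\<And>n. norm (Y n) \<le> inverse (real (Suc n))"
    "\<And>n. \<not> local_norm R (\<lambda>x. f (x + Y n) - f x) \<le> ennreal \<epsilon>"
    by metis
  have Y0: "Y \<longlonglongrightarrow> 0"
    by (rule Lim_null_comparison[OF always_eventually LIMSEQ_inverse_real_of_nat]) (use Y(1) in auto)
  define F where "F x = indicator (cball 0 (R + 1)) x * f x" for x
  have F: "integrable lborel F"
    unfolding F_def by (rule locally_integrable_cball[OF f])
  have "(\<lambda>n. LINT x|lborel. \<bar>F (x + Y n) - F x\<bar>) \<longlonglongrightarrow> 0"
    using integrable_translation_continuous[OF F] Y0 by (simp add: translation_continuous_def)
  then obtain n where n: "(LINT x|lborel. \<bar>F (x + Y n) - F x\<bar>) < \<epsilon>"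
    using order_tendstoD(2)[of _ 0 sequentially \<epsilon>] \<open>\<epsilon> > 0\<close> by (auto simp: eventually_sequentially)
  have "norm (Y n) \<le> 1"
    using Y(1)[of n] by (rule order_trans) (simp add: inverse_le_1_iff)
  have "local_norm R (\<lambda>x. f (x + Y n) - f x) \<le> (\<integral>\<^sup>+x. ennreal \<bar>F (x + Y n) - F x\<bar> \<partial>lborel)"
    unfolding local_norm_def
  proof (rule nn_integral_mono)
    fix x :: 'a
    have "norm (x + Y n) \<le> R + 1 \<and> norm x \<le> R + 1" if "norm x \<le> R"
      using that \<open>norm (Y n) \<le> 1\<close> norm_triangle_ineq[of x "Y n"] by auto
    then show "ennreal \<bar>f (x + Y n) - f x\<bar> * indicator (cball 0 R) x \<le> ennreal \<bar>F (x + Y n) - F x\<bar>"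
      by (auto simp: F_def indicator_def)
  qed
  also have "\<dots> = ennreal (LINT x|lborel. \<bar>F (x + Y n) - F x\<bar>)"
    using F by (intro nn_integral_eq_integral) (auto intro!: integrable_translate)
  also have "\<dots> \<le> ennreal \<epsilon>"
    using n by (intro ennreal_leI) simp
  finally show False using Y(2)[of n] by simp
qed

definition mollifier :: "real \<Rightarrow> 'a::euclidean_space \<Rightarrow> 'a \<Rightarrow> real" where
  "mollifier h c x = bump c h x / (LINT z|lborel. bump (0::'a) h z)"

lemma borel_measurable_bump [measurable]: "bump c h \<in> borel_measurable borel"
  unfolding bump_def[abs_def] by measurable

lemma integrable_bump:
  fixes c :: "'a::euclidean_space"
  assumes "h > 0" shows "integrable lborel (bump c h)"
proof (rule Bochner_Integration.integrable_bound[of _ "indicator (cball c h) :: 'a \<Rightarrow> real"])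
  show "integrable lborel (indicator (cball c h) :: 'a \<Rightarrow> real)"
    using emeasure_lborel_cball_finite[of c h] by (intro integrable_real_indicator) simp_all
  show "AE x in lborel. norm (bump c h x) \<le> norm (indicator (cball c h) x :: real)"
    using bump_eq_0[OF assms, of c] bump_nonneg[of c h] bump_le_1[of c h]
    by (intro AE_I2) (auto simp: indicator_def)
qed simp

lemma integral_bump_pos:
  assumes "h > 0" shows "0 < (LINT z|lborel. bump (0::'a::euclidean_space) h z)"
proof -
  have "(LINT z|lborel. bump (0::'a) h z) \<noteq> 0"
  proof
    assume "(LINT z|lborel. bump (0::'a) h z) = 0"
    then have "AE z in lborel. bump (0::'a) h z = 0"
      by (subst (asm) integral_nonneg_eq_0_iff_AE[OF integrable_bump[OF assms]]) (auto simp: bump_nonneg)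
    then have "AE z in lborel. z \<notin> ball (0::'a) h"
      by eventually_elim (metis assms bump_pos_iff less_irrefl mem_ball)
    then have "ball (0::'a) h \<in> null_sets lborel"
      by (subst AE_iff_null_sets) auto
    then show False
      using content_ball_pos[OF assms, of "0::'a"] by (simp add: measure_def null_sets_def)
  qed
  moreover have "0 \<le> (LINT z|lborel. bump (0::'a) h z)"
    by (intro integral_nonneg_AE AE_I2 bump_nonneg)
  ultimately show ?thesis by simp
qed


lemma integral_mollifier: "h > 0 \<Longrightarrow> (LINT z|lborel. mollifier h (0::'a::euclidean_space) z) = 1"
  using integral_bump_pos[where 'a='a, of h] by (simp add: mollifier_def)

lemma mollifier_nonneg: "h > 0 \<Longrightarrow> 0 \<le> mollifier h c x"
  using integral_bump_pos[where 'a='a, of h] by (simp add: mollifier_def bump_nonneg)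

lemma mollifier_eq_0: "h > 0 \<Longrightarrow> h \<le> dist c x \<Longrightarrow> mollifier h c x = 0"
  by (simp add: mollifier_def bump_eq_0)

lemma mollifier_translate: "mollifier h c (x + c) = mollifier h 0 x"
  by (simp add: mollifier_def bump_translate)

lemma borel_measurable_mollifier [measurable]: "mollifier h c \<in> borel_measurable borel"
  unfolding mollifier_def[abs_def] by measurable

lemma mollifier_bounded: "h > 0 \<Longrightarrow> mollifier h (c::'a::euclidean_space) x \<le> 1 / (LINT z|lborel. bump (0::'a) h z)"
  using integral_bump_pos[where 'a='a, of h] by (simp add: mollifier_def bump_le_1 divide_right_mono)

subsection \<open>Averages of translates\<close>

text \<open>
  Two averages are used: mollification (\<open>k\<close> a bump and \<open>\<tau>\<close> the identity), and the mean over a segment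
  (\<open>k\<close> the indicator of \<open>[0, 1]\<close> and \<open>\<tau> s = s *\<^sub>R y\<close>).
\<close>

definition average ::
    "('a::euclidean_space \<Rightarrow> real) \<Rightarrow> ('s::euclidean_space \<Rightarrow> real) \<Rightarrow> ('s \<Rightarrow> 'a) \<Rightarrow> 'a \<Rightarrow> real" where
  "average f k \<tau> x = (LINT s|lborel. k s * f (x + \<tau> s))"

context
  fixes f :: "'a::euclidean_space \<Rightarrow> real" and k :: "'s::euclidean_space \<Rightarrow> real" and \<tau> :: "'s \<Rightarrow> 'a" and M :: real
  assumes f: "locally_integrable f" and k: "integrable lborel k" "\<And>s. 0 \<le> k s"
    and \<tau>: "\<tau> \<in> borel_measurable borel" "\<And>s. k s \<noteq> 0 \<Longrightarrow> norm (\<tau> s) \<le> M"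
begin

lemma average_measurables: "f \<in> borel_measurable borel" "k \<in> borel_measurable borel" "\<tau> \<in> borel_measurable borel"
  using locally_integrable_measurable[OF f] borel_measurable_integrable[OF k(1)] \<tau>(1) by simp_all

lemma nn_integral_average_swap:
  assumes [measurable]: "(\<lambda>(x, s). F x s) \<in> borel_measurable (borel \<Otimes>\<^sub>M borel)"
  shows "(\<integral>\<^sup>+x. (\<integral>\<^sup>+s. ennreal (k s * \<bar>F x s\<bar>) \<partial>lborel) * indicator (cball (0::'a) R) x \<partial>lborel)
    = (\<integral>\<^sup>+s. ennreal (k s) * local_norm R (\<lambda>x. F x s) \<partial>lborel)"
proof -
  note average_measurables [measurable]
  have "(\<integral>\<^sup>+x. (\<integral>\<^sup>+s. ennreal (k s * \<bar>F x s\<bar>) \<partial>lborel) * indicator (cball (0::'a) R) x \<partial>lborel)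
      = (\<integral>\<^sup>+x. (\<integral>\<^sup>+s. ennreal (k s) * (ennreal \<bar>F x s\<bar> * indicator (cball 0 R) x) \<partial>lborel) \<partial>lborel)"
  proof (rule nn_integral_cong)
    fix x :: 'a
    have "(\<integral>\<^sup>+s. ennreal (k s * \<bar>F x s\<bar>) \<partial>lborel) * indicator (cball 0 R) x
        = (\<integral>\<^sup>+s. ennreal (k s * \<bar>F x s\<bar>) * indicator (cball 0 R) x \<partial>lborel)"
      by (rule nn_integral_multc[symmetric]) measurable
    then show "(\<integral>\<^sup>+s. ennreal (k s * \<bar>F x s\<bar>) \<partial>lborel) * indicator (cball 0 R) x
        = (\<integral>\<^sup>+s. ennreal (k s) * (ennreal \<bar>F x s\<bar> * indicator (cball 0 R) x) \<partial>lborel)"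
      by (simp add: ennreal_mult k(2) mult.assoc)
  qed
  also have "\<dots> = (\<integral>\<^sup>+s. (\<integral>\<^sup>+x. ennreal (k s) * (ennreal \<bar>F x s\<bar> * indicator (cball 0 R) x) \<partial>lborel) \<partial>lborel)"
    by (rule lborel_pair.Fubini') measurable
  also have "\<dots> = (\<integral>\<^sup>+s. ennreal (k s) * local_norm R (\<lambda>x. F x s) \<partial>lborel)"
    unfolding local_norm_def by (intro nn_integral_cong nn_integral_cmult) measurable
  finally show ?thesis .
qed

lemma nn_integral_weight_le:
  assumes "\<And>s. k s \<noteq> 0 \<Longrightarrow> L s \<le> C"
  shows "(\<integral>\<^sup>+s. ennreal (k s) * L s \<partial>lborel) \<le> ennreal (LINT s|lborel. k s) * C"
proof -
  note average_measurables [measurable]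
  have "(\<integral>\<^sup>+s. ennreal (k s) * L s \<partial>lborel) \<le> (\<integral>\<^sup>+s. ennreal (k s) * C \<partial>lborel)"
  proof (rule nn_integral_mono)
    fix s show "ennreal (k s) * L s \<le> ennreal (k s) * C"
      using assms[of s] by (cases "k s = 0") (auto intro: mult_left_mono)
  qed
  also have "\<dots> = (\<integral>\<^sup>+s. ennreal (k s) \<partial>lborel) * C"
    by (rule nn_integral_multc) measurable
  also have "(\<integral>\<^sup>+s. ennreal (k s) \<partial>lborel) = ennreal (LINT s|lborel. k s)"
    using k by (intro nn_integral_eq_integral) auto
  finally show ?thesis .
qed

lemma local_norm_translate_le:
  assumes "norm y \<le> M"
  shows "local_norm R (\<lambda>x. f (x + y)) \<le> local_norm (R + M) f"
proof -
  note average_measurables [measurable]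
  have "local_norm R (\<lambda>x. f (x + y)) \<le> (\<integral>\<^sup>+x. ennreal \<bar>f (x + y)\<bar> * indicator (cball 0 (R + M)) (x + y) \<partial>lborel)"
    unfolding local_norm_def
  proof (rule nn_integral_mono)
    fix x :: 'a
    have "norm x \<le> R \<Longrightarrow> norm (x + y) \<le> R + M"
      using assms norm_triangle_ineq[of x y] by linarith
    then show "ennreal \<bar>f (x + y)\<bar> * indicator (cball 0 R) x \<le> ennreal \<bar>f (x + y)\<bar> * indicator (cball 0 (R + M)) (x + y)"
      by (auto simp: indicator_def)
  qed
  also have "\<dots> = local_norm (R + M) f"
    unfolding local_norm_def
    by (rule nn_integral_translate[of "\<lambda>x. ennreal \<bar>f x\<bar> * indicator (cball 0 (R + M)) x"]) measurable
  finally show ?thesis .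
qed

lemma average_finite:
  "(\<integral>\<^sup>+x. (\<integral>\<^sup>+s. ennreal (k s * \<bar>f (x + \<tau> s)\<bar>) \<partial>lborel) * indicator (cball (0::'a) R) x \<partial>lborel) < \<infinity>"
proof -
  note average_measurables [measurable]
  have "(\<integral>\<^sup>+x. (\<integral>\<^sup>+s. ennreal (k s * \<bar>f (x + \<tau> s)\<bar>) \<partial>lborel) * indicator (cball (0::'a) R) x \<partial>lborel)
      = (\<integral>\<^sup>+s. ennreal (k s) * local_norm R (\<lambda>x. f (x + \<tau> s)) \<partial>lborel)"
    by (rule nn_integral_average_swap) measurable
  also have "\<dots> \<le> ennreal (LINT s|lborel. k s) * local_norm (R + M) f"
    by (intro nn_integral_weight_le local_norm_translate_le \<tau>(2))
  also have "\<dots> < \<infinity>"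
    using local_norm_finite[OF f, of "R + M"] by (simp add: ennreal_mult_less_top)
  finally show ?thesis .
qed

lemma AE_average_integrable: "AE x in lborel. integrable lborel (\<lambda>s. k s * f (x + \<tau> s))"
proof -
  note average_measurables [measurable]
  have "AE x in lborel. (\<integral>\<^sup>+s. ennreal (k s * \<bar>f (x + \<tau> s)\<bar>) \<partial>lborel) * indicator (cball (0::'a) (real n)) x \<noteq> \<infinity>" for n
    using average_finite[of "real n"] by (intro nn_integral_noteq_infinite) auto
  then have "AE x in lborel. \<forall>n. (\<integral>\<^sup>+s. ennreal (k s * \<bar>f (x + \<tau> s)\<bar>) \<partial>lborel) * indicator (cball (0::'a) (real n)) x \<noteq> \<infinity>"
    unfolding AE_all_countable by blast
  then show ?thesis
  proof eventually_elim
    fix x :: 'a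
    assume *: "\<forall>n. (\<integral>\<^sup>+s. ennreal (k s * \<bar>f (x + \<tau> s)\<bar>) \<partial>lborel) * indicator (cball (0::'a) (real n)) x \<noteq> \<infinity>"
    obtain n where "norm x \<le> real n" using real_arch_simple by blast
    then have "(\<integral>\<^sup>+s. ennreal (k s * \<bar>f (x + \<tau> s)\<bar>) \<partial>lborel) < \<infinity>"
      using spec[OF *, of n] by (simp add: less_top)
    then show "integrable lborel (\<lambda>s. k s * f (x + \<tau> s))"
      by (intro integrableI_bounded) (simp_all add: abs_mult k(2))
  qed
qed

lemma borel_measurable_average: "average f k \<tau> \<in> borel_measurable borel"
  using average_measurables unfolding average_def[abs_def] by measurable

lemma abs_average_le: "ennreal \<bar>average f k \<tau> x\<bar> \<le> (\<integral>\<^sup>+s. ennreal (k s * \<bar>f (x + \<tau> s)\<bar>) \<partial>lborel)"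
proof (cases "integrable lborel (\<lambda>s. k s * f (x + \<tau> s))")
  case True
  from integral_norm_bound_ennreal[OF this] show ?thesis
    by (simp add: average_def abs_mult k(2))
qed (simp add: average_def not_integrable_integral_eq)

lemma locally_integrable_average: "locally_integrable (average f k \<tau>)"
  unfolding locally_integrable_def
proof (intro conjI allI impI)
  note borel_measurable_average [measurable]
  show "average f k \<tau> \<in> borel_measurable lborel" by measurable
  fix K :: "'a set" assume K: "compact K"
  then obtain R where R: "K \<subseteq> cball 0 R"
    using compact_subset_cball by blast
  have [measurable]: "K \<in> sets borel" using K by (simp add: borel_compact)
  show "set_integrable lborel K (average f k \<tau>)"
    unfolding set_integrable_def
  proof (rule integrableI_bounded)
    have "(\<integral>\<^sup>+x. ennreal (norm (indicator K x *\<^sub>R average f k \<tau> x)) \<partial>lborel)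
       \<le> (\<integral>\<^sup>+x. (\<integral>\<^sup>+s. ennreal (k s * \<bar>f (x + \<tau> s)\<bar>) \<partial>lborel) * indicator (cball (0::'a) R) x \<partial>lborel)"
    proof (rule nn_integral_mono)
      fix x
      show "ennreal (norm (indicator K x *\<^sub>R average f k \<tau> x))
         \<le> (\<integral>\<^sup>+s. ennreal (k s * \<bar>f (x + \<tau> s)\<bar>) \<partial>lborel) * indicator (cball (0::'a) R) x"
        using R abs_average_le[of x] by (auto simp: indicator_def)
    qed
    also have "\<dots> < \<infinity>" by (rule average_finite)
    finally show "(\<integral>\<^sup>+x. ennreal (norm (indicator K x *\<^sub>R average f k \<tau> x)) \<partial>lborel) < \<infinity>" .
  qed measurable
qed

text \<open>
  By Tonelli's theorem the error of an average is at most the average of the errors of the translates.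
\<close>

lemma average_close:
  assumes one: "(LINT s|lborel. k s) = 1"
    and le: "\<And>s. k s \<noteq> 0 \<Longrightarrow> local_norm R (\<lambda>x. f (x + \<tau> s) - f x) \<le> \<epsilon>"
  shows "local_norm R (\<lambda>x. average f k \<tau> x - f x) \<le> \<epsilon>"
proof -
  note average_measurables [measurable]
  have "local_norm R (\<lambda>x. average f k \<tau> x - f x)
      \<le> (\<integral>\<^sup>+x. (\<integral>\<^sup>+s. ennreal (k s * \<bar>f (x + \<tau> s) - f x\<bar>) \<partial>lborel) * indicator (cball 0 R) x \<partial>lborel)"
    unfolding local_norm_def
  proof (rule nn_integral_mono_AE)
    show "AE x in lborel. ennreal \<bar>average f k \<tau> x - f x\<bar> * indicator (cball 0 R) x
      \<le> (\<integral>\<^sup>+s. ennreal (k s * \<bar>f (x + \<tau> s) - f x\<bar>) \<partial>lborel) * indicator (cball 0 R) x"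
      using AE_average_integrable
    proof eventually_elim
      fix x :: 'a assume int: "integrable lborel (\<lambda>s. k s * f (x + \<tau> s))"
      have "average f k \<tau> x - f x = (LINT s|lborel. k s * f (x + \<tau> s)) - (LINT s|lborel. k s * f x)"
        using one by (simp add: average_def)
      also have "\<dots> = (LINT s|lborel. k s * (f (x + \<tau> s) - f x))"
        using int k(1) by (simp add: right_diff_distrib)
      also have "ennreal \<bar>\<dots>\<bar> \<le> (\<integral>\<^sup>+s. ennreal (norm (k s * (f (x + \<tau> s) - f x))) \<partial>lborel)"
        unfolding real_norm_def[symmetric]
        by (rule integral_norm_bound_ennreal) (use int k in \<open>simp add: right_diff_distrib\<close>)
      finally show "ennreal \<bar>average f k \<tau> x - f x\<bar> * indicator (cball 0 R) x
        \<le> (\<integral>\<^sup>+s. ennreal (k s * \<bar>f (x + \<tau> s) - f x\<bar>) \<partial>lborel) * indicator (cball 0 R) x"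
        by (intro mult_right_mono) (simp_all add: abs_mult k(2))
    qed
  qed
  also have "\<dots> = (\<integral>\<^sup>+s. ennreal (k s) * local_norm R (\<lambda>x. f (x + \<tau> s) - f x) \<partial>lborel)"
    by (rule nn_integral_average_swap) measurable
  also have "\<dots> \<le> ennreal (LINT s|lborel. k s) * \<epsilon>"
    by (intro nn_integral_weight_le le)
  finally show ?thesis by (simp add: one)
qed

lemma average_Fubini:
  assumes \<psi>: "\<psi> \<in> borel_measurable lborel" "\<And>x. \<bar>\<psi> x\<bar> \<le> B" "\<And>x. x \<notin> cball 0 R \<Longrightarrow> \<psi> x = 0"
  shows "(LINT x|lborel. average f k \<tau> x * \<psi> x) = (LINT s|lborel. k s * (LINT x|lborel. f (x + \<tau> s) * \<psi> x))"
proof -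
  note average_measurables [measurable]
  have [measurable]: "\<psi> \<in> borel_measurable borel" using \<psi>(1) by simp
  have "integrable (lborel \<Otimes>\<^sub>M lborel) (\<lambda>(x, s). k s * f (x + \<tau> s) * \<psi> x)"
  proof (rule integrableI_bounded)
    have "(\<integral>\<^sup>+p. ennreal (norm (case p of (x, s) \<Rightarrow> k s * f (x + \<tau> s) * \<psi> x)) \<partial>(lborel \<Otimes>\<^sub>M lborel))
        = (\<integral>\<^sup>+x. (\<integral>\<^sup>+s. ennreal (norm (k s * f (x + \<tau> s) * \<psi> x)) \<partial>lborel) \<partial>lborel)"
      by (subst lborel.nn_integral_fst[symmetric]) auto
    also have "\<dots> \<le> (\<integral>\<^sup>+x. ennreal B * ((\<integral>\<^sup>+s. ennreal (k s * \<bar>f (x + \<tau> s)\<bar>) \<partial>lborel) * indicator (cball 0 R) x) \<partial>lborel)"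
    proof (rule nn_integral_mono)
      fix x :: 'a
      have "(\<integral>\<^sup>+s. ennreal (norm (k s * f (x + \<tau> s) * \<psi> x)) \<partial>lborel)
          = (\<integral>\<^sup>+s. ennreal (k s * \<bar>f (x + \<tau> s)\<bar>) * ennreal \<bar>\<psi> x\<bar> \<partial>lborel)"
        by (intro nn_integral_cong) (simp add: abs_mult k(2) ennreal_mult)
      also have "\<dots> = (\<integral>\<^sup>+s. ennreal (k s * \<bar>f (x + \<tau> s)\<bar>) \<partial>lborel) * ennreal \<bar>\<psi> x\<bar>"
        by (rule nn_integral_multc) measurable
      also have "\<dots> \<le> (\<integral>\<^sup>+s. ennreal (k s * \<bar>f (x + \<tau> s)\<bar>) \<partial>lborel) * (ennreal B * indicator (cball 0 R) x)"
        using \<psi>(2)[of x] \<psi>(3)[of x] by (intro mult_left_mono) (auto simp: indicator_def intro: ennreal_leI)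
      finally show "(\<integral>\<^sup>+s. ennreal (norm (k s * f (x + \<tau> s) * \<psi> x)) \<partial>lborel)
          \<le> ennreal B * ((\<integral>\<^sup>+s. ennreal (k s * \<bar>f (x + \<tau> s)\<bar>) \<partial>lborel) * indicator (cball 0 R) x)"
        by (simp only: ac_simps)
    qed
    also have "\<dots> = ennreal B * (\<integral>\<^sup>+x. (\<integral>\<^sup>+s. ennreal (k s * \<bar>f (x + \<tau> s)\<bar>) \<partial>lborel) * indicator (cball 0 R) x \<partial>lborel)"
      by (rule nn_integral_cmult) measurable
    also have "\<dots> < \<infinity>"
      using average_finite[of R] by (simp add: ennreal_mult_less_top)
    finally show "(\<integral>\<^sup>+p. ennreal (norm (case p of (x, s) \<Rightarrow> k s * f (x + \<tau> s) * \<psi> x)) \<partial>(lborel \<Otimes>\<^sub>M lborel)) < \<infinity>" .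
  qed measurable
  then have "(LINT s|lborel. LINT x|lborel. k s * f (x + \<tau> s) * \<psi> x) = (LINT x|lborel. LINT s|lborel. k s * f (x + \<tau> s) * \<psi> x)"
    by (rule lborel_pair.Fubini_integral)
  then show ?thesis
    by (simp add: average_def mult.assoc flip: integral_mult_left_zero)
qed

end

lemma mollification_eq_average:
  fixes f :: "'a::euclidean_space \<Rightarrow> real"
  assumes "locally_integrable f" "h > 0"
  shows "(LINT z|lborel. mollifier h x z * f z) = average f (mollifier h 0) (\<lambda>y. y) x"
proof -
  have [measurable]: "f \<in> borel_measurable borel" using locally_integrable_measurable[OF assms(1)] by simp
  have "(LINT z|lborel. mollifier h x z * f z) = (LINT y|lborel. mollifier h x (y + x) * f (y + x))"
    by (rule integral_translate[symmetric]) simp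
  then show ?thesis
    by (simp add: mollifier_translate add.commute average_def)
qed

theorem mollification_close:
  fixes f :: "'a::euclidean_space \<Rightarrow> real"
  assumes f: "locally_integrable f" and h: "h > 0"
    and le: "\<And>y. norm y \<le> h \<Longrightarrow> local_norm R (\<lambda>x. f (x + y) - f x) \<le> \<epsilon>"
  shows "local_norm R (\<lambda>x. (LINT z|lborel. mollifier h x z * f z) - f x) \<le> \<epsilon>"
proof -
  have k: "integrable lborel (mollifier h (0::'a))"
    unfolding mollifier_def[abs_def] by (intro integrable_divide_zero integrable_bump h)
  have near: "norm y \<le> h" if "mollifier h 0 y \<noteq> 0" for y :: 'a
    using mollifier_eq_0[OF h, of 0 y] that by force
  show ?thesis
    unfolding mollification_eq_average[OF f h]
    by (rule average_close[OF f k mollifier_nonneg[OF h] _ near integral_mollifier[OF h] le[OF near]]) auto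
qed

text \<open>
  All mollifications of \<open>f\<close> vanish, and they approximate \<open>f\<close> in \<open>L\<^sup>1\<close> on bounded sets by continuity of
  translations.
\<close>

theorem fundamental_lemma:
  fixes f :: "'a::euclidean_space \<Rightarrow> real"
  assumes f: "locally_integrable f"
    and zero: "\<And>c h. h > 0 \<Longrightarrow> (LINT x|lborel. f x * bump c h x) = 0"
  shows "AE x in lborel. f x = 0"
proof (rule local_norm_zero_AE)
  fix R
  have "local_norm R f \<le> ennreal \<epsilon>" if "\<epsilon> > 0" for \<epsilon>
  proof -
    obtain h where h: "h > 0" "\<And>y. norm y \<le> h \<Longrightarrow> local_norm R (\<lambda>x. f (x + y) - f x) \<le> ennreal \<epsilon>"
      using local_translation_continuity[OF f \<open>\<epsilon> > 0\<close>, of R] by blast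
    have "(LINT z|lborel. mollifier h x z * f z) = 0" for x
      using zero[OF h(1), of x] by (simp add: mollifier_def mult.commute)
    then show ?thesis
      using mollification_close[OF f h] by (simp add: local_norm_def)
  qed
  then have "local_norm R f \<le> 0 + ennreal \<epsilon>" if "\<epsilon> > 0" for \<epsilon>
    using that by simp
  then show "local_norm R f = 0"
    using ennreal_le_epsilon[of 0 "local_norm R f"] by auto
qed (use f in measurable)

section \<open>Calculus of weak gradients\<close>

lemma test_fun_supported:
  assumes "test_fun \<phi>"
  shows "\<exists>R. \<forall>x. x \<notin> cball 0 R \<longrightarrow> \<phi> x = 0 \<and> (\<forall>y. frechet_derivative \<phi> (at x) y = 0)"
proof -
  obtain R where R: "closure {x. \<phi> x \<noteq> 0} \<subseteq> cball 0 R"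
    using compact_subset_cball[OF compact_test_fun_support[OF assms]] by blast
  show ?thesis
  proof (intro exI[of _ R] allI impI conjI)
    fix x y :: 'a assume "x \<notin> cball 0 R"
    then have x: "x \<notin> closure {x. \<phi> x \<noteq> 0}" using R by blast
    show "\<phi> x = 0" by (rule test_fun_eq_0[OF assms x])
    show "frechet_derivative \<phi> (at x) y = 0" by (rule test_fun_derivative_eq_0[OF assms x])
  qed
qed

lemma integrable_locally_mult:
  fixes f \<psi> :: "'a::euclidean_space \<Rightarrow> real"
  assumes f: "locally_integrable f" and \<psi>: "\<psi> \<in> borel_measurable borel"
    "\<And>x. \<bar>\<psi> x\<bar> \<le> B" "\<And>x. x \<notin> cball 0 R \<Longrightarrow> \<psi> x = 0"
  shows "integrable lborel (\<lambda>x. f x * \<psi> x)"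
proof (rule Bochner_Integration.integrable_bound)
  have [measurable]: "f \<in> borel_measurable borel" using locally_integrable_measurable[OF f] by simp
  note \<psi>(1)[measurable]
  show "integrable lborel (\<lambda>x. B * (indicator (cball 0 R) x * f x))"
    by (intro integrable_mult_right locally_integrable_cball f)
  show "(\<lambda>x. f x * \<psi> x) \<in> borel_measurable lborel" by measurable
  show "AE x in lborel. norm (f x * \<psi> x) \<le> norm (B * (indicator (cball 0 R) x * f x))"
  proof (rule AE_I2)
    fix x
    have "\<bar>\<psi> x\<bar> \<le> \<bar>B * indicator (cball 0 R) x\<bar>"
      using \<psi>(2)[of x] \<psi>(3)[of x] by (auto simp: indicator_def)
    then have "\<bar>\<psi> x\<bar> * \<bar>f x\<bar> \<le> \<bar>B * indicator (cball 0 R) x\<bar> * \<bar>f x\<bar>"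
      by (rule mult_right_mono) simp
    then show "norm (f x * \<psi> x) \<le> norm (B * (indicator (cball 0 R) x * f x))"
      by (simp add: abs_mult ac_simps)
  qed
qed

lemma locally_integrable_inner:
  fixes g :: "'a::euclidean_space \<Rightarrow> 'b::euclidean_space"
  assumes "locally_integrable g"
  shows "locally_integrable (\<lambda>x. g x \<bullet> y)"
proof -
  have [measurable]: "g \<in> borel_measurable borel"
    using assms by (simp add: locally_integrable_def)
  have "integrable lborel (\<lambda>x. (indicator K x *\<^sub>R g x) \<bullet> y)" if "compact K" for K
    using assms that unfolding locally_integrable_def set_integrable_def by (intro integrable_inner_left) auto
  then show ?thesis
    unfolding locally_integrable_def set_integrable_def by simp
qed

lemma locally_integrable_translate:
  fixes f :: "'a::euclidean_space \<Rightarrow> real"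
  assumes "locally_integrable f"
  shows "locally_integrable (\<lambda>x. f (x + y))"
  unfolding locally_integrable_def
proof (intro conjI allI impI)
  have f[measurable]: "f \<in> borel_measurable borel"
    using assms by (simp add: locally_integrable_def)
  show "(\<lambda>x. f (x + y)) \<in> borel_measurable lborel" by measurable
  fix K :: "'a set" assume K: "compact K"
  have "compact ((+) y ` K)" by (intro compact_continuous_image K continuous_intros)
  then have "integrable lborel (\<lambda>x. indicator ((+) y ` K) x *\<^sub>R f x)"
    using assms unfolding locally_integrable_def set_integrable_def by blast
  then have "integrable lborel (\<lambda>x. indicator ((+) y ` K) (x + y) *\<^sub>R f (x + y))"
    by (rule integrable_translate)
  moreover have "indicator ((+) y ` K) (x + y) = (indicator K x :: real)" for x
    by (auto simp: indicator_def image_iff add.commute)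
  ultimately show "set_integrable lborel K (\<lambda>x. f (x + y))"
    by (simp add: set_integrable_def)
qed

lemma locally_integrable_diff:
  "locally_integrable f \<Longrightarrow> locally_integrable g \<Longrightarrow> locally_integrable (\<lambda>x. f x - g x)"
  unfolding locally_integrable_def by (auto intro: borel_measurable_diff set_integral_diff)

lemma locally_integrable_bound:
  assumes f: "locally_integrable f" and "g \<in> borel_measurable lborel" and "\<And>x. norm (g x) \<le> a * norm (f x) + b"
  shows "locally_integrable g"
  unfolding locally_integrable_def set_integrable_def
proof (intro conjI allI impI)
  fix K :: "'a set" assume K: "compact K"
  have [measurable]: "K \<in> sets borel" "g \<in> borel_measurable borel" using K assms(2) by (auto simp: borel_compact)
  have "emeasure lborel K < \<infinity>" using K by (rule emeasure_compact_finite)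
  then have i: "integrable lborel (\<lambda>x. indicator K x :: real)" by (intro integrable_real_indicator) auto
  have "integrable lborel (\<lambda>x. norm (indicator K x *\<^sub>R f x))"
    using f K unfolding locally_integrable_def set_integrable_def by (intro integrable_norm) blast
  then have "integrable lborel (\<lambda>x. a * norm (indicator K x *\<^sub>R f x) + b * indicator K x)"
    using i by auto
  then show "integrable lborel (\<lambda>x. indicator K x *\<^sub>R g x)"
  proof (rule Bochner_Integration.integrable_bound)
    show "AE x in lborel. norm (indicator K x *\<^sub>R g x) \<le> norm (a * norm (indicator K x *\<^sub>R f x) + b * indicator K x)"
      using order_trans[OF assms(3) abs_ge_self] by (intro AE_I2) (auto simp: indicator_def)
  qed measurable
qed (rule assms)

lemma weak_gradientD:
  assumes "has_weak_gradient u g"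
  shows "locally_integrable u" "locally_integrable g" "locally_integrable (\<lambda>x. g x \<bullet> y)"
  using assms by (auto simp: has_weak_gradient_def intro: locally_integrable_inner)

lemma integrable_test_fun_mult:
  fixes f :: "'a::euclidean_space \<Rightarrow> real"
  assumes "locally_integrable f" "test_fun \<phi>"
  shows "integrable lborel (\<lambda>x. f x * \<phi> x)" "integrable lborel (\<lambda>x. f x * frechet_derivative \<phi> (at x) y)"
proof -
  obtain R where R: "\<And>x. x \<notin> cball 0 R \<Longrightarrow> \<phi> x = 0" "\<And>x. x \<notin> cball 0 R \<Longrightarrow> frechet_derivative \<phi> (at x) y = 0"
    using test_fun_supported[OF assms(2)] by blast
  obtain B C where B: "\<And>x. \<bar>\<phi> x\<bar> \<le> B" "\<And>x. \<bar>frechet_derivative \<phi> (at x) y\<bar> \<le> C"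
    using test_fun_bounded(1)[OF assms(2)] test_fun_bounded(2)[OF assms(2), of y] by blast
  then show "integrable lborel (\<lambda>x. f x * \<phi> x)" "integrable lborel (\<lambda>x. f x * frechet_derivative \<phi> (at x) y)"
    using integrable_locally_mult[OF assms(1) _ B(1) R(1)] integrable_locally_mult[OF assms(1) _ B(2) R(2)]
      borel_measurable_test_fun[OF assms(2)] borel_measurable_test_fun_derivative[OF assms(2), of y]
    by auto
qed

lemma weak_gradient_direction:
  assumes "has_weak_gradient u g" "test_fun \<phi>"
  shows "(LINT x|lborel. u x * frechet_derivative \<phi> (at x) y) = - (LINT x|lborel. (g x \<bullet> y) * \<phi> x)"
proof -
  note D = weak_gradientD[OF assms(1)]
  have "(LINT x|lborel. u x * frechet_derivative \<phi> (at x) y)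
      = (LINT x|lborel. (\<Sum>i\<in>Basis. (y \<bullet> i) * (u x * frechet_derivative \<phi> (at x) i)))"
    by (subst test_fun_derivative_expand[OF assms(2)]) (simp add: sum_distrib_left ac_simps)
  also have "\<dots> = (\<Sum>i\<in>Basis. (y \<bullet> i) * (LINT x|lborel. u x * frechet_derivative \<phi> (at x) i))"
    by (subst Bochner_Integration.integral_sum)
       (auto intro!: integrable_mult_right integrable_test_fun_mult D assms)
  also have "\<dots> = (\<Sum>i\<in>Basis. (y \<bullet> i) * - (LINT x|lborel. (g x \<bullet> i) * \<phi> x))"
    using assms by (intro sum.cong) (auto simp: has_weak_gradient_def)
  also have "\<dots> = - (LINT x|lborel. (\<Sum>i\<in>Basis. (y \<bullet> i) * ((g x \<bullet> i) * \<phi> x)))"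
    by (subst Bochner_Integration.integral_sum)
       (auto intro!: integrable_mult_right integrable_test_fun_mult D assms simp: sum_negf)
  also have "(\<lambda>x. \<Sum>i\<in>Basis. (y \<bullet> i) * ((g x \<bullet> i) * \<phi> x)) = (\<lambda>x. (g x \<bullet> y) * \<phi> x)"
    by (rule ext, subst euclidean_inner[of _ y]) (simp add: sum_distrib_right sum_distrib_left ac_simps)
  finally show ?thesis .
qed

lemma bump_shift: "bump (c + v) h x = bump c h (x - v)"
  by (simp add: bump_def algebra_simps)

lemma bump_has_derivative:
  "h > 0 \<Longrightarrow> (bump c h has_derivative frechet_derivative (bump c h) (at x)) (at x)"
  by (rule test_fun_has_derivative[OF test_fun_bump])

lemma bump_derivative_shift:
  assumes "h > 0"
  shows "frechet_derivative (bump (c + v) h) (at x) = frechet_derivative (bump c h) (at (x - v))"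
proof -
  have "((\<lambda>x. x - v) has_derivative (\<lambda>x. x)) (at x)"
    by (auto intro!: derivative_eq_intros)
  from diff_chain_at[OF this bump_has_derivative[OF assms]]
  have "(bump (c + v) h has_derivative frechet_derivative (bump c h) (at (x - v))) (at x)"
    by (simp add: o_def bump_shift[abs_def])
  then show ?thesis by (rule frechet_derivative_at[symmetric])
qed

lemma bump_FTC:
  assumes h: "h > 0"
  shows "(LINT s|lborel. indicator {0..1} s * frechet_derivative (bump c h) (at (x - s *\<^sub>R y)) y)
    = bump c h x - bump c h (x - y)"
proof -
  let ?D = "\<lambda>s. frechet_derivative (bump c h) (at (x - s *\<^sub>R y)) y"
  have deriv: "((\<lambda>s. - bump c h (x - s *\<^sub>R y)) has_real_derivative ?D s) (at s)" for s
  proof -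
    have "((\<lambda>s. x - s *\<^sub>R y) has_derivative (\<lambda>r. - (r *\<^sub>R y))) (at s)"
      by (auto intro!: derivative_eq_intros)
    from diff_chain_at[OF this bump_has_derivative[OF h]]
    have "((\<lambda>s. bump c h (x - s *\<^sub>R y)) has_derivative (\<lambda>r. frechet_derivative (bump c h) (at (x - s *\<^sub>R y)) (- (r *\<^sub>R y)))) (at s)"
      by (simp add: o_def)
    moreover have "frechet_derivative (bump c h) (at (x - s *\<^sub>R y)) (- (r *\<^sub>R y)) = - (r * ?D s)" for r
    proof -
      interpret linear "frechet_derivative (bump c h) (at (x - s *\<^sub>R y))"
        using bump_has_derivative[OF h] by (rule has_derivative_linear)
      show ?thesis by (simp add: neg scale)
    qed
    ultimately have "((\<lambda>s. bump c h (x - s *\<^sub>R y)) has_derivative (\<lambda>r. - (r * ?D s))) (at s)"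
      by simp
    then have "((\<lambda>s. bump c h (x - s *\<^sub>R y)) has_real_derivative - ?D s) (at s)"
      by (rule has_derivative_imp_has_field_derivative) simp
    from DERIV_minus[OF this] show ?thesis by simp
  qed
  have "isCont ?D s" for s
  proof -
    have "continuous_on UNIV ?D"
      by (rule continuous_on_compose2[OF continuous_on_test_fun_derivative[OF test_fun_bump[OF h], of UNIV]])
         (auto intro!: continuous_intros)
    then show ?thesis by (simp add: continuous_on_eq_continuous_at)
  qed
  then have "(LINT s|lborel. ?D s * indicator {0..1} s) = - bump c h (x - 1 *\<^sub>R y) - - bump c h (x - 0 *\<^sub>R y)"
    by (intro integral_FTC_Icc_real deriv) auto
  then show ?thesis by (simp add: mult.commute)
qed

abbreviation segment_average :: "('a::euclidean_space \<Rightarrow> real) \<Rightarrow> 'a \<Rightarrow> 'a \<Rightarrow> real" where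
  "segment_average f y \<equiv> average f (indicator {0..1::real}) (\<lambda>s. s *\<^sub>R y)"

lemma segment_weight:
  "integrable lborel (indicator {0..1::real} :: real \<Rightarrow> real)" "0 \<le> (indicator {0..1} s :: real)"
  "(\<lambda>s. s *\<^sub>R y) \<in> borel_measurable borel"
  "(indicator {0..1} s :: real) \<noteq> 0 \<Longrightarrow> norm (s *\<^sub>R y) \<le> norm y"
  "(LINT s|lborel. indicator {0..1::real} s) = (1 :: real)"
proof -
  show "(LINT s|lborel. indicator {0..1::real} s) = (1 :: real)" by simp
  show "(\<lambda>s. s *\<^sub>R y) \<in> borel_measurable borel"
    by (intro borel_measurable_continuous_onI continuous_intros)
qed (auto simp: indicator_def mult_left_le_one_le split: if_splits)

text \<open>
  Fubini's theorem for a segment of translates of a derivative, combined with the fundamental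
  theorem of calculus for the bump along that segment.
\<close>

lemma integral_segment_bump:
  assumes u: "locally_integrable u" and h: "h > 0"
  shows "(LINT s|lborel. indicator {0..1} s * (LINT x|lborel. u x * frechet_derivative (bump c h) (at (x - s *\<^sub>R y)) y))
    = (LINT x|lborel. u x * (bump c h x - bump c h (x - y)))"
proof -
  have [measurable]: "u \<in> borel_measurable borel" using locally_integrable_measurable[OF u] by simp
  let ?D = "\<lambda>x. frechet_derivative (bump c h) (at x) y"
  note t = test_fun_bump[OF h, of c]
  have [measurable]: "?D \<in> borel_measurable borel"
    using borel_measurable_test_fun_derivative[OF t] by simp
  obtain R where R: "\<And>x. x \<notin> cball 0 R \<Longrightarrow> ?D x = 0"
    using test_fun_supported[OF t] by blast
  obtain B where B: "\<And>x. \<bar>?D x\<bar> \<le> B" "B \<ge> 0"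
    using test_fun_bounded(2)[OF t] by blast
  let ?F = "\<lambda>x s. indicator {0..1::real} s * (u x * ?D (x - s *\<^sub>R y))"
  have "integrable (lborel \<Otimes>\<^sub>M lborel) (\<lambda>(x, s). ?F x s)"
  proof (rule integrableI_bounded)
    have "(\<integral>\<^sup>+p. ennreal (norm (case p of (x, s) \<Rightarrow> ?F x s)) \<partial>(lborel \<Otimes>\<^sub>M lborel))
        = (\<integral>\<^sup>+x. (\<integral>\<^sup>+s. ennreal (norm (?F x s)) \<partial>lborel) \<partial>lborel)"
      by (subst lborel.nn_integral_fst[symmetric]) auto
    also have "\<dots> \<le> (\<integral>\<^sup>+x. ennreal B * (ennreal \<bar>u x\<bar> * indicator (cball 0 (R + norm y)) x) \<partial>lborel)"
    proof (rule nn_integral_mono)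
      fix x :: 'a
      have "norm (?F x s) \<le> B * (\<bar>u x\<bar> * indicator (cball 0 (R + norm y)) x) * indicator {0..1} s" for s
      proof (cases "s \<in> {0..1}")
        case True
        then have "norm (s *\<^sub>R y) \<le> norm y" by (simp add: mult_left_le_one_le)
        then have "norm x \<le> R + norm y" if "norm (x - s *\<^sub>R y) \<le> R"
          using that norm_triangle_ineq[of "x - s *\<^sub>R y" "s *\<^sub>R y"] by simp
        then have "\<bar>?D (x - s *\<^sub>R y)\<bar> \<le> B * indicator (cball 0 (R + norm y)) x"
          using R[of "x - s *\<^sub>R y"] B(1)[of "x - s *\<^sub>R y"] B(2) by (auto simp: indicator_def)
        then have "\<bar>u x\<bar> * \<bar>?D (x - s *\<^sub>R y)\<bar> \<le> \<bar>u x\<bar> * (B * indicator (cball 0 (R + norm y)) x)"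
          by (rule mult_left_mono) simp
        then show ?thesis using True by (simp add: abs_mult ac_simps)
      qed simp
      then have "(\<integral>\<^sup>+s. ennreal (norm (?F x s)) \<partial>lborel)
          \<le> (\<integral>\<^sup>+s. ennreal (B * (\<bar>u x\<bar> * indicator (cball 0 (R + norm y)) x)) * indicator {0..1::real} s \<partial>lborel)"
      proof (intro nn_integral_mono)
        fix s :: real
        assume "\<And>s. norm (?F x s) \<le> B * (\<bar>u x\<bar> * indicator (cball 0 (R + norm y)) x) * indicator {0..1} s"
        from ennreal_leI[OF this[of s]]
        show "ennreal (norm (?F x s)) \<le> ennreal (B * (\<bar>u x\<bar> * indicator (cball 0 (R + norm y)) x)) * indicator {0..1} s"
          by (cases "s \<in> {0..1}") simp_all
      qed
      also have "\<dots> = ennreal (B * (\<bar>u x\<bar> * indicator (cball 0 (R + norm y)) x))"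
        by (subst nn_integral_cmult_indicator) auto
      also have "\<dots> = ennreal B * (ennreal \<bar>u x\<bar> * indicator (cball 0 (R + norm y)) x)"
        using B(2) by (auto simp: ennreal_mult indicator_def)
      finally show "(\<integral>\<^sup>+s. ennreal (norm (?F x s)) \<partial>lborel)
          \<le> ennreal B * (ennreal \<bar>u x\<bar> * indicator (cball 0 (R + norm y)) x)" .
    qed
    also have "\<dots> = ennreal B * local_norm (R + norm y) u"
      unfolding local_norm_def by (rule nn_integral_cmult) measurable
    also have "\<dots> < \<infinity>"
      using local_norm_finite[OF u] by (simp add: ennreal_mult_less_top)
    finally show "(\<integral>\<^sup>+p. ennreal (norm (case p of (x, s) \<Rightarrow> ?F x s)) \<partial>(lborel \<Otimes>\<^sub>M lborel)) < \<infinity>" .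
  qed measurable
  then have "(LINT s|lborel. LINT x|lborel. ?F x s) = (LINT x|lborel. LINT s|lborel. ?F x s)"
    by (rule lborel_pair.Fubini_integral)
  also have "(\<lambda>x. LINT s|lborel. ?F x s) = (\<lambda>x. u x * (bump c h x - bump c h (x - y)))"
    by (rule ext) (simp add: bump_FTC[OF h, symmetric] mult.left_commute flip: integral_mult_right_zero)
  finally show ?thesis by simp
qed

text \<open>
  Both sides have the same integral against every bump. For the right hand side, the weak
  gradient is moved onto the translated bump \<open>bump (c + s y) h\<close>, again a test function, and the integral
  over \<open>s\<close> of its derivative in direction \<open>y\<close> is the difference of the bump and its translate.
\<close>

theorem weak_gradient_FTC:
  assumes w: "has_weak_gradient u g"
  shows "AE x in lborel. u (x + y) - u x = segment_average (\<lambda>x. g x \<bullet> y) y x"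
proof -
  note D = weak_gradientD[OF w]
  let ?g = "\<lambda>x. g x \<bullet> y"
  have [measurable]: "u \<in> borel_measurable borel" "?g \<in> borel_measurable borel"
    using locally_integrable_measurable[OF D(1)] locally_integrable_measurable[OF D(3)] by simp_all
  let ?A = "segment_average ?g y"
  have A: "locally_integrable ?A"
    by (rule locally_integrable_average[OF D(3) segment_weight(1-4)])
  have int: "locally_integrable (\<lambda>x. u (x + y) - u x)"
    by (intro locally_integrable_diff locally_integrable_translate D)
  have "AE x in lborel. u (x + y) - u x - ?A x = 0"
  proof (rule fundamental_lemma)
    show "locally_integrable (\<lambda>x. u (x + y) - u x - ?A x)"
      by (intro locally_integrable_diff int A)
    fix c :: 'a and h :: real assume h: "h > 0"
    let ?\<phi> = "bump c h"
    note t = test_fun_bump[OF h, of c]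
    obtain R where R: "\<And>x. x \<notin> cball 0 R \<Longrightarrow> ?\<phi> x = 0"
      using test_fun_supported[OF t] by blast
    have "(LINT x|lborel. ?A x * ?\<phi> x) = (LINT s|lborel. indicator {0..1} s * (LINT x|lborel. ?g (x + s *\<^sub>R y) * ?\<phi> x))"
      by (rule average_Fubini[OF D(3) segment_weight(1-4), of _ 1 R])
         (use R in \<open>auto simp: bump_nonneg bump_le_1\<close>)
    also have "(\<lambda>s. LINT x|lborel. ?g (x + s *\<^sub>R y) * ?\<phi> x)
        = (\<lambda>s. - (LINT x|lborel. u x * frechet_derivative ?\<phi> (at (x - s *\<^sub>R y)) y))"
    proof
      fix s
      have "(LINT x|lborel. ?g (x + s *\<^sub>R y) * ?\<phi> x) = (LINT x|lborel. ?g (x + s *\<^sub>R y) * ?\<phi> ((x + s *\<^sub>R y) - s *\<^sub>R y))"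
        by simp
      also have "\<dots> = (LINT x|lborel. ?g x * ?\<phi> (x - s *\<^sub>R y))"
        by (rule integral_translate[of "\<lambda>x. ?g x * ?\<phi> (x - s *\<^sub>R y)"]) measurable
      also have "\<dots> = (LINT x|lborel. ?g x * bump (c + s *\<^sub>R y) h x)"
        by (simp only: bump_shift)
      also have "\<dots> = - (LINT x|lborel. u x * frechet_derivative (bump (c + s *\<^sub>R y) h) (at x) y)"
        using weak_gradient_direction[OF w test_fun_bump[OF h]] by simp
      finally show "(LINT x|lborel. ?g (x + s *\<^sub>R y) * ?\<phi> x)
          = - (LINT x|lborel. u x * frechet_derivative ?\<phi> (at (x - s *\<^sub>R y)) y)"
        by (simp only: bump_derivative_shift[OF h])
    qed
    also have "(LINT s|lborel. indicator {0..1} s * - (LINT x|lborel. u x * frechet_derivative ?\<phi> (at (x - s *\<^sub>R y)) y))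
        = - (LINT x|lborel. u x * (?\<phi> x - ?\<phi> (x - y)))"
      using integral_segment_bump[OF D(1) h, of c y] by simp
    also have "\<dots> = (LINT x|lborel. u x * ?\<phi> (x - y)) - (LINT x|lborel. u x * ?\<phi> x)"
      using integrable_test_fun_mult(1)[OF D(1) t] integrable_test_fun_mult(1)[OF D(1) test_fun_bump[OF h, of "c + y"]]
      by (simp add: right_diff_distrib bump_shift)
    also have "(LINT x|lborel. u x * ?\<phi> (x - y)) = (LINT x|lborel. u (x + y) * ?\<phi> ((x + y) - y))"
      by (rule integral_translate[symmetric]) measurable
    finally have "(LINT x|lborel. ?A x * ?\<phi> x) = (LINT x|lborel. (u (x + y) - u x) * ?\<phi> x)"
      using integrable_test_fun_mult(1)[OF D(1) t] integrable_test_fun_mult(1)[OF locally_integrable_translate[OF D(1)] t]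
      by (simp add: left_diff_distrib)
    then show "(LINT x|lborel. (u (x + y) - u x - ?A x) * ?\<phi> x) = 0"
      using integrable_test_fun_mult(1)[OF int t] integrable_test_fun_mult(1)[OF A t]
      by (simp add: left_diff_distrib[of "_ - _" "?A _"])
  qed
  then show ?thesis by eventually_elim simp
qed

lemma average_local_norm_le:
  assumes f: "locally_integrable f" and k: "integrable lborel k" "\<And>s. 0 \<le> k s"
    and \<tau>: "\<tau> \<in> borel_measurable borel" "\<And>s. k s \<noteq> 0 \<Longrightarrow> norm (\<tau> s) \<le> M"
    and one: "(LINT s|lborel. k s) = 1"
  shows "local_norm R (average f k \<tau>) \<le> local_norm (R + M) f"
proof -
  note [measurable] = average_measurables[OF f k \<tau>]
  have "local_norm R (average f k \<tau>)
      \<le> (\<integral>\<^sup>+x. (\<integral>\<^sup>+s. ennreal (k s * \<bar>f (x + \<tau> s)\<bar>) \<partial>lborel) * indicator (cball 0 R) x \<partial>lborel)"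
    unfolding local_norm_def by (intro nn_integral_mono mult_right_mono abs_average_le[OF f k \<tau>]) auto
  also have "\<dots> = (\<integral>\<^sup>+s. ennreal (k s) * local_norm R (\<lambda>x. f (x + \<tau> s)) \<partial>lborel)"
    by (rule nn_integral_average_swap[OF f k \<tau>]) measurable
  also have "\<dots> \<le> ennreal (LINT s|lborel. k s) * local_norm (R + M) f"
    by (intro nn_integral_weight_le[OF f k \<tau>] local_norm_translate_le[OF f k \<tau>] \<tau>(2))
  finally show ?thesis by (simp add: one)
qed

lemma local_norm_cong_AE:
  "AE x in lborel. f x = g x \<Longrightarrow> local_norm R f = local_norm R g"
  unfolding local_norm_def by (rule nn_integral_cong_AE) (erule eventually_mono, simp)

lemma local_norm_cmult: "f \<in> borel_measurable lborel \<Longrightarrow> local_norm R (\<lambda>x. c * f x) = ennreal \<bar>c\<bar> * local_norm R f"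
  unfolding local_norm_def
  by (subst nn_integral_cmult[symmetric]) (auto simp: abs_mult ennreal_mult mult.assoc intro!: nn_integral_cong)

text \<open>
  A translate over \<open>y\<close> costs no more than the mean of \<open>g \<bullet> y\<close> along the segment; this is the
  equicontinuity behind Rellich's theorem.
\<close>

theorem weak_gradient_translation_estimate:
  assumes w: "has_weak_gradient u g" and "norm y \<le> M"
  shows "local_norm R (\<lambda>x. u (x + y) - u x) \<le> local_norm (R + M) (\<lambda>x. g x \<bullet> y)"
proof -
  have "local_norm R (\<lambda>x. u (x + y) - u x) = local_norm R (segment_average (\<lambda>x. g x \<bullet> y) y)"
    by (rule local_norm_cong_AE[OF weak_gradient_FTC[OF w]])
  also have "\<dots> \<le> local_norm (R + M) (\<lambda>x. g x \<bullet> y)"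
    by (rule average_local_norm_le[OF weak_gradientD(3)[OF w] segment_weight(1-3) _ segment_weight(5)])
       (rule order_trans[OF segment_weight(4) assms(2)])
  finally show ?thesis .
qed

lemma tendsto_0_if_eventually_le_ennreal:
  fixes f :: "nat \<Rightarrow> ennreal"
  assumes "\<And>\<epsilon>::real. \<epsilon> > 0 \<Longrightarrow> \<forall>\<^sub>F n in sequentially. f n \<le> ennreal \<epsilon>"
  shows "f \<longlonglongrightarrow> 0"
proof (rule order_tendstoI)
  fix a :: ennreal assume "0 < a"
  then obtain z where z: "0 < z" "z < a" using dense by blast
  then obtain e where "z = ennreal e" "e \<ge> 0"
    by (cases z) auto
  then have e: "e > 0" "ennreal e < a"
    using z by (auto simp: less_le)
  show "\<forall>\<^sub>F n in sequentially. f n < a"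
    using assms[OF e(1)] by eventually_elim (rule le_less_trans[OF _ e(2)])
qed simp

definition difference_quotient :: "('a::euclidean_space \<Rightarrow> real) \<Rightarrow> 'a \<Rightarrow> nat \<Rightarrow> 'a \<Rightarrow> real" where
  "difference_quotient u y n x = real (Suc n) * (u (x + (1 / real (Suc n)) *\<^sub>R y) - u x)"

lemma borel_measurable_difference_quotient:
  assumes [measurable]: "u \<in> borel_measurable borel"
  shows "difference_quotient u y n \<in> borel_measurable borel"
  unfolding difference_quotient_def[abs_def] by measurable

text \<open>
  Difference quotients are segment averages of \<open>g \<bullet> y\<close> over shrinking segments, and averages over
  short segments are close to the function itself.
\<close>

theorem difference_quotient_tendsto:
  assumes w: "has_weak_gradient u g"
  shows "(\<lambda>n. local_norm R (\<lambda>x. difference_quotient u y n x - g x \<bullet> y)) \<longlonglongrightarrow> 0"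
proof (rule tendsto_0_if_eventually_le_ennreal)
  fix \<epsilon> :: real assume \<epsilon>: "\<epsilon> > 0"
  let ?g = "\<lambda>x. g x \<bullet> y"
  note g = weak_gradientD(3)[OF w, of y]
  obtain \<delta> where \<delta>: "\<delta> > 0" "\<And>z. norm z \<le> \<delta> \<Longrightarrow> local_norm R (\<lambda>x. ?g (x + z) - ?g x) \<le> ennreal \<epsilon>"
    using local_translation_continuity[OF g \<epsilon>, of R] by blast
  have "(\<lambda>n. 1 / real (Suc n) * norm y) \<longlonglongrightarrow> 0 * norm y"
    by (intro tendsto_mult_right LIMSEQ_Suc[OF lim_1_over_n])
  then have "\<forall>\<^sub>F n in sequentially. 1 / real (Suc n) * norm y < \<delta>"
    using \<delta>(1) by (intro order_tendstoD(2)) auto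
  then show "\<forall>\<^sub>F n in sequentially. local_norm R (\<lambda>x. difference_quotient u y n x - ?g x) \<le> ennreal \<epsilon>"
  proof eventually_elim
    fix n assume n: "1 / real (Suc n) * norm y < \<delta>"
    define t where "t = 1 / real (Suc n)"
    have t: "t > 0" "real (Suc n) * t = 1" by (simp_all add: t_def)
    let ?A = "segment_average ?g (t *\<^sub>R y)"
    have "AE x in lborel. difference_quotient u y n x = ?A x"
      using weak_gradient_FTC[OF w, of "t *\<^sub>R y"]
    proof eventually_elim
      fix x assume "u (x + t *\<^sub>R y) - u x = segment_average (\<lambda>x. g x \<bullet> (t *\<^sub>R y)) (t *\<^sub>R y) x"
      also have "\<dots> = t * ?A x"
        by (simp add: average_def mult.left_commute flip: integral_mult_right_zero)
      finally have "real (Suc n) * (u (x + t *\<^sub>R y) - u x) = real (Suc n) * t * ?A x"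
        by (simp only: mult.assoc)
      then show "difference_quotient u y n x = ?A x"
        by (simp only: difference_quotient_def t_def[symmetric] t(2) mult_1)
    qed
    then have "AE x in lborel. difference_quotient u y n x - ?g x = ?A x - ?g x"
      by eventually_elim simp
    then have "local_norm R (\<lambda>x. difference_quotient u y n x - ?g x) = local_norm R (\<lambda>x. ?A x - ?g x)"
      by (rule local_norm_cong_AE)
    also have "\<dots> \<le> ennreal \<epsilon>"
    proof (rule average_close[OF g segment_weight(1-5)])
      fix s :: real assume "(indicator {0..1} s :: real) \<noteq> 0"
      then have "norm (s *\<^sub>R (t *\<^sub>R y)) \<le> norm (t *\<^sub>R y)" by (rule segment_weight(4))
      also have "\<dots> \<le> \<delta>" using n by (simp add: t_def)
      finally show "local_norm R (\<lambda>x. ?g (x + s *\<^sub>R (t *\<^sub>R y)) - ?g x) \<le> ennreal \<epsilon>"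
        by (rule \<delta>(2))
    qed
    finally show "local_norm R (\<lambda>x. difference_quotient u y n x - ?g x) \<le> ennreal \<epsilon>" .
  qed
qed

lemma test_fun_difference_le:
  assumes "test_fun \<phi>" "\<And>x. \<bar>frechet_derivative \<phi> (at x) y\<bar> \<le> B"
  shows "\<bar>\<phi> (x + t *\<^sub>R y) - \<phi> x\<bar> \<le> B * \<bar>t\<bar>"
proof -
  have deriv: "((\<lambda>s. \<phi> (x + s *\<^sub>R y)) has_real_derivative frechet_derivative \<phi> (at (x + s *\<^sub>R y)) y) (at s)" for s
  proof -
    have "((\<lambda>s. x + s *\<^sub>R y) has_derivative (\<lambda>r. r *\<^sub>R y)) (at s)"
      by (auto intro!: derivative_eq_intros)
    from diff_chain_at[OF this test_fun_has_derivative[OF assms(1)]]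
    have "((\<lambda>s. \<phi> (x + s *\<^sub>R y)) has_derivative (\<lambda>r. frechet_derivative \<phi> (at (x + s *\<^sub>R y)) (r *\<^sub>R y))) (at s)"
      by (simp add: o_def)
    moreover have "frechet_derivative \<phi> (at (x + s *\<^sub>R y)) (r *\<^sub>R y) = r * frechet_derivative \<phi> (at (x + s *\<^sub>R y)) y" for r
    proof -
      interpret linear "frechet_derivative \<phi> (at (x + s *\<^sub>R y))"
        using test_fun_has_derivative[OF assms(1)] by (rule has_derivative_linear)
      show ?thesis by (simp add: scale)
    qed
    ultimately show ?thesis
      by (intro has_derivative_imp_has_field_derivative) (simp_all add: mult.commute)
  qed
  have "norm (\<phi> (x + t *\<^sub>R y) - \<phi> (x + 0 *\<^sub>R y)) \<le> B * norm (t - 0)"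
    by (rule field_differentiable_bound[of UNIV _ "\<lambda>s. frechet_derivative \<phi> (at (x + s *\<^sub>R y)) y"])
       (use deriv assms(2) in auto)
  then show ?thesis by simp
qed

lemma test_fun_difference_quotient_tendsto:
  assumes "test_fun \<phi>"
  shows "(\<lambda>n. real (Suc n) * (\<phi> (x + (r / real (Suc n)) *\<^sub>R y) - \<phi> x)) \<longlonglongrightarrow> r * frechet_derivative \<phi> (at x) y"
proof -
  have "((\<lambda>s. \<phi> (x + s *\<^sub>R (r *\<^sub>R y))) has_real_derivative r * frechet_derivative \<phi> (at x) y) (at 0)"
  proof -
    have "((\<lambda>s. x + s *\<^sub>R (r *\<^sub>R y)) has_derivative (\<lambda>s. s *\<^sub>R (r *\<^sub>R y))) (at 0)"
      by (auto intro!: derivative_eq_intros)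
    moreover have "(\<phi> has_derivative frechet_derivative \<phi> (at x)) (at (x + 0 *\<^sub>R (r *\<^sub>R y)))"
      using test_fun_has_derivative[OF assms, of x] by simp
    ultimately have "(\<phi> \<circ> (\<lambda>s. x + s *\<^sub>R (r *\<^sub>R y)) has_derivative frechet_derivative \<phi> (at x) \<circ> (\<lambda>s. s *\<^sub>R (r *\<^sub>R y))) (at 0)"
      by (rule diff_chain_at)
    moreover have "frechet_derivative \<phi> (at x) \<circ> (\<lambda>s. s *\<^sub>R (r *\<^sub>R y)) = (*) (r * frechet_derivative \<phi> (at x) y)"
    proof -
      interpret linear "frechet_derivative \<phi> (at x)"
        using test_fun_has_derivative[OF assms] by (rule has_derivative_linear)
      show ?thesis by (auto simp: fun_eq_iff scale)
    qed
    ultimately show ?thesis by (simp add: has_field_derivative_def o_def)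
  qed
  then have *: "((\<lambda>h. (\<phi> (x + h *\<^sub>R (r *\<^sub>R y)) - \<phi> x) / h) \<longlongrightarrow> r * frechet_derivative \<phi> (at x) y) (at 0)"
    by (simp add: DERIV_def)
  have "filterlim (\<lambda>n. 1 / real (Suc n)) (at 0) sequentially"
    unfolding filterlim_at by (intro conjI LIMSEQ_Suc[OF lim_1_over_n]) auto
  from filterlim_compose[OF * this] show ?thesis
    by (simp add: mult.commute)
qed

lemma abs_integral_mult_le_local_norm:
  assumes [measurable]: "f \<in> borel_measurable lborel" "\<psi> \<in> borel_measurable lborel"
    and \<psi>: "\<And>x. \<bar>\<psi> x\<bar> \<le> B" "\<And>x. x \<notin> cball 0 R \<Longrightarrow> \<psi> x = 0"
    and int: "integrable lborel (\<lambda>x. f x * \<psi> x)"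
  shows "ennreal \<bar>LINT x|lborel. f x * \<psi> x\<bar> \<le> ennreal B * local_norm R f"
proof -
  have "ennreal \<bar>LINT x|lborel. f x * \<psi> x\<bar> \<le> (\<integral>\<^sup>+x. ennreal (norm (f x * \<psi> x)) \<partial>lborel)"
    using integral_norm_bound_ennreal[OF int] by simp
  also have "\<dots> \<le> (\<integral>\<^sup>+x. ennreal B * (ennreal \<bar>f x\<bar> * indicator (cball 0 R) x) \<partial>lborel)"
  proof (rule nn_integral_mono)
    fix x :: 'a
    have "B \<ge> 0" using \<psi>(1)[of x] by linarith
    have "\<bar>f x\<bar> * \<bar>\<psi> x\<bar> \<le> \<bar>f x\<bar> * B"
      by (intro mult_left_mono \<psi>) auto
    then show "ennreal (norm (f x * \<psi> x)) \<le> ennreal B * (ennreal \<bar>f x\<bar> * indicator (cball 0 R) x)"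
      using \<psi>(2)[of x] \<open>B \<ge> 0\<close>
      by (auto simp: indicator_def abs_mult mult.commute simp flip: ennreal_mult intro!: ennreal_leI)
  qed
  also have "\<dots> = ennreal B * local_norm R f"
    unfolding local_norm_def by (rule nn_integral_cmult) measurable
  finally show ?thesis .
qed

text \<open>
  By translation invariance the difference quotient can be moved from \<open>u\<close> onto the test function,
  where it converges boundedly to the classical derivative. Together with the previous theorem this
  characterises weak gradients by difference quotients, a form that is convenient for nonlinear
  operations.
\<close>

theorem has_weak_gradient_of_difference_quotients:
  assumes u: "locally_integrable u" and g: "locally_integrable g"
    and lim: "\<And>i R. i \<in> Basis \<Longrightarrow> (\<lambda>n. local_norm R (\<lambda>x. difference_quotient u i n x - g x \<bullet> i)) \<longlonglongrightarrow> 0"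
  shows "has_weak_gradient u g"
  unfolding has_weak_gradient_def
proof (intro conjI allI impI ballI u g)
  fix \<phi> :: "'a \<Rightarrow> real" and i :: 'a assume \<phi>: "test_fun \<phi>" and i: "i \<in> Basis"
  have [measurable]: "u \<in> borel_measurable borel" "\<phi> \<in> borel_measurable borel"
    using locally_integrable_measurable[OF u] borel_measurable_test_fun[OF \<phi>] by simp_all
  note gi = locally_integrable_inner[OF g, of i]
  have [measurable]: "(\<lambda>x. g x \<bullet> i) \<in> borel_measurable borel"
    using locally_integrable_measurable[OF gi] by simp
  obtain R where R: "\<And>x. x \<notin> cball 0 R \<Longrightarrow> \<phi> x = 0"
    using test_fun_supported[OF \<phi>] by blast
  obtain B where B: "\<And>x. \<bar>\<phi> x\<bar> \<le> B"
    using test_fun_bounded(1)[OF \<phi>] by blast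
  obtain C where C: "\<And>x. \<bar>frechet_derivative \<phi> (at x) i\<bar> \<le> C"
    using test_fun_bounded(2)[OF \<phi>, of i] by blast
  have C0: "C \<ge> 0" using C[of 0] by linarith
  let ?d = "difference_quotient u i"
  have d: "locally_integrable (?d n)" for n
  proof (rule locally_integrable_bound[of "\<lambda>x. u (x + (1 / real (Suc n)) *\<^sub>R i) - u x" _ "real (Suc n)" 0])
    show "locally_integrable (\<lambda>x. u (x + (1 / real (Suc n)) *\<^sub>R i) - u x)"
      by (intro locally_integrable_diff locally_integrable_translate u)
  qed (simp_all add: difference_quotient_def abs_mult borel_measurable_difference_quotient)
  have [measurable]: "?d n \<in> borel_measurable borel" for n
    by (simp add: borel_measurable_difference_quotient)
  have left: "(\<lambda>n. LINT x|lborel. ?d n x * \<phi> x) \<longlonglongrightarrow> (LINT x|lborel. (g x \<bullet> i) * \<phi> x)"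
  proof -
    have int: "integrable lborel (\<lambda>x. ?d n x * \<phi> x)" "integrable lborel (\<lambda>x. (g x \<bullet> i) * \<phi> x)" for n
      by (intro integrable_test_fun_mult(1) d gi \<phi>)+
    have "ennreal \<bar>(LINT x|lborel. ?d n x * \<phi> x) - (LINT x|lborel. (g x \<bullet> i) * \<phi> x)\<bar>
        \<le> ennreal B * local_norm R (\<lambda>x. ?d n x - g x \<bullet> i)" for n
    proof -
      have "(LINT x|lborel. ?d n x * \<phi> x) - (LINT x|lborel. (g x \<bullet> i) * \<phi> x) = (LINT x|lborel. (?d n x - g x \<bullet> i) * \<phi> x)"
        using int by (simp add: left_diff_distrib)
      moreover have "integrable lborel (\<lambda>x. (?d n x - g x \<bullet> i) * \<phi> x)"
        using int by (simp add: left_diff_distrib)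
      ultimately show ?thesis
        using abs_integral_mult_le_local_norm[OF _ _ B R, of "\<lambda>x. ?d n x - g x \<bullet> i"] by simp
    qed
    note le = this
    have "(\<lambda>n. ennreal B * local_norm R (\<lambda>x. ?d n x - g x \<bullet> i)) \<longlonglongrightarrow> ennreal B * 0"
      by (intro ennreal_tendsto_cmult lim i) simp
    then have up: "(\<lambda>n. ennreal B * local_norm R (\<lambda>x. ?d n x - g x \<bullet> i)) \<longlonglongrightarrow> 0"
      by simp
    have "(\<lambda>n. ennreal \<bar>(LINT x|lborel. ?d n x * \<phi> x) - (LINT x|lborel. (g x \<bullet> i) * \<phi> x)\<bar>) \<longlonglongrightarrow> 0"
      by (rule tendsto_sandwich[OF _ _ tendsto_const up]) (simp_all add: le)
    then have "(\<lambda>n. (LINT x|lborel. ?d n x * \<phi> x) - (LINT x|lborel. (g x \<bullet> i) * \<phi> x)) \<longlonglongrightarrow> 0"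
      unfolding ennreal_0[symmetric] by (subst (asm) tendsto_ennreal_iff) (simp_all only: tendsto_rabs_zero_iff, simp_all)
    then show ?thesis by (simp only: LIM_zero_iff)
  qed
  have shift: "(LINT x|lborel. ?d n x * \<phi> x) = (LINT x|lborel. u x * (real (Suc n) * (\<phi> (x + (- 1 / real (Suc n)) *\<^sub>R i) - \<phi> x)))" for n
  proof -
    let ?y = "(1 / real (Suc n)) *\<^sub>R i"
    have int: "integrable lborel (\<lambda>x. u (x + ?y) * \<phi> x)" "integrable lborel (\<lambda>x. u x * \<phi> x)"
      by (intro integrable_test_fun_mult(1) locally_integrable_translate u \<phi>)+
    have "(LINT x|lborel. u (x + ?y) * \<phi> ((x + ?y) - ?y)) = (LINT x|lborel. u x * \<phi> (x - ?y))"
      by (rule integral_translate[of "\<lambda>x. u x * \<phi> (x - ?y)"]) measurable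
    moreover have "integrable lborel (\<lambda>x. u x * \<phi> (x - ?y))"
      using integrable_translate[OF int(1), of "- ?y"] by simp
    ultimately have "(LINT x|lborel. (u (x + ?y) - u x) * \<phi> x) = (LINT x|lborel. u x * (\<phi> (x - ?y) - \<phi> x))"
      using int by (simp add: left_diff_distrib right_diff_distrib)
    then have "real (Suc n) * (LINT x|lborel. (u (x + ?y) - u x) * \<phi> x)
        = real (Suc n) * (LINT x|lborel. u x * (\<phi> (x - ?y) - \<phi> x))"
      by (simp only:)
    then show ?thesis
      by (simp add: difference_quotient_def mult.assoc mult.left_commute flip: integral_mult_right_zero)
  qed
  have "(\<lambda>n. LINT x|lborel. u x * (real (Suc n) * (\<phi> (x + (- 1 / real (Suc n)) *\<^sub>R i) - \<phi> x)))
      \<longlonglongrightarrow> (LINT x|lborel. u x * (- 1 * frechet_derivative \<phi> (at x) i))"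
  proof (rule integral_dominated_convergence[where w = "\<lambda>x. C * \<bar>indicator (cball 0 (R + 1)) x * u x\<bar>"])
    show "integrable lborel (\<lambda>x. C * \<bar>indicator (cball 0 (R + 1)) x * u x\<bar>)"
      by (intro integrable_mult_right integrable_abs locally_integrable_cball u)
    show "AE x in lborel. (\<lambda>n. u x * (real (Suc n) * (\<phi> (x + (- 1 / real (Suc n)) *\<^sub>R i) - \<phi> x)))
        \<longlonglongrightarrow> u x * (- 1 * frechet_derivative \<phi> (at x) i)"
      by (intro AE_I2 tendsto_mult_left test_fun_difference_quotient_tendsto \<phi>)
    show "AE x in lborel. norm (u x * (real (Suc n) * (\<phi> (x + (- 1 / real (Suc n)) *\<^sub>R i) - \<phi> x)))
        \<le> C * \<bar>indicator (cball 0 (R + 1)) x * u x\<bar>" for n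
    proof (rule AE_I2)
      fix x
      have le: "real (Suc n) * \<bar>\<phi> (x + (- 1 / real (Suc n)) *\<^sub>R i) - \<phi> x\<bar> \<le> C"
      proof -
        have "\<bar>\<phi> (x + (- 1 / real (Suc n)) *\<^sub>R i) - \<phi> x\<bar> \<le> C * \<bar>- 1 / real (Suc n)\<bar>"
          by (rule test_fun_difference_le[OF \<phi> C])
        then have "real (Suc n) * \<bar>\<phi> (x + (- 1 / real (Suc n)) *\<^sub>R i) - \<phi> x\<bar> \<le> real (Suc n) * (C * \<bar>- 1 / real (Suc n)\<bar>)"
          by (rule mult_left_mono) simp
        also have "\<dots> = C" by simp
        finally show ?thesis .
      qed
      have zero: "\<phi> (x + (- 1 / real (Suc n)) *\<^sub>R i) - \<phi> x = 0" if "x \<notin> cball 0 (R + 1)"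
      proof -
        define v where "v = (- 1 / real (Suc n)) *\<^sub>R i"
        have "norm v \<le> 1" using i by (simp add: v_def)
        moreover have "norm x \<le> norm (x + v) + norm v"
          using norm_triangle_ineq4[of "x + v" v] by simp
        moreover have "R + 1 < norm x" using that by simp
        ultimately have "x + v \<notin> cball 0 R" by simp
        then have "x + (- 1 / real (Suc n)) *\<^sub>R i \<notin> cball 0 R"
          unfolding v_def .
        moreover have "x \<notin> cball 0 R" using that by auto
        ultimately show ?thesis using R by simp
      qed
      show "norm (u x * (real (Suc n) * (\<phi> (x + (- 1 / real (Suc n)) *\<^sub>R i) - \<phi> x)))
          \<le> C * \<bar>indicator (cball 0 (R + 1)) x * u x\<bar>"
      proof (cases "x \<in> cball 0 (R + 1)")
        case True
        have "\<bar>u x\<bar> * (real (Suc n) * \<bar>\<phi> (x + (- 1 / real (Suc n)) *\<^sub>R i) - \<phi> x\<bar>) \<le> \<bar>u x\<bar> * C"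
          using le by (rule mult_left_mono) simp
        then show ?thesis using True by (simp only: real_norm_def abs_mult indicator_simps abs_of_nat abs_one mult_1 mult.commute[of C])
      next
        case False
        then show ?thesis using zero[OF False] by (simp only: mult_zero_right) (simp add: C0)
      qed
    qed
  qed (use borel_measurable_test_fun_derivative[OF \<phi>, of i] in measurable)
  then have "(\<lambda>n. LINT x|lborel. ?d n x * \<phi> x) \<longlonglongrightarrow> - (LINT x|lborel. u x * frechet_derivative \<phi> (at x) i)"
    by (simp add: shift)
  from LIMSEQ_unique[OF left this]
  show "(LINT x|lborel. u x * frechet_derivative \<phi> (at x) i) = - (LINT x|lborel. (g x \<bullet> i) * \<phi> x)" by simp
qed

theorem weak_gradient_unique:
  assumes "has_weak_gradient u g" "has_weak_gradient u g'"
  shows "AE x in lborel. g x = g' x"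
proof -
  have "AE x in lborel. g x \<bullet> i - g' x \<bullet> i = 0" if i: "i \<in> Basis" for i
  proof (rule fundamental_lemma)
    show "locally_integrable (\<lambda>x. g x \<bullet> i - g' x \<bullet> i)"
      by (intro locally_integrable_diff weak_gradientD(3)[OF assms(1)] weak_gradientD(3)[OF assms(2)])
    fix c :: 'a and h :: real assume "h > 0"
    note t = test_fun_bump[OF this, of c]
    show "(LINT x|lborel. (g x \<bullet> i - g' x \<bullet> i) * bump c h x) = 0"
      using weak_gradient_direction[OF assms(1) t, of i] weak_gradient_direction[OF assms(2) t, of i]
        integrable_test_fun_mult(1)[OF weak_gradientD(3)[OF assms(1), of i] t]
        integrable_test_fun_mult(1)[OF weak_gradientD(3)[OF assms(2), of i] t]
      by (simp add: left_diff_distrib)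
  qed
  then have "AE x in lborel. \<forall>i\<in>Basis. g x \<bullet> i - g' x \<bullet> i = 0"
    by (intro AE_finite_allI) auto
  then show ?thesis
    by eventually_elim (auto intro: euclidean_eqI)
qed

lemma local_norm_dominated:
  fixes f :: "nat \<Rightarrow> 'a::euclidean_space \<Rightarrow> real"
  assumes [measurable]: "\<And>n. f n \<in> borel_measurable borel"
    and lim: "AE x in lborel. (\<lambda>n. f n x) \<longlonglongrightarrow> 0"
    and le: "\<And>n x. \<bar>f n x\<bar> \<le> w x" and w: "locally_integrable w"
  shows "(\<lambda>n. local_norm R (f n)) \<longlonglongrightarrow> 0"
proof -
  have [measurable]: "w \<in> borel_measurable borel"
    using locally_integrable_measurable[OF w] by simp
  have "(\<lambda>n. local_norm R (f n)) \<longlonglongrightarrow> (\<integral>\<^sup>+x. 0 \<partial>(lborel :: 'a measure))"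
    unfolding local_norm_def
  proof (rule nn_integral_dominated_convergence[where w = "\<lambda>x. ennreal \<bar>w x\<bar> * indicator (cball 0 R) x"])
    show "AE x in lborel. ennreal \<bar>f n x\<bar> * indicator (cball 0 R) x \<le> ennreal \<bar>w x\<bar> * indicator (cball 0 R) x" for n
      using order_trans[OF le abs_ge_self] by (intro AE_I2 mult_right_mono ennreal_leI) auto
    show "(\<integral>\<^sup>+x. ennreal \<bar>w x\<bar> * indicator (cball 0 R) x \<partial>lborel) < \<infinity>"
      using local_norm_finite[OF w, of R] by (simp add: local_norm_def)
    show "AE x in lborel. (\<lambda>n. ennreal \<bar>f n x\<bar> * indicator (cball 0 R) x) \<longlonglongrightarrow> 0"
      using lim
    proof eventually_elim
      fix x assume "(\<lambda>n. f n x) \<longlonglongrightarrow> 0"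
      then have "(\<lambda>n. ennreal (\<bar>f n x\<bar> * indicator (cball 0 R) x)) \<longlonglongrightarrow> ennreal (\<bar>0\<bar> * indicator (cball 0 R) x)"
        by (intro tendsto_intros)
      then show "(\<lambda>n. ennreal \<bar>f n x\<bar> * indicator (cball 0 R) x) \<longlonglongrightarrow> 0"
        by (auto simp: ennreal_mult indicator_def)
    qed
  qed measurable
  then show ?thesis by simp
qed

lemma locally_integrable_const: "locally_integrable (\<lambda>_::'a::euclidean_space. c :: real)"
  by (rule locally_integrable_bound[of "\<lambda>_. 0 :: real" _ 0 "\<bar>c\<bar>"])
     (auto simp: locally_integrable_def set_integrable_def)

text \<open>
  With \<open>h = 1 / (n + 1)\<close> and the difference quotient \<open>d\<close> of \<open>u\<close>, the difference quotient of \<open>G \<circ> u\<close> is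
  \<open>(G (u + h d) - G u) / h\<close>. Replacing \<open>d\<close> by the limit \<open>g \<bullet> i\<close> costs at most \<open>L \<bar>d - g \<bullet> i\<bar>\<close>, as \<open>G\<close> is
  Lipschitz, and \<open>(G (u + h (g \<bullet> i)) - G u) / h\<close> converges pointwise, dominated by \<open>L \<bar>g \<bullet> i\<bar>\<close>.
\<close>

theorem weak_gradient_chain_rule:
  assumes w: "has_weak_gradient u g"
    and G: "\<And>t. (G has_real_derivative G' t) (at t)" "\<And>t. \<bar>G' t\<bar> \<le> L" "G' \<in> borel_measurable borel"
  shows "has_weak_gradient (\<lambda>x. G (u x)) (\<lambda>x. G' (u x) *\<^sub>R g x)"
proof (rule has_weak_gradient_of_difference_quotients)
  note D = weak_gradientD[OF w]
  have [measurable]: "u \<in> borel_measurable borel" "g \<in> borel_measurable borel" "G' \<in> borel_measurable borel"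
    using D(1,2) G(3) by (auto simp: locally_integrable_def)
  have "continuous_on UNIV G"
    by (rule continuous_at_imp_continuous_on) (use DERIV_isCont[OF G(1)] in simp)
  then have [measurable]: "G \<in> borel_measurable borel"
    by (rule borel_measurable_continuous_onI)
  have L: "L \<ge> 0" using G(2)[of 0] by linarith
  have lip: "\<bar>G a - G b\<bar> \<le> L * \<bar>a - b\<bar>" for a b
    using field_differentiable_bound[of UNIV G G' L a b] G(1,2) by auto
  show "locally_integrable (\<lambda>x. G (u x))"
  proof (rule locally_integrable_bound[OF D(1)])
    show "norm (G (u x)) \<le> L * norm (u x) + \<bar>G 0\<bar>" for x
      using lip[of "u x" 0] by simp
  qed measurable
  show "locally_integrable (\<lambda>x. G' (u x) *\<^sub>R g x)"
  proof (rule locally_integrable_bound[OF D(2)])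
    show "norm (G' (u x) *\<^sub>R g x) \<le> L * norm (g x) + 0" for x
      using G(2)[of "u x"] by (simp add: mult_right_mono)
  qed measurable
  fix i :: 'a and R
  let ?h = "\<lambda>n. 1 / real (Suc n)"
  let ?d = "difference_quotient u i"
  let ?p = "\<lambda>n x. real (Suc n) * (G (u x + ?h n * ?d n x) - G (u x + ?h n * (g x \<bullet> i)))"
  let ?q = "\<lambda>n x. real (Suc n) * (G (u x + ?h n * (g x \<bullet> i)) - G (u x)) - G' (u x) * (g x \<bullet> i)"
  have [measurable]: "?d n \<in> borel_measurable borel" for n
    by (simp add: borel_measurable_difference_quotient)
  have scaled: "real (Suc n) * \<bar>G (a + ?h n * s) - G (a + ?h n * t)\<bar> \<le> L * \<bar>s - t\<bar>" for n a s t
  proof -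
    have "\<bar>(a + ?h n * s) - (a + ?h n * t)\<bar> = ?h n * \<bar>s - t\<bar>"
      by (simp add: abs_mult flip: diff_divide_distrib)
    then have "\<bar>G (a + ?h n * s) - G (a + ?h n * t)\<bar> \<le> L * (?h n * \<bar>s - t\<bar>)"
      using lip[of "a + ?h n * s" "a + ?h n * t"] by (simp only:)
    then have "real (Suc n) * \<bar>G (a + ?h n * s) - G (a + ?h n * t)\<bar> \<le> real (Suc n) * (L * (?h n * \<bar>s - t\<bar>))"
      by (rule mult_left_mono) simp
    then show ?thesis by simp
  qed
  have split: "difference_quotient (\<lambda>x. G (u x)) i n x - (G' (u x) *\<^sub>R g x) \<bullet> i = ?p n x + ?q n x" for n x
  proof -
    have "u (x + ?h n *\<^sub>R i) = u x + ?h n * ?d n x"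
      by (simp add: difference_quotient_def)
    then have "difference_quotient (\<lambda>x. G (u x)) i n x = real (Suc n) * (G (u x + ?h n * ?d n x) - G (u x))"
      by (simp only: difference_quotient_def)
    then show ?thesis
      by (simp only: right_diff_distrib inner_scaleR_left)
  qed
  have le: "local_norm R (\<lambda>x. difference_quotient (\<lambda>x. G (u x)) i n x - (G' (u x) *\<^sub>R g x) \<bullet> i)
      \<le> ennreal \<bar>L\<bar> * local_norm R (\<lambda>x. ?d n x - g x \<bullet> i) + local_norm R (?q n)" for n
  proof -
    have "local_norm R (\<lambda>x. difference_quotient (\<lambda>x. G (u x)) i n x - (G' (u x) *\<^sub>R g x) \<bullet> i)
        \<le> local_norm R (?p n) + local_norm R (?q n)"
      unfolding split by (rule local_norm_triangle) measurable
    also have "local_norm R (?p n) \<le> local_norm R (\<lambda>x. L * (?d n x - g x \<bullet> i))"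
    proof (rule local_norm_mono)
      fix x show "\<bar>?p n x\<bar> \<le> \<bar>L * (?d n x - g x \<bullet> i)\<bar>"
        using scaled[of n "u x" "?d n x" "g x \<bullet> i"] L by (simp only: abs_mult abs_of_nat abs_of_nonneg)
    qed
    also have "\<dots> = ennreal \<bar>L\<bar> * local_norm R (\<lambda>x. ?d n x - g x \<bullet> i)"
      by (rule local_norm_cmult) measurable
    finally show ?thesis by (simp add: add_right_mono)
  qed
  have "(\<lambda>n. local_norm R (?q n)) \<longlonglongrightarrow> 0"
  proof (rule local_norm_dominated[where w = "\<lambda>x. 2 * L * \<bar>g x \<bullet> i\<bar>"])
    show "AE x in lborel. (\<lambda>n. ?q n x) \<longlonglongrightarrow> 0"
    proof (rule AE_I2)
      fix x
      have "((\<lambda>s. G (u x + s * (g x \<bullet> i))) has_real_derivative G' (u x) * (g x \<bullet> i)) (at 0)"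
        by (rule DERIV_chain2[where f = G and g = "\<lambda>s. u x + s * (g x \<bullet> i)"])
           (use G(1)[of "u x"] in \<open>auto intro!: derivative_eq_intros\<close>)
      then have "((\<lambda>h. (G (u x + h * (g x \<bullet> i)) - G (u x)) / h) \<longlongrightarrow> G' (u x) * (g x \<bullet> i)) (at 0)"
        by (simp add: DERIV_def)
      moreover have "filterlim (\<lambda>n. ?h n) (at 0) sequentially"
        unfolding filterlim_at by (intro conjI LIMSEQ_Suc[OF lim_1_over_n]) auto
      ultimately have "(\<lambda>n. (G (u x + ?h n * (g x \<bullet> i)) - G (u x)) / ?h n) \<longlonglongrightarrow> G' (u x) * (g x \<bullet> i)"
        by (rule filterlim_compose)
      then have "(\<lambda>n. (G (u x + ?h n * (g x \<bullet> i)) - G (u x)) / ?h n - G' (u x) * (g x \<bullet> i)) \<longlonglongrightarrow> 0"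
        by (simp only: LIM_zero_iff)
      then show "(\<lambda>n. ?q n x) \<longlonglongrightarrow> 0"
        by (simp add: mult.commute)
    qed
    show "\<bar>?q n x\<bar> \<le> 2 * L * \<bar>g x \<bullet> i\<bar>" for n x
    proof -
      have "real (Suc n) * \<bar>G (u x + ?h n * (g x \<bullet> i)) - G (u x)\<bar> \<le> L * \<bar>g x \<bullet> i\<bar>"
        using scaled[of n "u x" "g x \<bullet> i" 0] by (simp only: mult_zero_right add_0_right diff_0_right)
      moreover have "\<bar>G' (u x) * (g x \<bullet> i)\<bar> \<le> L * \<bar>g x \<bullet> i\<bar>"
        using G(2) by (simp add: abs_mult mult_right_mono)
      moreover have "\<bar>?q n x\<bar> \<le> real (Suc n) * \<bar>G (u x + ?h n * (g x \<bullet> i)) - G (u x)\<bar> + \<bar>G' (u x) * (g x \<bullet> i)\<bar>"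
        by (rule order_trans[OF abs_triangle_ineq4]) (simp only: abs_mult abs_of_nat order_refl)
      ultimately show ?thesis by linarith
    qed
    show "locally_integrable (\<lambda>x. 2 * L * \<bar>g x \<bullet> i\<bar>)"
      by (rule locally_integrable_bound[OF D(3)[of i], of _ "2 * L" 0]) (use L in \<open>auto simp: abs_mult\<close>)
  qed measurable
  moreover have "(\<lambda>n. ennreal \<bar>L\<bar> * local_norm R (\<lambda>x. ?d n x - g x \<bullet> i)) \<longlonglongrightarrow> ennreal \<bar>L\<bar> * 0"
    by (intro ennreal_tendsto_cmult difference_quotient_tendsto w) simp
  ultimately have up: "(\<lambda>n. ennreal \<bar>L\<bar> * local_norm R (\<lambda>x. ?d n x - g x \<bullet> i) + local_norm R (?q n)) \<longlonglongrightarrow> ennreal \<bar>L\<bar> * 0 + 0"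
    by (intro tendsto_add)
  show "(\<lambda>n. local_norm R (\<lambda>x. difference_quotient (\<lambda>x. G (u x)) i n x - (G' (u x) *\<^sub>R g x) \<bullet> i)) \<longlonglongrightarrow> 0"
  proof (rule tendsto_sandwich[OF always_eventually always_eventually tendsto_const])
    show "(\<lambda>n. ennreal \<bar>L\<bar> * local_norm R (\<lambda>x. ?d n x - g x \<bullet> i) + local_norm R (?q n)) \<longlonglongrightarrow> 0"
      using up by (simp only: mult_zero_right add_0_right)
  qed (intro allI zero_le, intro allI le)
qed

definition classical_gradient :: "('a::euclidean_space \<Rightarrow> real) \<Rightarrow> 'a \<Rightarrow> 'a" where
  "classical_gradient \<phi> x = (\<Sum>i\<in>Basis. frechet_derivative \<phi> (at x) i *\<^sub>R i)"

lemma classical_gradient_inner: "i \<in> Basis \<Longrightarrow> classical_gradient \<phi> x \<bullet> i = frechet_derivative \<phi> (at x) i"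
  by (simp add: classical_gradient_def)

lemma borel_measurable_classical_gradient:
  "test_fun \<phi> \<Longrightarrow> classical_gradient \<phi> \<in> borel_measurable borel"
  unfolding classical_gradient_def[abs_def] using borel_measurable_test_fun_derivative
  by (intro borel_measurable_sum borel_measurable_scaleR) simp_all

lemma classical_gradient_bounded:
  assumes "test_fun \<phi>"
  shows "\<exists>B\<ge>0. \<forall>x. norm (classical_gradient \<phi> x) \<le> B"
proof -
  have "\<exists>B\<ge>0. \<forall>x. \<bar>frechet_derivative \<phi> (at x) i\<bar> \<le> B" for i
    by (rule test_fun_bounded(2)[OF assms])
  then obtain B where B: "\<And>i. B i \<ge> 0" "\<And>i x. \<bar>frechet_derivative \<phi> (at x) i\<bar> \<le> B i" by metis
  have "norm (classical_gradient \<phi> x) \<le> (\<Sum>i\<in>Basis. B i)" for x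
    unfolding classical_gradient_def by (rule order_trans[OF norm_sum sum_mono]) (use B in simp)
  then show ?thesis using B(1) by (intro exI[of _ "\<Sum>i\<in>Basis. B i"]) (auto intro: sum_nonneg)
qed

lemma test_fun_has_weak_gradient:
  assumes \<phi>: "test_fun \<phi>"
  shows "has_weak_gradient \<phi> (classical_gradient \<phi>)"
proof (rule has_weak_gradient_of_difference_quotients)
  have [measurable]: "\<phi> \<in> borel_measurable borel"
    using borel_measurable_test_fun[OF \<phi>] by simp
  obtain B where B: "\<And>x. \<bar>\<phi> x\<bar> \<le> B" using test_fun_bounded(1)[OF \<phi>] by blast
  show "locally_integrable \<phi>"
    by (rule locally_integrable_bound[OF locally_integrable_const[of 0], of _ 0 B]) (use B in auto)
  obtain C where C: "\<And>x. norm (classical_gradient \<phi> x) \<le> C" using classical_gradient_bounded[OF \<phi>] by blast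
  show "locally_integrable (classical_gradient \<phi>)"
    by (rule locally_integrable_bound[OF locally_integrable_const[of 0], of _ 0 C])
       (use C borel_measurable_classical_gradient[OF \<phi>] in auto)
  fix i :: 'a and R assume i: "i \<in> Basis"
  obtain D where D: "\<And>x. \<bar>frechet_derivative \<phi> (at x) i\<bar> \<le> D"
    using test_fun_bounded(2)[OF \<phi>, of i] by blast
  have [measurable]: "(\<lambda>x. frechet_derivative \<phi> (at x) i) \<in> borel_measurable borel"
    using borel_measurable_test_fun_derivative[OF \<phi>] by simp
  have [measurable]: "difference_quotient \<phi> i n \<in> borel_measurable borel" for n
    by (simp add: borel_measurable_difference_quotient)
  show "(\<lambda>n. local_norm R (\<lambda>x. difference_quotient \<phi> i n x - classical_gradient \<phi> x \<bullet> i)) \<longlonglongrightarrow> 0"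
    unfolding classical_gradient_inner[OF i]
  proof (rule local_norm_dominated[where w = "\<lambda>_. 2 * D"])
    show "AE x in lborel. (\<lambda>n. difference_quotient \<phi> i n x - frechet_derivative \<phi> (at x) i) \<longlonglongrightarrow> 0"
    proof (rule AE_I2)
      fix x
      show "(\<lambda>n. difference_quotient \<phi> i n x - frechet_derivative \<phi> (at x) i) \<longlonglongrightarrow> 0"
        using test_fun_difference_quotient_tendsto[OF \<phi>, of x 1 i]
        unfolding difference_quotient_def mult_1 by (simp only: LIM_zero_iff)
    qed
    show "\<bar>difference_quotient \<phi> i n x - frechet_derivative \<phi> (at x) i\<bar> \<le> 2 * D" for n x
    proof -
      have "\<bar>difference_quotient \<phi> i n x\<bar> \<le> real (Suc n) * (D * \<bar>1 / real (Suc n)\<bar>)"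
        unfolding difference_quotient_def abs_mult abs_of_nat
        by (intro mult_left_mono test_fun_difference_le \<phi> D) simp
      also have "\<dots> = D" by simp
      finally show ?thesis using D[of x] by linarith
    qed
  qed (use locally_integrable_const in measurable)
qed

lemma locally_integrable_cong_AE:
  assumes f: "locally_integrable f" "f' \<in> borel_measurable lborel" "AE x in lborel. f x = f' x"
  shows "locally_integrable f'"
  unfolding locally_integrable_def set_integrable_def
proof (intro conjI allI impI)
  fix K :: "'a set" assume K: "compact K"
  then have "integrable lborel (\<lambda>x. indicator K x *\<^sub>R f x)"
    using f(1) by (simp add: locally_integrable_def set_integrable_def)
  moreover have "K \<in> sets lborel" using K by (simp add: borel_compact)
  ultimately show "integrable lborel (\<lambda>x. indicator K x *\<^sub>R f' x)"
    using f(2,3) by (subst integrable_cong_AE[symmetric, where f = "\<lambda>x. indicator K x *\<^sub>R f x"])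
      (auto simp: locally_integrable_def elim: eventually_mono)
qed (rule f)

lemma has_weak_gradient_cong_AE:
  assumes "has_weak_gradient u g" "u' \<in> borel_measurable lborel" "g' \<in> borel_measurable lborel"
    and "AE x in lborel. u x = u' x" "AE x in lborel. g x = g' x"
  shows "has_weak_gradient u' g'"
proof -
  have meas: "u \<in> borel_measurable lborel" "g \<in> borel_measurable lborel"
    using assms(1) by (auto simp: has_weak_gradient_def locally_integrable_def)
  have "(LINT x|lborel. u' x * frechet_derivative \<phi> (at x) i) = - (LINT x|lborel. (g' x \<bullet> i) * \<phi> x)"
    if "test_fun \<phi>" "i \<in> Basis" for \<phi> i
  proof -
    note [measurable] = borel_measurable_test_fun[OF that(1)] borel_measurable_test_fun_derivative[OF that(1), of i] assms(2,3) meas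
    have "(LINT x|lborel. u' x * frechet_derivative \<phi> (at x) i) = (LINT x|lborel. u x * frechet_derivative \<phi> (at x) i)"
      by (rule integral_cong_AE) (measurable, use assms(4) in eventually_elim, simp)
    also have "\<dots> = - (LINT x|lborel. (g x \<bullet> i) * \<phi> x)"
      using assms(1) that by (simp add: has_weak_gradient_def)
    also have "(LINT x|lborel. (g x \<bullet> i) * \<phi> x) = (LINT x|lborel. (g' x \<bullet> i) * \<phi> x)"
      by (rule integral_cong_AE) (measurable, use assms(5) in eventually_elim, simp)
    finally show ?thesis .
  qed
  moreover have "locally_integrable u'" "locally_integrable g'"
    using assms by (auto simp: has_weak_gradient_def intro: locally_integrable_cong_AE)
  ultimately show ?thesis
    by (simp add: has_weak_gradient_def)
qed

lemma local_norm_mono_radius: "r \<le> R \<Longrightarrow> local_norm r f \<le> local_norm R f"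
  unfolding local_norm_def by (intro nn_integral_mono mult_left_mono) (auto simp: indicator_def)

text \<open>
  Along a subsequence with \<open>local_norm k (d (r k)) \<le> 2 ^ (- k)\<close> the series \<open>\<Sum> \<bar>d (r k)\<bar>\<close> is integrable on
  every ball, once finitely many terms are dropped.
\<close>

theorem local_norm_subsequence_AE:
  fixes d :: "nat \<Rightarrow> 'a::euclidean_space \<Rightarrow> real"
  assumes [measurable]: "\<And>n. d n \<in> borel_measurable borel"
    and lim: "\<And>R. (\<lambda>n. local_norm R (d n)) \<longlonglongrightarrow> 0"
  shows "\<exists>r. strict_mono (r :: nat \<Rightarrow> nat) \<and> (AE x in lborel. (\<lambda>k. d (r k) x) \<longlonglongrightarrow> 0)"
proof -
  have ex: "\<exists>n>m. local_norm (real k) (d n) < ennreal ((1/2) ^ k)" for m k :: nat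
  proof -
    have "\<forall>\<^sub>F n in sequentially. local_norm (real k) (d n) < ennreal ((1/2) ^ k)"
      by (rule order_tendstoD(2)[OF lim]) simp
    then have "\<forall>\<^sub>F n in sequentially. local_norm (real k) (d n) < ennreal ((1/2) ^ k) \<and> n > m"
      using eventually_gt_at_top[of m] by eventually_elim simp
    then show ?thesis
      using eventually_happens'[OF sequentially_bot] by blast
  qed
  have "\<exists>r. \<forall>k. local_norm (real k) (d (r k)) < ennreal ((1/2) ^ k) \<and> (r k :: nat) < r (Suc k)"
  proof (rule dependent_nat_choice)
    show "\<exists>n. local_norm (real 0) (d n) < ennreal ((1/2) ^ 0)" using ex[of 0 0] by blast
    show "\<exists>n. local_norm (real (Suc k)) (d n) < ennreal ((1/2) ^ Suc k) \<and> m < n" for m k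
      using ex[of m "Suc k"] by blast
  qed
  then obtain r where r: "\<And>k. local_norm (real k) (d (r k)) < ennreal ((1/2) ^ k)" "strict_mono r"
    by (auto simp: strict_mono_Suc_iff)
  have "AE x in lborel. norm x \<le> real N \<longrightarrow> (\<lambda>k. d (r k) x) \<longlonglongrightarrow> 0" for N
  proof -
    let ?f = "\<lambda>k x. ennreal \<bar>d (r (k + N)) x\<bar> * indicator (cball 0 (real N)) x"
    have "(\<integral>\<^sup>+x. (\<Sum>k. ?f k x) \<partial>lborel) = (\<Sum>k. local_norm (real N) (d (r (k + N))))"
      unfolding local_norm_def by (rule nn_integral_suminf) measurable
    also have "\<dots> \<le> (\<Sum>k. ennreal ((1/2) ^ k))"
    proof (intro suminf_le)
      fix k
      have "local_norm (real N) (d (r (k + N))) \<le> local_norm (real (k + N)) (d (r (k + N)))"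
        by (rule local_norm_mono_radius) simp
      also have "\<dots> \<le> ennreal ((1/2) ^ (k + N))"
        using r(1) by (rule less_imp_le)
      also have "\<dots> \<le> ennreal ((1/2) ^ k)"
        by (intro ennreal_leI power_decreasing) auto
      finally show "local_norm (real N) (d (r (k + N))) \<le> ennreal ((1/2) ^ k)" .
    qed auto
    also have "\<dots> = ennreal (\<Sum>k. (1/2) ^ k)"
      by (intro suminf_ennreal2) auto
    also have "\<dots> < \<infinity>" by simp
    finally have "AE x in lborel. (\<Sum>k. ?f k x) \<noteq> \<infinity>"
      by (intro nn_integral_noteq_infinite) auto
    then show ?thesis
    proof eventually_elim
      fix x assume fin: "(\<Sum>k. ?f k x) \<noteq> \<infinity>"
      show "norm x \<le> real N \<longrightarrow> (\<lambda>k. d (r k) x) \<longlonglongrightarrow> 0"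
      proof
        assume "norm x \<le> real N"
        then have "summable (\<lambda>k. \<bar>d (r (k + N)) x\<bar>)"
          using fin by (intro summable_suminf_not_top) auto
        then have "(\<lambda>k. \<bar>d (r (k + N)) x\<bar>) \<longlonglongrightarrow> 0"
          by (rule summable_LIMSEQ_zero)
        then have "(\<lambda>k. d (r (k + N)) x) \<longlonglongrightarrow> 0"
          by (simp only: tendsto_rabs_zero_iff)
        then show "(\<lambda>k. d (r k) x) \<longlonglongrightarrow> 0"
          by (rule LIMSEQ_offset)
      qed
    qed
  qed
  then have "AE x in lborel. \<forall>N. norm x \<le> real N \<longrightarrow> (\<lambda>k. d (r k) x) \<longlonglongrightarrow> 0"
    unfolding AE_all_countable by blast
  then have "AE x in lborel. (\<lambda>k. d (r k) x) \<longlonglongrightarrow> 0"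
    by eventually_elim (use real_arch_simple in blast)
  then show ?thesis using r(2) by blast
qed

section \<open>The truncated power nonlinearity\<close>

definition odd_power :: "real \<Rightarrow> real \<Rightarrow> real" where
  "odd_power a t = \<bar>t\<bar> powr (a - 2) * t"

definition clamp_at :: "real \<Rightarrow> real \<Rightarrow> real" where
  "clamp_at \<delta> t = max (- \<delta>) (min \<delta> t)"

lemma odd_power_nonneg: "t \<ge> 0 \<Longrightarrow> odd_power a t = t powr (a - 1)"
proof (cases "t = 0")
  case False
  assume "t \<ge> 0"
  have "t powr (a - 1) = t powr ((a - 2) + 1)" by simp
  also have "\<dots> = t powr (a - 2) * t powr 1" by (rule powr_add)
  finally have "t powr (a - 1) = t powr (a - 2) * t powr 1" .
  then show ?thesis using False \<open>t \<ge> 0\<close> by (simp add: odd_power_def)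
qed (simp add: odd_power_def)

lemma odd_power_uminus: "odd_power a (- t) = - odd_power a t"
  by (simp add: odd_power_def)

lemma odd_power_eq: "odd_power a t = (max 0 t) powr (a - 1) - (max 0 (- t)) powr (a - 1)"
proof (cases "t \<ge> 0")
  case True
  then show ?thesis by (simp add: odd_power_nonneg max_def)
next
  case False
  then have "odd_power a t = - odd_power a (- t)" by (simp add: odd_power_uminus)
  also have "odd_power a (- t) = (- t) powr (a - 1)" using False by (intro odd_power_nonneg) simp
  finally show ?thesis using False by (simp add: max_def)
qed

lemma abs_odd_power: "\<bar>odd_power a t\<bar> = \<bar>t\<bar> powr (a - 1)"
  using odd_power_nonneg[of "\<bar>t\<bar>" a] by (simp add: odd_power_def abs_mult)

lemma odd_power_mult_self: "odd_power a t * t = \<bar>t\<bar> powr a"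
proof (cases "t = 0")
  case False
  have "odd_power a t * t = \<bar>t\<bar> powr (a - 2) * \<bar>t\<bar> powr 2"
    using False by (simp add: odd_power_def power2_eq_square mult.assoc)
  also have "\<dots> = \<bar>t\<bar> powr ((a - 2) + 2)" by (rule powr_add[symmetric])
  also have "\<dots> = \<bar>t\<bar> powr a" by simp
  finally show ?thesis .
qed (simp add: odd_power_def)

lemma continuous_on_odd_power: "a > 1 \<Longrightarrow> continuous_on UNIV (odd_power a)"
  unfolding odd_power_eq[abs_def]
  by (intro continuous_on_diff continuous_on_powr' continuous_on_max continuous_on_minus
      continuous_on_const continuous_on_id) auto

lemma odd_power_mono: "a > 1 \<Longrightarrow> s \<le> t \<Longrightarrow> odd_power a s \<le> odd_power a t"
  unfolding odd_power_eq by (intro diff_mono powr_mono2) auto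

lemma continuous_on_clamp_at: "continuous_on A (clamp_at \<delta>)"
  unfolding clamp_at_def[abs_def] by (intro continuous_intros)

lemma clamp_at_uminus: "\<delta> \<ge> 0 \<Longrightarrow> clamp_at \<delta> (- t) = - clamp_at \<delta> t"
  by (auto simp: clamp_at_def max_def min_def)

lemma abs_clamp_at_le: "\<delta> \<ge> 0 \<Longrightarrow> \<bar>clamp_at \<delta> t\<bar> \<le> \<delta>"
  by (auto simp: clamp_at_def)

lemma clamp_at_eq: "\<bar>t\<bar> \<le> \<delta> \<Longrightarrow> clamp_at \<delta> t = t"
  by (auto simp: clamp_at_def)

text \<open>
  This is the tangent at \<open>c\<close> to the convex function \<open>\<bar>t\<bar> powr a / a\<close>.
\<close>

definition tangent_power :: "real \<Rightarrow> real \<Rightarrow> real \<Rightarrow> real" where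
  "tangent_power a c t = odd_power a c * t - (1 - 1 / a) * \<bar>c\<bar> powr a"

text \<open>
  A primitive of \<open>odd_power a (clamp_at \<delta> t)\<close>: it equals \<open>\<bar>t\<bar> powr a / a\<close> on \<open>[-\<delta>, \<delta>]\<close> and continues
  along the tangents at the end points.
\<close>

definition truncated_power :: "real \<Rightarrow> real \<Rightarrow> real \<Rightarrow> real" where
  "truncated_power a \<delta> t = tangent_power a (clamp_at \<delta> t) t"

lemma tangent_power_self: "tangent_power a t t = \<bar>t\<bar> powr a / a"
  unfolding tangent_power_def odd_power_mult_self by (simp add: algebra_simps)

text \<open>
  This is Young's inequality for the exponents \<open>a\<close> and \<open>a / (a - 1)\<close>.
\<close>

lemma tangent_power_le:
  assumes a: "a > 1"
  shows "tangent_power a c t \<le> \<bar>t\<bar> powr a / a"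
proof -
  let ?b = "a / (a - 1)"
  have "odd_power a c * t \<le> \<bar>t\<bar> * \<bar>c\<bar> powr (a - 1)"
    using abs_ge_self[of "odd_power a c * t"] by (simp add: abs_mult abs_odd_power mult.commute)
  also have "\<dots> \<le> \<bar>t\<bar> powr a / a + (\<bar>c\<bar> powr (a - 1)) powr ?b / ?b"
    using a by (intro Youngs_inequality) (auto simp: field_simps)
  also have "(\<bar>c\<bar> powr (a - 1)) powr ?b = \<bar>c\<bar> powr a"
    using a by (simp add: powr_powr)
  also have "\<bar>c\<bar> powr a / ?b = (1 - 1 / a) * \<bar>c\<bar> powr a"
    using a by (simp add: field_simps)
  finally show ?thesis by (simp add: tangent_power_def)
qed

lemma tangent_power_uminus: "tangent_power a (- c) (- t) = tangent_power a c t"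
  by (simp add: tangent_power_def odd_power_uminus)

text \<open>
  Beyond \<open>\<delta>\<close> the truncated power is the tangent at \<open>\<delta>\<close>, which is above any tangent at \<open>\<bar>c\<bar> \<le> \<delta>\<close> at the point
  \<open>\<delta>\<close> and has the larger slope. So the truncated power is a supremum of tangents, hence convex.
\<close>

lemma tangent_power_le_truncated:
  assumes a: "a > 1" and \<delta>: "\<delta> > 0" and c: "\<bar>c\<bar> \<le> \<delta>"
  shows "tangent_power a c t \<le> truncated_power a \<delta> t"
proof -
  have big: "tangent_power a c t \<le> tangent_power a \<delta> t" if c: "\<bar>c\<bar> \<le> \<delta>" and t: "t > \<delta>" for c t
  proof -
    have "tangent_power a c t = tangent_power a c \<delta> + odd_power a c * (t - \<delta>)"
      by (simp add: tangent_power_def algebra_simps)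
    also have "\<dots> \<le> tangent_power a \<delta> \<delta> + odd_power a \<delta> * (t - \<delta>)"
      using tangent_power_le[OF a, of c \<delta>] c t \<delta> a
      by (intro add_mono mult_right_mono odd_power_mono) (auto simp: tangent_power_self)
    also have "\<dots> = tangent_power a \<delta> t"
      by (simp add: tangent_power_def algebra_simps)
    finally show ?thesis .
  qed
  consider "\<bar>t\<bar> \<le> \<delta>" | "t > \<delta>" | "- t > \<delta>" by linarith
  then show ?thesis
  proof cases
    case 1
    then show ?thesis
      using tangent_power_le[OF a, of c t] by (simp add: truncated_power_def clamp_at_eq tangent_power_self)
  next
    case 2
    then show ?thesis
      using big[OF c 2] \<delta> by (simp add: truncated_power_def clamp_at_def)
  next
    case 3
    then have "clamp_at \<delta> t = - \<delta>" using \<delta> by (simp add: clamp_at_def)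
    moreover have "tangent_power a (- c) (- t) \<le> tangent_power a \<delta> (- t)"
      by (rule big) (use c 3 in auto)
    ultimately show ?thesis
      using tangent_power_uminus[of a \<delta> "- t"] by (simp add: truncated_power_def tangent_power_uminus)
  qed
qed

lemma truncated_power_subgradient:
  assumes "a > 1" "\<delta> > 0"
  shows "truncated_power a \<delta> s + odd_power a (clamp_at \<delta> s) * (t - s) \<le> truncated_power a \<delta> t"
proof -
  have "truncated_power a \<delta> s + odd_power a (clamp_at \<delta> s) * (t - s) = tangent_power a (clamp_at \<delta> s) t"
    by (simp add: truncated_power_def tangent_power_def algebra_simps)
  also have "\<dots> \<le> truncated_power a \<delta> t"
    using assms by (intro tangent_power_le_truncated abs_clamp_at_le) auto
  finally show ?thesis .
qed

lemma truncated_power_eq: "\<bar>t\<bar> \<le> \<delta> \<Longrightarrow> truncated_power a \<delta> t = \<bar>t\<bar> powr a / a"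
  by (simp add: truncated_power_def clamp_at_eq tangent_power_self)

lemma truncated_power_0: "\<delta> \<ge> 0 \<Longrightarrow> truncated_power a \<delta> 0 = 0"
  by (simp add: truncated_power_eq)

lemma continuous_on_clamped_odd_power:
  "a > 1 \<Longrightarrow> continuous_on UNIV (\<lambda>t. odd_power a (clamp_at \<delta> t))"
  by (rule continuous_on_compose2[OF continuous_on_odd_power continuous_on_clamp_at]) auto

lemma continuous_on_truncated_power:
  "a > 1 \<Longrightarrow> continuous_on UNIV (truncated_power a \<delta>)"
  unfolding truncated_power_def[abs_def] tangent_power_def
  by (intro continuous_on_diff continuous_on_mult continuous_on_powr' continuous_on_rabs
      continuous_on_const continuous_on_id continuous_on_clamped_odd_power continuous_on_clamp_at) auto

lemma abs_clamped_odd_power_le: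
  "a > 1 \<Longrightarrow> \<delta> > 0 \<Longrightarrow> \<bar>odd_power a (clamp_at \<delta> t)\<bar> \<le> \<delta> powr (a - 1)"
  unfolding abs_odd_power by (intro powr_mono2 abs_clamp_at_le) auto

lemma truncated_power_nonneg: "a > 1 \<Longrightarrow> \<delta> > 0 \<Longrightarrow> 0 \<le> truncated_power a \<delta> t"
  using truncated_power_subgradient[of a \<delta> 0 t]
  by (simp add: truncated_power_0 clamp_at_eq odd_power_def)

section \<open>The energy space of a confining potential\<close>

lemma square_integrable_Pair:
  fixes f :: "'a::euclidean_space \<Rightarrow> 'b::euclidean_space" and g :: "'a \<Rightarrow> 'c::euclidean_space"
  assumes "square_integrable f" "square_integrable g"
  shows "square_integrable (\<lambda>t. (f t, g t))"
proof (rule square_integrable_bound)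
  show "integrable lborel (\<lambda>t. (norm (f t))\<^sup>2 + (norm (g t))\<^sup>2)"
    using assms by (auto simp: square_integrable_def)
  show "(\<lambda>t. (f t, g t)) \<in> borel_measurable lborel"
    using assms by (auto simp: square_integrable_def)
qed (simp add: norm_Pair)

lemma square_integrable_fst_snd:
  fixes f :: "'a::euclidean_space \<Rightarrow> 'b::euclidean_space \<times> 'c::euclidean_space"
  assumes "square_integrable f"
  shows "square_integrable (\<lambda>t. fst (f t))" "square_integrable (\<lambda>t. snd (f t))"
proof -
  have [measurable]: "f \<in> borel_measurable borel" using assms by (simp add: square_integrable_def)
  have [measurable]: "(\<lambda>t. fst (f t)) \<in> borel_measurable borel" "(\<lambda>t. snd (f t)) \<in> borel_measurable borel"
    by (auto intro!: borel_measurable_continuous_on[OF _ \<open>f \<in> borel_measurable borel\<close>] continuous_intros)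
  have "norm (fst p) \<le> norm p" "norm (snd p) \<le> norm p" for p :: "'b \<times> 'c"
    using norm_fst_le[of "fst p" "snd p"] norm_snd_le[of "snd p" "fst p"] by simp_all
  note le = this
  show "square_integrable (\<lambda>t. fst (f t))"
    by (rule square_integrable_bound[OF _ square_integrable_norm[OF assms]])
       (simp, intro AE_I2 power_mono norm_ge_zero le)
  show "square_integrable (\<lambda>t. snd (f t))"
    by (rule square_integrable_bound[OF _ square_integrable_norm[OF assms]])
       (simp, intro AE_I2 power_mono norm_ge_zero le)
qed

lemma square_integrable_locally_integrable:
  fixes f :: "'a::euclidean_space \<Rightarrow> 'b::euclidean_space"
  assumes "square_integrable f"
  shows "locally_integrable f"
proof (rule locally_integrable_bound[of "\<lambda>x. (norm (f x))\<^sup>2" _ 1 1])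
  have i: "integrable lborel (\<lambda>x. (norm (f x))\<^sup>2)" using assms by (simp add: square_integrable_def)
  show "locally_integrable (\<lambda>x. (norm (f x))\<^sup>2)"
    unfolding locally_integrable_def set_integrable_def
    using i by (intro conjI allI impI integrable_mult_indicator) (auto simp: borel_compact)
  show "f \<in> borel_measurable lborel" using assms by (rule square_integrableD)
  fix x
  have "0 \<le> (norm (f x) - 1)\<^sup>2" by simp
  then have "2 * norm (f x) \<le> (norm (f x))\<^sup>2 + 1" by (simp add: power2_diff)
  moreover have "norm (f x) \<ge> 0" by simp
  ultimately have "norm (f x) \<le> (norm (f x))\<^sup>2 + 1" by linarith
  then show "norm (f x) \<le> 1 * norm ((norm (f x))\<^sup>2) + 1" by simp
qed

locale confining_potential =
  fixes V :: "'a::euclidean_space \<Rightarrow> real" and V0 :: real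
  assumes V_cont: "continuous_on UNIV V" and V0_pos: "V0 > 0" and V_ge: "V0 \<le> V x"
    and V_int: "integrable lborel (\<lambda>x. 1 / V x)"
begin

lemma V_pos: "V x > 0"
  using V_ge[of x] V0_pos by linarith

lemma V_nonzero [simp]: "V x \<noteq> 0"
  using V_pos[of x] by simp

lemma V_measurable [measurable]: "V \<in> borel_measurable borel"
  by (rule borel_measurable_continuous_onI[OF V_cont])

text \<open>
  The factor \<open>sqrt (V t)\<close> turns the inner product of the energy space into that of an \<open>L\<^sup>2\<close> space, so
  that a function with its gradient becomes an element of a space known to be complete. The
  functions \<open>fn\<close> and \<open>gr\<close> recover the two components from such an element.
\<close>

definition pack :: "('a \<Rightarrow> real) \<Rightarrow> ('a \<Rightarrow> 'a) \<Rightarrow> ('a, real \<times> 'a) l2" where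
  "pack u g = l2_of (\<lambda>t. (sqrt (V t) * u t, g t))"

definition fn :: "('a, real \<times> 'a) l2 \<Rightarrow> 'a \<Rightarrow> real" where
  "fn x t = fst (l2_fun x t) / sqrt (V t)"

definition gr :: "('a, real \<times> 'a) l2 \<Rightarrow> 'a \<Rightarrow> 'a" where
  "gr x t = snd (l2_fun x t)"

lemma square_integrable_components:
  "square_integrable (\<lambda>t. fst (l2_fun x t))" "square_integrable (gr x)"
  using square_integrable_fst_snd[OF square_integrable_l2_fun[of x]] by (simp_all add: gr_def[abs_def])

lemma fst_l2_fun: "fst (l2_fun x t) = sqrt (V t) * fn x t"
  using V_pos[of t] by (simp add: fn_def)

lemma measurable_components [measurable]:
  "(\<lambda>t. fst (l2_fun x t)) \<in> borel_measurable borel" "fn x \<in> borel_measurable borel" "gr x \<in> borel_measurable borel"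
proof -
  show 1: "(\<lambda>t. fst (l2_fun x t)) \<in> borel_measurable borel" "gr x \<in> borel_measurable borel"
    using square_integrable_components[of x] by (simp_all add: square_integrable_def)
  show "fn x \<in> borel_measurable borel"
    unfolding fn_def[abs_def] by (intro borel_measurable_divide 1) measurable
qed

lemma integrable_V_square: "integrable lborel (\<lambda>t. V t * (fn x t)\<^sup>2)"
proof -
  have "(norm (fst (l2_fun x t)))\<^sup>2 = V t * (fn x t)\<^sup>2" for t
    using V_pos[of t] by (simp add: fst_l2_fun power_mult_distrib)
  then show ?thesis
    using square_integrable_norm[OF square_integrable_components(1)[of x]] by simp
qed

lemma square_integrable_fn: "square_integrable (fn x)"
proof (rule square_integrable_bound)
  show "integrable lborel (\<lambda>t. 1 / V0 * (V t * (fn x t)\<^sup>2))"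
    by (intro integrable_mult_right integrable_V_square)
  show "AE t in lborel. (norm (fn x t))\<^sup>2 \<le> 1 / V0 * (V t * (fn x t)\<^sup>2)"
    using V_ge V0_pos by (intro AE_I2) (simp add: field_simps mult_right_mono)
qed simp

lemma square_integrable_inverse_sqrt:
  assumes [measurable]: "w \<in> borel_measurable borel" and "\<And>t. \<bar>w t\<bar> \<le> B"
  shows "square_integrable (\<lambda>t. w t / sqrt (V t))"
proof (rule square_integrable_bound)
  show "integrable lborel (\<lambda>t. B\<^sup>2 * (1 / V t))"
    by (intro integrable_mult_right V_int)
  have "(w t)\<^sup>2 \<le> B\<^sup>2" for t
    using power_mono[OF assms(2)[of t], of 2] by simp
  then show "AE t in lborel. (norm (w t / sqrt (V t)))\<^sup>2 \<le> B\<^sup>2 * (1 / V t)"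
    using V_pos by (intro AE_I2) (simp add: power_divide less_imp_le divide_right_mono)
qed measurable

lemma inner_l2_of_Pair:
  assumes w: "square_integrable w" and z: "square_integrable z"
  shows "inner (l2_of (\<lambda>t. (w t, z t))) x = (LINT t|lborel. w t * (sqrt (V t) * fn x t)) + (LINT t|lborel. z t \<bullet> gr x t)"
    and "integrable lborel (\<lambda>t. w t * (sqrt (V t) * fn x t))" "integrable lborel (\<lambda>t. z t \<bullet> gr x t)"
proof -
  show 1: "integrable lborel (\<lambda>t. w t * (sqrt (V t) * fn x t))" "integrable lborel (\<lambda>t. z t \<bullet> gr x t)"
    using integrable_inner_square_integrable[OF w square_integrable_components(1)[of x]]
      integrable_inner_square_integrable[OF z square_integrable_components(2)[of x]]
    by (simp_all add: fst_l2_fun)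
  have "inner (w t, z t) (l2_fun x t) = w t * (sqrt (V t) * fn x t) + z t \<bullet> gr x t" for t
    by (simp add: inner_prod_def fst_l2_fun gr_def)
  then show "inner (l2_of (\<lambda>t. (w t, z t))) x = (LINT t|lborel. w t * (sqrt (V t) * fn x t)) + (LINT t|lborel. z t \<bullet> gr x t)"
    using 1 by (simp add: inner_l2_of[OF square_integrable_Pair[OF w z]])
qed

lemma inner_weighted:
  assumes [measurable]: "w \<in> borel_measurable borel" and "\<And>t. \<bar>w t\<bar> \<le> B" and z: "square_integrable z"
  shows "inner (l2_of (\<lambda>t. (w t / sqrt (V t), z t))) x = (LINT t|lborel. w t * fn x t) + (LINT t|lborel. z t \<bullet> gr x t)"
    and "integrable lborel (\<lambda>t. w t * fn x t)"
proof -
  have "w t / sqrt (V t) * (sqrt (V t) * fn x t) = w t * fn x t" for t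
    using V_pos[of t] by simp
  then show "inner (l2_of (\<lambda>t. (w t / sqrt (V t), z t))) x = (LINT t|lborel. w t * fn x t) + (LINT t|lborel. z t \<bullet> gr x t)"
    "integrable lborel (\<lambda>t. w t * fn x t)"
    using inner_l2_of_Pair[OF square_integrable_inverse_sqrt[OF assms(1,2)] z, of x] by simp_all
qed

lemma inner_eq:
  shows "inner x y = (LINT t|lborel. V t * fn x t * fn y t) + (LINT t|lborel. gr x t \<bullet> gr y t)"
    and "integrable lborel (\<lambda>t. V t * fn x t * fn y t)" "integrable lborel (\<lambda>t. gr x t \<bullet> gr y t)"
proof -
  have "sqrt (V t) * fn x t * (sqrt (V t) * fn y t) = (sqrt (V t) * sqrt (V t)) * fn x t * fn y t" for t
    by (simp only: ac_simps)
  then have eq: "(\<lambda>t. fst (l2_fun x t) * (sqrt (V t) * fn y t)) = (\<lambda>t. V t * fn x t * fn y t)"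
    using V_pos by (auto simp: fst_l2_fun less_imp_le)
  have "l2_of (\<lambda>t. (fst (l2_fun x t), gr x t)) = x"
    by (simp add: gr_def)
  then show "inner x y = (LINT t|lborel. V t * fn x t * fn y t) + (LINT t|lborel. gr x t \<bullet> gr y t)"
    using inner_l2_of_Pair(1)[OF square_integrable_components[of x], of y] unfolding eq by (simp only:)
  show "integrable lborel (\<lambda>t. V t * fn x t * fn y t)" "integrable lborel (\<lambda>t. gr x t \<bullet> gr y t)"
    using inner_l2_of_Pair(2,3)[OF square_integrable_components[of x], of y] unfolding eq by (simp_all only:)
qed

lemma norm_eq:
  "(norm x)\<^sup>2 = (LINT t|lborel. V t * (fn x t)\<^sup>2) + (LINT t|lborel. (norm (gr x t))\<^sup>2)"
  unfolding power2_norm_eq_inner by (simp add: inner_eq power2_eq_square mult.assoc)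

lemma integrable_fn: "integrable lborel (fn x)"
  using inner_weighted(2)[of "\<lambda>_. 1" 1 "\<lambda>_. 0" x] by (simp add: square_integrable_0)

lemma pack:
  assumes [measurable]: "u \<in> borel_measurable borel" and u: "integrable lborel (\<lambda>t. V t * (u t)\<^sup>2)"
    and g: "square_integrable g"
  shows "AE t in lborel. fn (pack u g) t = u t" "AE t in lborel. gr (pack u g) t = g t"
proof -
  have "square_integrable (\<lambda>t. sqrt (V t) * u t)"
    using u V_pos by (simp add: square_integrable_def power_mult_distrib less_imp_le)
  then have "AE t in lborel. l2_fun (pack u g) t = (sqrt (V t) * u t, g t)"
    unfolding pack_def by (intro AE_l2_fun_l2_of square_integrable_Pair g)
  then show "AE t in lborel. fn (pack u g) t = u t" "AE t in lborel. gr (pack u g) t = g t"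
    by (eventually_elim, use V_pos in \<open>simp add: fn_def gr_def less_imp_neq[symmetric]\<close>)+
qed

lemma fn_ops:
  "AE t in lborel. fn (x + y) t = fn x t + fn y t"
  "AE t in lborel. fn (x - y) t = fn x t - fn y t"
  "AE t in lborel. fn (c *\<^sub>R x) t = c * fn x t"
  "AE t in lborel. fn (- x) t = - fn x t"
  "AE t in lborel. fn 0 t = 0"
proof -
  show "AE t in lborel. fn (x + y) t = fn x t + fn y t"
    using AE_l2_ops(2)[of x y] by eventually_elim (simp add: fn_def add_divide_distrib)
  show "AE t in lborel. fn (x - y) t = fn x t - fn y t"
    using AE_l2_ops(4)[of x y] by eventually_elim (simp add: fn_def diff_divide_distrib)
  show "AE t in lborel. fn (c *\<^sub>R x) t = c * fn x t"
    using AE_l2_ops(5)[of c x] by eventually_elim (simp add: fn_def)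
  show "AE t in lborel. fn (- x) t = - fn x t"
    using AE_l2_ops(3)[of x] by eventually_elim (simp add: fn_def)
  show "AE t in lborel. fn 0 t = 0"
    using AE_l2_ops(1)[where 'a='a and 'b="real \<times> 'a"] by eventually_elim (simp add: fn_def)
qed

lemma eq_iff_fn_gr: "x = y \<longleftrightarrow> (AE t in lborel. fn x t = fn y t \<and> gr x t = gr y t)"
proof -
  have "l2_fun x t = l2_fun y t \<longleftrightarrow> fn x t = fn y t \<and> gr x t = gr y t" for t
    by (auto simp: prod_eq_iff fst_l2_fun gr_def)
  then show ?thesis by (simp add: l2_eq_iff)
qed

text \<open>
  Orthogonality to these elements is the defining identity of a weak gradient. The energy space
  is therefore an orthogonal complement, which makes it a closed subspace at once.
\<close>

definition test_element :: "('a \<Rightarrow> real) \<Rightarrow> 'a \<Rightarrow> ('a, real \<times> 'a) l2" where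
  "test_element \<phi> i = l2_of (\<lambda>t. (frechet_derivative \<phi> (at t) i / sqrt (V t), \<phi> t *\<^sub>R i))"

definition energy_space :: "('a, real \<times> 'a) l2 set" where
  "energy_space = {x. \<forall>\<phi>. test_fun \<phi> \<longrightarrow> (\<forall>i\<in>Basis. inner (test_element \<phi> i) x = 0)}"

lemma square_integrable_test_fun:
  assumes "test_fun \<phi>" shows "square_integrable (\<lambda>t. \<phi> t *\<^sub>R i)"
proof -
  obtain B where B: "\<And>x. \<bar>\<phi> x\<bar> \<le> B" using test_fun_bounded(1)[OF assms] by blast
  obtain R where R: "\<And>x. x \<notin> cball 0 R \<Longrightarrow> \<phi> x = 0" using test_fun_supported[OF assms] by blast
  have [measurable]: "\<phi> \<in> borel_measurable borel" using borel_measurable_test_fun[OF assms] by simp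
  have "locally_integrable \<phi>" by (rule weak_gradientD(1)[OF test_fun_has_weak_gradient[OF assms]])
  then have "integrable lborel (\<lambda>x. \<phi> x * \<phi> x)" by (rule integrable_test_fun_mult(1)[OF _ assms])
  then have "integrable lborel (\<lambda>x. (norm i)\<^sup>2 * (\<phi> x * \<phi> x))" by (rule integrable_mult_right)
  moreover have "(norm (\<phi> x *\<^sub>R i))\<^sup>2 = (norm i)\<^sup>2 * (\<phi> x * \<phi> x)" for x
    by (simp add: power_mult_distrib power2_eq_square[symmetric])
  ultimately show ?thesis
    by (simp add: square_integrable_def)
qed

lemma inner_test_element:
  assumes "test_fun \<phi>"
  shows "inner (test_element \<phi> i) x = (LINT t|lborel. fn x t * frechet_derivative \<phi> (at t) i) + (LINT t|lborel. (gr x t \<bullet> i) * \<phi> t)"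
proof -
  obtain B where B: "\<And>x. \<bar>frechet_derivative \<phi> (at x) i\<bar> \<le> B" using test_fun_bounded(2)[OF assms, of i] by blast
  have "(\<lambda>t. frechet_derivative \<phi> (at t) i) \<in> borel_measurable borel"
    using borel_measurable_test_fun_derivative[OF assms, of i] by simp
  from inner_weighted(1)[OF this B square_integrable_test_fun[OF assms]]
  show ?thesis
    by (simp add: test_element_def mult.commute inner_commute)
qed

lemma energy_space_iff: "x \<in> energy_space \<longleftrightarrow> has_weak_gradient (fn x) (gr x)"
proof -
  have "locally_integrable (fn x)" "locally_integrable (gr x)"
    by (intro square_integrable_locally_integrable square_integrable_fn square_integrable_components)+
  then show ?thesis
    by (auto simp: energy_space_def has_weak_gradient_def inner_test_element eq_neg_iff_add_eq_0)
qed

lemma energy_space_closed_subspace: "subspace energy_space" "closed energy_space"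
proof -
  show "subspace energy_space"
    by (auto simp: subspace_def energy_space_def inner_add_right)
  have "energy_space = (\<Inter>\<phi>\<in>{\<phi>. test_fun \<phi>}. \<Inter>i\<in>Basis. {x. inner (test_element \<phi> i) x = 0})"
    by (auto simp: energy_space_def)
  then show "closed energy_space"
    by (auto intro!: closed_INT closed_Collect_eq continuous_intros)
qed

lemma energy_space_determined_by_fn:
  assumes "x \<in> energy_space" "y \<in> energy_space" "AE t in lborel. fn x t = fn y t"
  shows "x = y"
proof -
  have "has_weak_gradient (fn y) (gr x)"
    by (rule has_weak_gradient_cong_AE[OF _ _ _ assms(3)]) (use assms(1) in \<open>auto simp: energy_space_iff\<close>)
  then have "AE t in lborel. gr x t = gr y t"
    by (rule weak_gradient_unique) (use assms(2) in \<open>simp add: energy_space_iff\<close>)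
  then show ?thesis
    using assms(3) unfolding eq_iff_fn_gr by eventually_elim simp
qed

lemma pack_in_energy_space:
  assumes w: "has_weak_gradient u g" and u: "integrable lborel (\<lambda>t. V t * (u t)\<^sup>2)" and g: "square_integrable g"
  shows "pack u g \<in> energy_space"
proof -
  have m: "u \<in> borel_measurable borel" using locally_integrable_measurable[OF weak_gradientD(1)[OF w]] by simp
  have "AE t in lborel. u t = fn (pack u g) t" "AE t in lborel. g t = gr (pack u g) t"
    using pack[OF m u g] by (auto elim: eventually_mono)
  then show ?thesis
    unfolding energy_space_iff by (intro has_weak_gradient_cong_AE[OF w]) auto
qed

subsection \<open>Rellich compactness\<close>

text \<open>
  Since \<open>s \<le> s\<^sup>2 + 1\<close>, square integrability bounds the integral over a ball up to the volume of the ball.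
\<close>

lemma cball_integral_le:
  fixes f :: "'a \<Rightarrow> 'b::euclidean_space"
  assumes f: "square_integrable f" and le: "(LINT x|lborel. (norm (f x))\<^sup>2) \<le> B"
  shows "local_norm R (\<lambda>x. norm (f x)) \<le> ennreal (B + measure lborel (cball 0 R :: 'a set))"
proof -
  have fin: "emeasure lborel (cball 0 R :: 'a set) < \<infinity>" by (rule emeasure_lborel_cball_finite)
  have [measurable]: "f \<in> borel_measurable borel" using f by (simp add: square_integrable_def)
  have "local_norm R (\<lambda>x. norm (f x)) \<le> (\<integral>\<^sup>+x. ennreal ((norm (f x))\<^sup>2) + indicator (cball 0 R) x \<partial>lborel)"
    unfolding local_norm_def
  proof (rule nn_integral_mono)
    fix x
    have "0 \<le> (norm (f x) - 1)\<^sup>2" by simp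
    then have "2 * norm (f x) \<le> (norm (f x))\<^sup>2 + 1" by (simp add: power2_diff)
    moreover have "0 \<le> norm (f x)" by simp
    ultimately have "ennreal (norm (f x)) \<le> ennreal ((norm (f x))\<^sup>2 + 1)" by (intro ennreal_leI) linarith
    then show "ennreal \<bar>norm (f x)\<bar> * indicator (cball 0 R) x \<le> ennreal ((norm (f x))\<^sup>2) + indicator (cball 0 R) x"
      by (simp add: indicator_def)
  qed
  also have "\<dots> = (\<integral>\<^sup>+x. ennreal ((norm (f x))\<^sup>2) \<partial>lborel) + emeasure lborel (cball 0 R :: 'a set)"
    by (subst nn_integral_add) auto
  also have "(\<integral>\<^sup>+x. ennreal ((norm (f x))\<^sup>2) \<partial>lborel) = ennreal (LINT x|lborel. (norm (f x))\<^sup>2)"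
    by (intro nn_integral_eq_integral square_integrable_norm f) simp
  also have "emeasure lborel (cball 0 R :: 'a set) = ennreal (measure lborel (cball 0 R :: 'a set))"
    using fin by (intro emeasure_eq_ennreal_measure) simp
  also have "ennreal (LINT x|lborel. (norm (f x))\<^sup>2) + \<dots> \<le> ennreal (B + measure lborel (cball 0 R :: 'a set))"
    using le order_trans[OF integral_nonneg_AE le] by (subst ennreal_plus[symmetric]) (auto intro!: ennreal_leI)
  finally show ?thesis .
qed

lemma fn_gr_square_le:
  assumes "norm x \<le> B"
  shows "(LINT t|lborel. (norm (fn x t))\<^sup>2) \<le> B\<^sup>2 / V0" "(LINT t|lborel. (norm (gr x t))\<^sup>2) \<le> B\<^sup>2"
proof -
  have n: "(norm x)\<^sup>2 \<le> B\<^sup>2" using assms by (simp add: power_mono)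
  have nn: "0 \<le> (LINT t|lborel. V t * (fn x t)\<^sup>2)" "0 \<le> (LINT t|lborel. (norm (gr x t))\<^sup>2)"
    using V_pos by (auto intro!: integral_nonneg_AE AE_I2 simp: less_imp_le)
  then show "(LINT t|lborel. (norm (gr x t))\<^sup>2) \<le> B\<^sup>2" using n norm_eq[of x] by linarith
  have "(LINT t|lborel. (norm (fn x t))\<^sup>2) \<le> (LINT t|lborel. 1 / V0 * (V t * (fn x t)\<^sup>2))"
  proof (rule integral_mono)
    show "(norm (fn x t))\<^sup>2 \<le> 1 / V0 * (V t * (fn x t)\<^sup>2)" for t
      using V_ge[of t] V0_pos by (simp add: field_simps mult_right_mono)
  qed (intro square_integrable_norm square_integrable_fn integrable_mult_right integrable_V_square)+
  also have "\<dots> = 1 / V0 * (LINT t|lborel. V t * (fn x t)\<^sup>2)" by simp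
  also have "(LINT t|lborel. V t * (fn x t)\<^sup>2) \<le> B\<^sup>2"
    using n nn norm_eq[of x] by linarith
  then have "1 / V0 * (LINT t|lborel. V t * (fn x t)\<^sup>2) \<le> 1 / V0 * B\<^sup>2"
    using V0_pos by (intro mult_left_mono) auto
  finally show "(LINT t|lborel. (norm (fn x t))\<^sup>2) \<le> B\<^sup>2 / V0" by simp
qed

text \<open>
  A mollified value at a point is the inner product with a fixed vector, so weak convergence gives
  pointwise convergence, and these vectors are bounded uniformly in the point.
\<close>

lemma mollified_weak_null:
  assumes bound: "\<And>n. norm (D n) \<le> B" and weak: "weakly_tendsto D 0" and h: "h > 0"
  shows "(\<lambda>n. local_norm R (\<lambda>x. LINT z|lborel. mollifier h x z * fn (D n) z)) \<longlonglongrightarrow> 0"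
proof -
  let ?c = "1 / (LINT z|lborel. bump (0::'a) h z)"
  have c: "\<bar>mollifier h x z\<bar> \<le> ?c" for x z :: 'a
    using mollifier_nonneg[OF h, of x z] mollifier_bounded[OF h, of x z] by simp
  have c0: "?c > 0" using integral_bump_pos[where 'a='a, OF h] by simp
  let ?w = "\<lambda>x. l2_of (\<lambda>z. (mollifier h x z / sqrt (V z), 0 :: 'a))"
  have eq: "(LINT z|lborel. mollifier h x z * fn y z) = inner y (?w x)" for x y
    using inner_weighted(1)[OF borel_measurable_mollifier c square_integrable_0, of x y]
    by (simp add: inner_commute)
  have w_le: "norm (?w x) \<le> sqrt (?c\<^sup>2 * (LINT z|lborel. 1 / V z))" for x
  proof -
    have sq: "square_integrable (\<lambda>z. mollifier h x z / sqrt (V z))"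
      by (rule square_integrable_inverse_sqrt[OF borel_measurable_mollifier c])
    have "(norm (?w x))\<^sup>2 = inner (?w x) (?w x)" by (simp add: power2_norm_eq_inner)
    also have "\<dots> = (LINT z|lborel. inner (mollifier h x z / sqrt (V z), 0 :: 'a) (mollifier h x z / sqrt (V z), 0))"
    proof -
      note s2 = square_integrable_Pair[OF sq square_integrable_0[where 'b='a]]
      show ?thesis
        unfolding inner_l2_of[OF s2]
        by (rule integral_cong_AE) (measurable, use AE_l2_fun_l2_of[OF s2] in eventually_elim, simp)
    qed
    also have "\<dots> \<le> (LINT z|lborel. ?c\<^sup>2 * (1 / V z))"
    proof (rule integral_mono)
      show "integrable lborel (\<lambda>z. inner (mollifier h x z / sqrt (V z), 0 :: 'a) (mollifier h x z / sqrt (V z), 0))"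
        using integrable_inner_square_integrable[OF sq sq] by (simp add: inner_prod_def)
      show "integrable lborel (\<lambda>z. ?c\<^sup>2 * (1 / V z))" by (intro integrable_mult_right V_int)
      fix z
      have "(mollifier h x z)\<^sup>2 \<le> ?c\<^sup>2" using power_mono[OF c[of x z], of 2] by simp
      then have "(mollifier h x z)\<^sup>2 * (1 / V z) \<le> ?c\<^sup>2 * (1 / V z)"
        using V_pos[of z] by (intro mult_right_mono) (simp_all add: less_imp_le)
      moreover have "inner (mollifier h x z / sqrt (V z), 0 :: 'a) (mollifier h x z / sqrt (V z), 0) = (mollifier h x z)\<^sup>2 * (1 / V z)"
        using V_pos[of z] by (simp add: inner_prod_def power2_eq_square)
      ultimately show "inner (mollifier h x z / sqrt (V z), 0 :: 'a) (mollifier h x z / sqrt (V z), 0) \<le> ?c\<^sup>2 * (1 / V z)"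
        by simp
    qed
    also have "\<dots> = ?c\<^sup>2 * (LINT z|lborel. 1 / V z)"
      by (rule Bochner_Integration.integral_mult_right_zero)
    finally show ?thesis by (rule real_le_rsqrt)
  qed
  define W where "W = sqrt (?c\<^sup>2 * (LINT z|lborel. 1 / V z))"
  have B0: "B \<ge> 0" using bound[of 0] norm_ge_zero order_trans by blast
  show ?thesis
  proof (rule local_norm_dominated[where w = "\<lambda>_. B * W"])
    show "(\<lambda>x. LINT z|lborel. mollifier h x z * fn (D n) z) \<in> borel_measurable borel" for n
      unfolding mollifier_def bump_def by measurable
    show "AE x in lborel. (\<lambda>n. LINT z|lborel. mollifier h x z * fn (D n) z) \<longlonglongrightarrow> 0"
      using weak unfolding eq weakly_tendsto_def by simp
    show "\<bar>LINT z|lborel. mollifier h x z * fn (D n) z\<bar> \<le> B * W" for n x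
    proof -
      have "\<bar>inner (D n) (?w x)\<bar> \<le> norm (D n) * norm (?w x)" by (rule Cauchy_Schwarz_ineq2)
      also have "\<dots> \<le> B * W" unfolding W_def by (intro mult_mono bound w_le B0) simp
      finally show ?thesis unfolding eq .
    qed
  qed (rule locally_integrable_const)
qed

text \<open>
  Let \<open>D n = X n - x\<close>. The translation estimate and the bound on the gradients show that mollification at
  scale \<open>h\<close> changes the functions of all \<open>D n\<close> by \<open>O(h)\<close> in \<open>L\<^sup>1\<close> of a ball, while for fixed \<open>h\<close> the
  mollified functions tend to \<open>0\<close>. Convergence in \<open>L\<^sup>1\<close> on balls gives a subsequence converging almost
  everywhere.
\<close>

theorem rellich:
  assumes X: "\<And>n. X n \<in> energy_space" "\<And>n. norm (X n) \<le> B" "weakly_tendsto X x" and x: "x \<in> energy_space"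
  shows "\<exists>r. strict_mono (r :: nat \<Rightarrow> nat) \<and> (AE t in lborel. (\<lambda>k. fn (X (r k)) t) \<longlonglongrightarrow> fn x t)"
proof -
  define D where "D n = X n - x" for n
  define C where "C = B + norm x"
  have D: "D n \<in> energy_space" for n
    unfolding D_def by (intro subspace_diff energy_space_closed_subspace X x)
  have Dw: "has_weak_gradient (fn (D n)) (gr (D n))" for n
    using D by (simp add: energy_space_iff)
  have D_bound: "norm (D n) \<le> C" for n
    unfolding D_def C_def using norm_triangle_ineq4[of "X n" x] X(2)[of n] by linarith
  have D_weak: "weakly_tendsto D 0"
    unfolding weakly_tendsto_def D_def
  proof
    fix z
    have "(\<lambda>n. inner (X n) z - inner x z) \<longlonglongrightarrow> inner x z - inner x z"
      using X(3) by (intro tendsto_diff tendsto_const) (simp add: weakly_tendsto_def)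
    then show "(\<lambda>n. inner (X n - x) z) \<longlonglongrightarrow> inner 0 z" by (simp add: inner_diff_left)
  qed
  have lim: "(\<lambda>n. local_norm R (fn (D n))) \<longlonglongrightarrow> 0" for R
  proof (rule tendsto_0_if_eventually_le_ennreal)
    fix \<epsilon> :: real assume \<epsilon>: "\<epsilon> > 0"
    define K where "K = C\<^sup>2 + measure lborel (cball 0 (R + 1) :: 'a set)"
    have K: "K \<ge> 0" by (simp add: K_def)
    define h where "h = min 1 (\<epsilon> / (2 * (K + 1)))"
    have h: "h > 0" "h \<le> 1" "h * K \<le> \<epsilon> / 2"
    proof -
      show "h > 0" "h \<le> 1" using \<epsilon> K by (auto simp: h_def)
      have "h * K \<le> \<epsilon> / (2 * (K + 1)) * (K + 1)"
        using K \<epsilon> by (intro mult_mono) (auto simp: h_def)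
      also have "\<epsilon> / (2 * k) * k = \<epsilon> / 2" if "k > 0" for k :: real using that by simp
      from this[of "K + 1"] have "\<epsilon> / (2 * (K + 1)) * (K + 1) = \<epsilon> / 2" using K by simp
      finally show "h * K \<le> \<epsilon> / 2" .
    qed
    have shift: "local_norm R (\<lambda>t. fn (D n) (t + y) - fn (D n) t) \<le> ennreal (\<epsilon> / 2)" if y: "norm y \<le> h" for n y
    proof -
      have "local_norm R (\<lambda>t. fn (D n) (t + y) - fn (D n) t) \<le> local_norm (R + 1) (\<lambda>t. gr (D n) t \<bullet> y)"
        by (rule weak_gradient_translation_estimate[OF Dw]) (use y h in linarith)
      also have "\<dots> \<le> local_norm (R + 1) (\<lambda>t. h * norm (gr (D n) t))"
      proof (rule local_norm_mono)
        fix t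
        have "\<bar>gr (D n) t \<bullet> y\<bar> \<le> norm (gr (D n) t) * norm y" by (rule Cauchy_Schwarz_ineq2)
        also have "\<dots> \<le> norm (gr (D n) t) * h" using y by (rule mult_left_mono) simp
        finally show "\<bar>gr (D n) t \<bullet> y\<bar> \<le> \<bar>h * norm (gr (D n) t)\<bar>" using h(1) by (simp add: mult.commute)
      qed
      also have "\<dots> = ennreal \<bar>h\<bar> * local_norm (R + 1) (\<lambda>t. norm (gr (D n) t))"
        by (rule local_norm_cmult) measurable
      also have "\<dots> \<le> ennreal \<bar>h\<bar> * ennreal K"
        unfolding K_def
        by (intro mult_left_mono cball_integral_le square_integrable_components fn_gr_square_le D_bound) simp
      also have "\<dots> \<le> ennreal (\<epsilon> / 2)"
        using h K by (simp add: ennreal_leI flip: ennreal_mult)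
      finally show ?thesis .
    qed
    let ?m = "\<lambda>n x. LINT z|lborel. mollifier h x z * fn (D n) z"
    have [measurable]: "?m n \<in> borel_measurable borel" for n
      unfolding mollifier_def bump_def by measurable
    have le: "local_norm R (fn (D n)) \<le> local_norm R (?m n) + ennreal (\<epsilon> / 2)" for n
    proof -
      have "local_norm R (fn (D n)) = local_norm R (\<lambda>t. ?m n t + (fn (D n) t - ?m n t))" by simp
      also have "\<dots> \<le> local_norm R (?m n) + local_norm R (\<lambda>t. fn (D n) t - ?m n t)"
        by (rule local_norm_triangle) measurable
      also have "local_norm R (\<lambda>t. fn (D n) t - ?m n t) = local_norm R (\<lambda>t. ?m n t - fn (D n) t)"
        by (simp add: local_norm_def abs_minus_commute)
      also have "\<dots> \<le> ennreal (\<epsilon> / 2)"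
        by (rule mollification_close[OF weak_gradientD(1)[OF Dw] h(1) shift])
      finally show ?thesis by (simp add: add_left_mono)
    qed
    have "(\<lambda>n. local_norm R (?m n)) \<longlonglongrightarrow> 0"
      by (rule mollified_weak_null[OF D_bound D_weak h(1)])
    then have "\<forall>\<^sub>F n in sequentially. local_norm R (?m n) < ennreal (\<epsilon> / 2)"
      using \<epsilon> by (intro order_tendstoD(2)) auto
    then show "\<forall>\<^sub>F n in sequentially. local_norm R (fn (D n)) \<le> ennreal \<epsilon>"
    proof eventually_elim
      fix n assume "local_norm R (?m n) < ennreal (\<epsilon> / 2)"
      then have "local_norm R (fn (D n)) \<le> ennreal (\<epsilon> / 2) + ennreal (\<epsilon> / 2)"
        by (intro order_trans[OF le add_right_mono]) simp
      also have "\<dots> = ennreal \<epsilon>" using \<epsilon> by (simp flip: ennreal_plus)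
      finally show "local_norm R (fn (D n)) \<le> ennreal \<epsilon>" .
    qed
  qed
  obtain r where r: "strict_mono r" "AE t in lborel. (\<lambda>k. fn (D (r k)) t) \<longlonglongrightarrow> 0"
    using local_norm_subsequence_AE[OF measurable_components(2) lim] by blast
  have "AE t in lborel. \<forall>n. fn (D n) t = fn (X n) t - fn x t"
    unfolding AE_all_countable D_def using fn_ops(2) by blast
  then have "AE t in lborel. (\<lambda>k. fn (X (r k)) t) \<longlonglongrightarrow> fn x t"
    using r(2) by eventually_elim (simp add: LIM_zero_iff)
  then show ?thesis using r(1) by blast
qed

end

section \<open>The truncated problem\<close>

text \<open>
  A bounded odd nonlinearity \<open>f\<close> with a primitive \<open>F\<close>; convexity of \<open>F\<close> is expressed by its tangents.
\<close>

locale truncated_problem = confining_potential V V0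
  for V :: "'a::euclidean_space \<Rightarrow> real" and V0 :: real +
  fixes f F :: "real \<Rightarrow> real" and c :: real
  assumes f_cont: "continuous_on UNIV f" and f_bound: "\<bar>f t\<bar> \<le> c" and f_odd: "f (- t) = - f t"
    and F_measurable [measurable]: "F \<in> borel_measurable borel"
    and F_subgradient: "F s + f s * (t - s) \<le> F t" and F_0: "F 0 = 0"
begin

lemma f_measurable [measurable]: "f \<in> borel_measurable borel"
  by (rule borel_measurable_continuous_onI[OF f_cont])

lemma f_0: "f 0 = 0"
  using f_odd[of 0] by simp

lemma F_nonneg: "0 \<le> F t"
  using F_subgradient[of 0 t] by (simp add: F_0 f_0)

lemma F_le: "F t \<le> c * \<bar>t\<bar>"
proof -
  have "F t \<le> f t * t"
    using F_subgradient[of t 0] by (simp add: F_0)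
  also have "\<dots> \<le> \<bar>f t\<bar> * \<bar>t\<bar>"
    by (simp flip: abs_mult)
  also have "\<dots> \<le> c * \<bar>t\<bar>"
    by (intro mult_right_mono f_bound) simp
  finally show ?thesis .
qed

text \<open>
  The inner product of this element with \<open>y\<close> is \<open>\<integral> f u v\<close>, where \<open>u\<close> and \<open>v\<close> are the functions of \<open>x\<close> and
  \<open>y\<close>. It lies in \<open>L\<^sup>2\<close> because \<open>f\<close> is bounded and \<open>1 / V\<close> is integrable; its projection onto the
  energy space is the weak solution of the linear equation with right hand side \<open>f u\<close>.
\<close>

definition nonlinearity :: "('a, real \<times> 'a) l2 \<Rightarrow> ('a, real \<times> 'a) l2" where
  "nonlinearity x = l2_of (\<lambda>t. (f (fn x t) / sqrt (V t), 0))"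

definition T :: "('a, real \<times> 'a) l2 \<Rightarrow> ('a, real \<times> 'a) l2" where
  "T x = proj energy_space (nonlinearity x)"

definition \<Phi> :: "('a, real \<times> 'a) l2 \<Rightarrow> real" where
  "\<Phi> x = (LINT t|lborel. F (fn x t))"

lemma integrable_F: "integrable lborel (\<lambda>t. F (fn x t))"
proof (rule Bochner_Integration.integrable_bound)
  show "integrable lborel (\<lambda>t. c * \<bar>fn x t\<bar>)"
    by (intro integrable_mult_right integrable_abs integrable_fn)
  show "AE t in lborel. norm (F (fn x t)) \<le> norm (c * \<bar>fn x t\<bar>)"
    using F_nonneg F_le order_trans[OF F_le abs_ge_self] by (intro AE_I2) simp
qed simp

lemma inner_nonlinearity:
  "inner (nonlinearity x) y = (LINT t|lborel. f (fn x t) * fn y t)"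
  "integrable lborel (\<lambda>t. f (fn x t) * fn y t)"
  using inner_weighted[of "\<lambda>t. f (fn x t)" c "\<lambda>_. 0" y] f_bound
  by (simp_all add: nonlinearity_def square_integrable_0)

lemma inner_T: "y \<in> energy_space \<Longrightarrow> inner (T x) y = (LINT t|lborel. f (fn x t) * fn y t)"
  unfolding T_def by (simp add: inner_proj[OF energy_space_closed_subspace] inner_nonlinearity)

lemma square_integrable_nonlinearity: "square_integrable (\<lambda>t. (f (fn x t) / sqrt (V t), 0 :: 'a))"
  by (intro square_integrable_Pair square_integrable_inverse_sqrt[OF _ f_bound] square_integrable_0) measurable

lemma norm_nonlinearity_diff:
  "(norm (nonlinearity x - nonlinearity y))\<^sup>2 = (LINT t|lborel. (f (fn x t) - f (fn y t))\<^sup>2 / V t)"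
  unfolding norm_l2_diff_square
proof (rule integral_cong_AE)
  show "AE t in lborel. (norm (l2_fun (nonlinearity x) t - l2_fun (nonlinearity y) t))\<^sup>2 = (f (fn x t) - f (fn y t))\<^sup>2 / V t"
    using AE_l2_fun_l2_of[OF square_integrable_nonlinearity[of x]] AE_l2_fun_l2_of[OF square_integrable_nonlinearity[of y]]
  proof eventually_elim
    fix t
    assume "l2_fun (l2_of (\<lambda>t. (f (fn x t) / sqrt (V t), 0 :: 'a))) t = (f (fn x t) / sqrt (V t), 0)"
      "l2_fun (l2_of (\<lambda>t. (f (fn y t) / sqrt (V t), 0 :: 'a))) t = (f (fn y t) / sqrt (V t), 0)"
    then show "(norm (l2_fun (nonlinearity x) t - l2_fun (nonlinearity y) t))\<^sup>2 = (f (fn x t) - f (fn y t))\<^sup>2 / V t"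
      using V_pos[of t] by (simp add: nonlinearity_def norm_Pair power_divide less_imp_le flip: diff_divide_distrib)
  qed
qed measurable

lemma nonlinearity_uminus: "nonlinearity (- x) = - nonlinearity x"
proof -
  have "AE t in lborel. l2_fun (- nonlinearity x) t = (f (fn (- x) t) / sqrt (V t), 0)"
    using AE_l2_fun_l2_of[OF square_integrable_nonlinearity[of x]] AE_l2_ops(3)[of "nonlinearity x"] fn_ops(4)[of x]
    by eventually_elim (simp add: nonlinearity_def f_odd)
  then show ?thesis
    unfolding nonlinearity_def[of "- x"] by (rule l2_of_eqI[OF square_integrable_nonlinearity, symmetric])
qed

lemma nonlinearity_0: "nonlinearity 0 = 0"
  using nonlinearity_uminus[of 0] by (simp add: eq_neg_iff_add_eq_0 flip: scaleR_2)

definition C :: real where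
  "C = sqrt (c\<^sup>2 * (LINT t|lborel. 1 / V t))"

lemma norm_T_le: "norm (T x) \<le> C"
proof -
  have "(norm (nonlinearity x))\<^sup>2 = (LINT t|lborel. (f (fn x t) - f (fn 0 t))\<^sup>2 / V t)"
    using norm_nonlinearity_diff[of x 0] by (simp add: nonlinearity_0)
  also have "\<dots> = (LINT t|lborel. (f (fn x t))\<^sup>2 / V t)"
    by (rule integral_cong_AE) (measurable, use fn_ops(5) in eventually_elim, simp add: f_0)
  also have "\<dots> \<le> (LINT t|lborel. c\<^sup>2 * (1 / V t))"
  proof (rule integral_mono')
    show "integrable lborel (\<lambda>t. c\<^sup>2 * (1 / V t))" by (intro integrable_mult_right V_int)
    fix t
    have "(f (fn x t))\<^sup>2 \<le> c\<^sup>2" using power_mono[OF f_bound, of "fn x t" 2] by simp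
    then show "(f (fn x t))\<^sup>2 / V t \<le> c\<^sup>2 * (1 / V t)"
      using V_pos[of t] by (simp add: divide_right_mono less_imp_le)
    show "0 \<le> c\<^sup>2 * (1 / V t)" using V_pos[of t] by (simp add: less_imp_le)
  qed
  also have "\<dots> = c\<^sup>2 * (LINT t|lborel. 1 / V t)"
    by (rule Bochner_Integration.integral_mult_right_zero)
  finally have "norm (nonlinearity x) \<le> C"
    unfolding C_def by (rule real_le_rsqrt)
  then show ?thesis
    unfolding T_def by (rule order_trans[OF norm_proj_le[OF energy_space_closed_subspace]])
qed

text \<open>
  After passing to a subsequence that converges almost everywhere, the distance of the
  nonlinearities is an integral against \<open>1 / V\<close> of a bounded integrand tending to \<open>0\<close>.
\<close>

lemma T_weak_to_strong:
  assumes X: "\<And>n. X n \<in> energy_space" "\<And>n. norm (X n) \<le> B" "weakly_tendsto X x"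
  shows "\<exists>r. strict_mono (r :: nat \<Rightarrow> nat) \<and> (\<lambda>n. T (X (r n))) \<longlonglongrightarrow> T x"
proof -
  have x: "x \<in> energy_space"
    by (rule weak_limit_in_closed_subspace[OF energy_space_closed_subspace X(1,3)])
  obtain r where r: "strict_mono r" "AE t in lborel. (\<lambda>k. fn (X (r k)) t) \<longlonglongrightarrow> fn x t"
    using rellich[OF X x] by blast
  have "(\<lambda>k. LINT t|lborel. (f (fn (X (r k)) t) - f (fn x t))\<^sup>2 / V t) \<longlonglongrightarrow> (LINT t|(lborel :: 'a measure). 0 :: real)"
  proof (rule integral_dominated_convergence[where w = "\<lambda>t. (2 * c)\<^sup>2 * (1 / V t)"])
    show "integrable lborel (\<lambda>t. (2 * c)\<^sup>2 * (1 / V t))" by (intro integrable_mult_right V_int)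
    show "AE t in lborel. (\<lambda>k. (f (fn (X (r k)) t) - f (fn x t))\<^sup>2 / V t) \<longlonglongrightarrow> 0"
      using r(2)
    proof eventually_elim
      fix t assume "(\<lambda>k. fn (X (r k)) t) \<longlonglongrightarrow> fn x t"
      then have "(\<lambda>k. f (fn (X (r k)) t)) \<longlonglongrightarrow> f (fn x t)"
        using f_cont by (intro isCont_tendsto_compose[of _ f]) (simp_all add: continuous_on_eq_continuous_at)
      then have "(\<lambda>k. (f (fn (X (r k)) t) - f (fn x t))\<^sup>2 / V t) \<longlonglongrightarrow> (f (fn x t) - f (fn x t))\<^sup>2 / V t"
        by (intro tendsto_intros) simp_all
      then show "(\<lambda>k. (f (fn (X (r k)) t) - f (fn x t))\<^sup>2 / V t) \<longlonglongrightarrow> 0" by simp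
    qed
    show "AE t in lborel. norm ((f (fn (X (r k)) t) - f (fn x t))\<^sup>2 / V t) \<le> (2 * c)\<^sup>2 * (1 / V t)" for k
    proof (rule AE_I2)
      fix t
      have "\<bar>f (fn (X (r k)) t) - f (fn x t)\<bar> \<le> 2 * c"
        using f_bound[of "fn (X (r k)) t"] f_bound[of "fn x t"] by linarith
      then have "(f (fn (X (r k)) t) - f (fn x t))\<^sup>2 \<le> (2 * c)\<^sup>2"
        using power_mono[of "\<bar>f (fn (X (r k)) t) - f (fn x t)\<bar>" "2 * c" 2] by simp
      then have "(f (fn (X (r k)) t) - f (fn x t))\<^sup>2 * (1 / V t) \<le> (2 * c)\<^sup>2 * (1 / V t)"
        using V_pos[of t] by (intro mult_right_mono) (simp_all add: less_imp_le)
      then show "norm ((f (fn (X (r k)) t) - f (fn x t))\<^sup>2 / V t) \<le> (2 * c)\<^sup>2 * (1 / V t)"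
        using V_pos[of t] by (simp add: abs_of_pos)
    qed
  qed measurable
  then have "(\<lambda>k. (norm (nonlinearity (X (r k)) - nonlinearity x))\<^sup>2) \<longlonglongrightarrow> 0"
    by (simp add: norm_nonlinearity_diff)
  then have "(\<lambda>k. sqrt ((norm (nonlinearity (X (r k)) - nonlinearity x))\<^sup>2)) \<longlonglongrightarrow> sqrt 0"
    by (rule tendsto_real_sqrt)
  then have lim: "(\<lambda>k. norm (nonlinearity (X (r k)) - nonlinearity x)) \<longlonglongrightarrow> 0" by simp
  have "norm (T (X (r k)) - T x) \<le> norm (nonlinearity (X (r k)) - nonlinearity x)" for k
    unfolding T_def proj_diff[OF energy_space_closed_subspace, symmetric]
    by (rule norm_proj_le[OF energy_space_closed_subspace])
  then have "(\<lambda>k. T (X (r k)) - T x) \<longlonglongrightarrow> 0"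
    by (intro Lim_null_comparison[OF always_eventually lim]) blast
  then have "(\<lambda>k. T (X (r k))) \<longlonglongrightarrow> T x" by (simp only: LIM_zero_iff)
  then show ?thesis using r(1) by blast
qed

lemma \<Phi>_subgradient:
  assumes x: "x \<in> energy_space" and y: "y \<in> energy_space"
  shows "\<Phi> x + inner (T x) (y - x) \<le> \<Phi> y"
proof -
  have "inner (T x) (y - x) = (LINT t|lborel. f (fn x t) * fn y t) - (LINT t|lborel. f (fn x t) * fn x t)"
    by (simp add: inner_diff_right inner_T x y)
  then have "\<Phi> x + inner (T x) (y - x) = (LINT t|lborel. F (fn x t) + (f (fn x t) * fn y t - f (fn x t) * fn x t))"
    using integrable_F inner_nonlinearity(2) by (simp add: \<Phi>_def)
  also have "\<dots> \<le> \<Phi> y"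
    unfolding \<Phi>_def
  proof (rule integral_mono)
    show "F (fn x t) + (f (fn x t) * fn y t - f (fn x t) * fn x t) \<le> F (fn y t)" for t
      using F_subgradient[of "fn x t" "fn y t"] by (simp add: right_diff_distrib)
  qed (use integrable_F inner_nonlinearity(2) in auto)
  finally show ?thesis .
qed

lemma \<Phi>_zero: "\<Phi> 0 = 0"
proof -
  have "\<Phi> 0 = (LINT t|(lborel :: 'a measure). 0)"
    unfolding \<Phi>_def by (rule integral_cong_AE) (measurable, use fn_ops(5) in eventually_elim, simp add: F_0)
  then show ?thesis by simp
qed

sublocale even_functional energy_space T \<Phi> C
proof
  show "subspace energy_space" "closed energy_space" by (rule energy_space_closed_subspace)+
  show "T x \<in> energy_space" for x
    unfolding T_def by (rule proj_mem[OF energy_space_closed_subspace])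
  show "T (- x) = - T x" for x
    unfolding T_def nonlinearity_uminus by (rule proj_uminus[OF energy_space_closed_subspace])
qed (rule norm_T_le T_weak_to_strong \<Phi>_subgradient \<Phi>_zero; assumption)+

subsection \<open>The maximum principle\<close>

text \<open>
  Test the equation with \<open>G u\<close>, where the smooth nondecreasing function \<open>G\<close> vanishes up to \<open>\<delta>\<close> and is
  positive beyond. The gradient term \<open>\<integral> G' u * (norm g)\<^sup>2\<close> is nonnegative, so that
  \<open>\<integral> (V u - f u) G u \<le> 0\<close>; but this integrand is positive wherever \<open>u > \<delta>\<close>.
\<close>

lemma fixed_point_le:
  assumes x: "x \<in> energy_space" "T x = x" and \<delta>: "\<delta> > 0" "\<And>t. t > \<delta> \<Longrightarrow> f t < V0 * t"
  shows "AE t in lborel. fn x t \<le> \<delta>"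
proof -
  define G where "G s = flat_exp 0 (s - \<delta>)" for s
  define G' where "G' s = flat_exp 2 (s - \<delta>)" for s
  have G_deriv: "(G has_real_derivative G' s) (at s)" for s
  proof -
    have "(flat_exp 0 has_real_derivative flat_exp 2 (s - \<delta>)) (at (s - \<delta>))"
      using flat_exp_has_derivative[of 0 "s - \<delta>"] by (simp add: numeral_2_eq_2)
    moreover have "((\<lambda>s. s - \<delta>) has_real_derivative 1) (at s)"
      by (auto intro!: derivative_eq_intros)
    ultimately have "((\<lambda>s. flat_exp 0 (s - \<delta>)) has_real_derivative flat_exp 2 (s - \<delta>) * 1) (at s)"
      by (rule DERIV_chain2)
    then show ?thesis by (simp add: G_def[abs_def] G'_def)
  qed
  have G'_nonneg: "0 \<le> G' s" for s by (simp add: G'_def flat_exp_nonneg)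
  have G'_le: "\<bar>G' s\<bar> \<le> 2" for s
    using flat_exp_bounded[of 2 "s - \<delta>"] flat_exp_nonneg[of 2 "s - \<delta>"] by (simp add: G'_def)
  have G_meas[measurable]: "G \<in> borel_measurable borel" "G' \<in> borel_measurable borel"
    unfolding G_def[abs_def] G'_def[abs_def] by measurable
  have G_le: "\<bar>G s\<bar> \<le> 2 * \<bar>s\<bar>" for s
  proof -
    have "norm (G s - G 0) \<le> 2 * norm (s - 0)"
      by (rule field_differentiable_bound[of UNIV G G']) (use G_deriv G'_le in auto)
    moreover have "G 0 = 0" using \<delta>(1) by (simp add: G_def flat_exp_def)
    ultimately show ?thesis by simp
  qed
  have w: "has_weak_gradient (\<lambda>t. G (fn x t)) (\<lambda>t. G' (fn x t) *\<^sub>R gr x t)"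
    by (rule weak_gradient_chain_rule[OF _ G_deriv G'_le]) (use x(1) in \<open>auto simp: energy_space_iff\<close>)
  have sq: "(G s)\<^sup>2 \<le> 4 * s\<^sup>2" "(G' s)\<^sup>2 \<le> 4" for s
    using power_mono[OF G_le[of s], of 2] power_mono[OF G'_le[of s], of 2] by (simp_all add: power_mult_distrib)
  have u: "integrable lborel (\<lambda>t. V t * (G (fn x t))\<^sup>2)"
  proof (rule Bochner_Integration.integrable_bound)
    show "integrable lborel (\<lambda>t. 4 * (V t * (fn x t)\<^sup>2))" by (intro integrable_mult_right integrable_V_square)
    show "AE t in lborel. norm (V t * (G (fn x t))\<^sup>2) \<le> norm (4 * (V t * (fn x t)\<^sup>2))"
    proof (rule AE_I2)
      fix t
      have "V t * (G (fn x t))\<^sup>2 \<le> V t * (4 * (fn x t)\<^sup>2)"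
        using V_pos[of t] by (intro mult_left_mono sq) simp
      then show "norm (V t * (G (fn x t))\<^sup>2) \<le> norm (4 * (V t * (fn x t)\<^sup>2))"
        using V_pos[of t] by (simp add: abs_mult)
    qed
  qed measurable
  have g: "square_integrable (\<lambda>t. G' (fn x t) *\<^sub>R gr x t)"
  proof (rule square_integrable_bound)
    show "integrable lborel (\<lambda>t. 4 * (norm (gr x t))\<^sup>2)"
      by (intro integrable_mult_right square_integrable_norm square_integrable_components)
    show "AE t in lborel. (norm (G' (fn x t) *\<^sub>R gr x t))\<^sup>2 \<le> 4 * (norm (gr x t))\<^sup>2"
      by (rule AE_I2) (simp add: power_mult_distrib mult_right_mono sq)
  qed measurable
  let ?y = "pack (\<lambda>t. G (fn x t)) (\<lambda>t. G' (fn x t) *\<^sub>R gr x t)"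
  have y: "?y \<in> energy_space" by (rule pack_in_energy_space[OF w u g])
  have p: "AE t in lborel. fn ?y t = G (fn x t)" "AE t in lborel. gr ?y t = G' (fn x t) *\<^sub>R gr x t"
    by (rule pack[OF _ u g]; measurable)+
  have "inner (T x) ?y = inner x ?y" using x(2) by simp
  then have "(LINT t|lborel. f (fn x t) * fn ?y t)
      = (LINT t|lborel. V t * fn x t * fn ?y t) + (LINT t|lborel. gr x t \<bullet> gr ?y t)"
    unfolding inner_T[OF y] inner_eq(1)[of x ?y] .
  moreover have "0 \<le> (LINT t|lborel. gr x t \<bullet> gr ?y t)"
    by (rule integral_nonneg_AE) (use p(2) in eventually_elim, simp add: G'_nonneg)
  ultimately have le: "(LINT t|lborel. V t * fn x t * fn ?y t - f (fn x t) * fn ?y t) \<le> 0"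
    using inner_eq(2)[of x ?y] inner_nonlinearity(2)[of x ?y] by simp
  have strict: "(V t * s - f s) * G s > 0" if "s > \<delta>" for s t
  proof -
    have "f s < V t * s" using \<delta>(2)[OF that] V_ge[of t] mult_right_mono[OF V_ge, of s t] that \<delta>(1) by linarith
    moreover have "G s > 0" using that by (simp add: G_def flat_exp_def)
    ultimately show ?thesis by simp
  qed
  have zero: "G s = 0" if "s \<le> \<delta>" for s
    using that by (simp add: G_def flat_exp_def)
  have nn: "AE t in lborel. 0 \<le> V t * fn x t * fn ?y t - f (fn x t) * fn ?y t"
    using p(1)
  proof eventually_elim
    fix t assume "fn ?y t = G (fn x t)"
    then have "V t * fn x t * fn ?y t - f (fn x t) * fn ?y t = (V t * fn x t - f (fn x t)) * G (fn x t)"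
      by (simp add: left_diff_distrib)
    also have "\<dots> \<ge> 0"
      using strict[of "fn x t" t] zero[of "fn x t"] by (cases "fn x t > \<delta>") auto
    finally show "0 \<le> V t * fn x t * fn ?y t - f (fn x t) * fn ?y t" .
  qed
  have int: "integrable lborel (\<lambda>t. V t * fn x t * fn ?y t - f (fn x t) * fn ?y t)"
    using inner_eq(2)[of x ?y] inner_nonlinearity(2)[of x ?y] by simp
  have "(LINT t|lborel. V t * fn x t * fn ?y t - f (fn x t) * fn ?y t) = 0"
    using le integral_nonneg_AE[OF nn] by linarith
  then have "AE t in lborel. V t * fn x t * fn ?y t - f (fn x t) * fn ?y t = 0"
    using integral_nonneg_eq_0_iff_AE[OF int nn] by simp
  then show ?thesis
    using p(1)
  proof eventually_elim
    fix t assume "V t * fn x t * fn ?y t - f (fn x t) * fn ?y t = 0" "fn ?y t = G (fn x t)"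
    then have "(V t * fn x t - f (fn x t)) * G (fn x t) = 0"
      by (simp add: left_diff_distrib)
    then show "fn x t \<le> \<delta>"
      using strict[of "fn x t" t] by force
  qed
qed

theorem fixed_point_bounded:
  assumes x: "x \<in> energy_space" "T x = x" and \<delta>: "\<delta> > 0" "\<And>t. t > \<delta> \<Longrightarrow> f t < V0 * t"
  shows "AE t in lborel. \<bar>fn x t\<bar> \<le> \<delta>"
proof -
  have "- x \<in> energy_space" using x(1) S(1) by (simp add: subspace_neg)
  moreover have "T (- x) = - x" using T_odd[OF x(1)] x(2) by simp
  ultimately have "AE t in lborel. fn (- x) t \<le> \<delta>" by (rule fixed_point_le) (use \<delta> in auto)
  moreover have "AE t in lborel. fn x t \<le> \<delta>"
    by (rule fixed_point_le) (use x \<delta> in auto)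
  ultimately show ?thesis
    using fn_ops(4)[of x] by eventually_elim auto
qed

end

section \<open>Negative energy on cross-polytopes of bumps\<close>

lemma locally_integrable_continuous:
  fixes f :: "'a::euclidean_space \<Rightarrow> real"
  assumes "continuous_on UNIV f"
  shows "locally_integrable f"
  unfolding locally_integrable_def set_integrable_def
  using borel_measurable_continuous_onI[OF assms] borel_integrable_compact[OF _ continuous_on_subset[OF assms subset_UNIV]]
  by simp

lemma square_integrable_classical_gradient:
  fixes \<phi> :: "'a::euclidean_space \<Rightarrow> real"
  assumes \<phi>: "test_fun \<phi>"
  shows "square_integrable (classical_gradient \<phi>)"
proof -
  obtain B where B: "\<And>x. norm (classical_gradient \<phi> x) \<le> B" using classical_gradient_bounded[OF \<phi>] by blast
  obtain R where R: "\<And>x y. x \<notin> cball 0 R \<Longrightarrow> frechet_derivative \<phi> (at x) y = 0"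
    using test_fun_supported[OF \<phi>] by blast
  show ?thesis
  proof (rule square_integrable_bound)
    show "integrable lborel (\<lambda>x. B\<^sup>2 * indicator (cball (0::'a) R) x :: real)"
      using emeasure_lborel_cball_finite[of "0::'a" R]
      by (intro integrable_mult_right integrable_real_indicator) simp_all
    show "AE x in lborel. (norm (classical_gradient \<phi> x))\<^sup>2 \<le> B\<^sup>2 * indicator (cball 0 R) x"
    proof (rule AE_I2)
      fix x
      show "(norm (classical_gradient \<phi> x))\<^sup>2 \<le> B\<^sup>2 * indicator (cball 0 R) x"
        using power_mono[OF B[of x], of 2] R[of x] by (cases "x \<in> cball 0 R") (auto simp: classical_gradient_def)
    qed
  qed (use borel_measurable_classical_gradient[OF \<phi>] in simp)
qed

context confining_potential
begin

definition bump_element :: "'a \<Rightarrow> ('a, real \<times> 'a) l2" where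
  "bump_element z = pack (bump z 1) (classical_gradient (bump z 1))"

lemma bump_element:
  "bump_element z \<in> energy_space" "AE t in lborel. fn (bump_element z) t = bump z 1 t"
proof -
  note \<phi> = test_fun_bump[OF zero_less_one, of z]
  have "locally_integrable (\<lambda>t. V t * bump z 1 t)"
    by (intro locally_integrable_continuous continuous_on_mult V_cont continuous_on_test_fun \<phi>)
  then have "integrable lborel (\<lambda>t. V t * bump z 1 t * bump z 1 t)"
    by (rule integrable_test_fun_mult(1)[OF _ \<phi>])
  then have int: "integrable lborel (\<lambda>t. V t * (bump z 1 t)\<^sup>2)"
    by (simp add: power2_eq_square mult.assoc)
  show "bump_element z \<in> energy_space"
    unfolding bump_element_def
    by (intro pack_in_energy_space test_fun_has_weak_gradient square_integrable_classical_gradient \<phi> int)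
  show "AE t in lborel. fn (bump_element z) t = bump z 1 t"
    unfolding bump_element_def
    by (intro pack(1) square_integrable_classical_gradient \<phi> int) measurable
qed

lemma fn_sum: "finite I \<Longrightarrow> AE t in lborel. fn (\<Sum>i\<in>I. E i) t = (\<Sum>i\<in>I. fn (E i) t)"
proof (induction rule: finite_induct)
  case empty
  then show ?case using fn_ops(5) by simp
next
  case (insert i I)
  show ?case
    using insert(3) fn_ops(1)[of "E i" "\<Sum>i\<in>I. E i"]
    by eventually_elim (use insert(1,2) in simp)
qed

lemma fn_bump_combination:
  fixes z :: "nat \<Rightarrow> 'a"
  shows "AE t in lborel. fn (\<Sum>i\<le>k. a i *\<^sub>R (r *\<^sub>R bump_element (z i))) t = (\<Sum>i\<le>k. a i * (r * bump (z i) 1 t))"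
proof -
  have "AE t in lborel. \<forall>i. fn (a i *\<^sub>R (r *\<^sub>R bump_element (z i))) t = a i * (r * bump (z i) 1 t)"
    unfolding AE_all_countable
  proof
    fix i
    show "AE t in lborel. fn (a i *\<^sub>R (r *\<^sub>R bump_element (z i))) t = a i * (r * bump (z i) 1 t)"
      using fn_ops(3)[of "a i" "r *\<^sub>R bump_element (z i)"] fn_ops(3)[of r "bump_element (z i)"] bump_element(2)[of "z i"]
      by eventually_elim simp
  qed
  then show ?thesis
    using fn_sum[OF finite_atMost, of "\<lambda>i. a i *\<^sub>R (r *\<^sub>R bump_element (z i))"] by eventually_elim simp
qed

end

context truncated_problem
begin

lemma \<Phi>_lower_bound:
  assumes F: "\<And>t. \<bar>t\<bar> \<le> \<delta> \<Longrightarrow> \<mu> * \<bar>t\<bar> powr q \<le> F t" and q: "q > 0" and \<mu>: "\<mu> > 0"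
    and A: "A \<in> sets borel" "emeasure lborel A < \<infinity>"
    and u: "AE t in lborel. \<bar>fn x t\<bar> \<le> \<delta>" "AE t in lborel. t \<in> A \<longrightarrow> m \<le> \<bar>fn x t\<bar>" and m: "m \<ge> 0"
  shows "\<mu> * m powr q * measure lborel A \<le> \<Phi> x"
proof -
  have "\<mu> * m powr q * measure lborel A = (LINT t|lborel. \<mu> * m powr q * indicator A t)"
    using A by simp
  also have "\<dots> \<le> \<Phi> x"
    unfolding \<Phi>_def
  proof (rule integral_mono_AE)
    show "integrable lborel (\<lambda>t. \<mu> * m powr q * indicator A t)"
      using A by (intro integrable_mult_right integrable_real_indicator) auto
    show "AE t in lborel. \<mu> * m powr q * indicator A t \<le> F (fn x t)"
      using u
    proof eventually_elim
      fix t assume *: "\<bar>fn x t\<bar> \<le> \<delta>" "t \<in> A \<longrightarrow> m \<le> \<bar>fn x t\<bar>"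
      show "\<mu> * m powr q * indicator A t \<le> F (fn x t)"
      proof (cases "t \<in> A")
        case True
        then have "\<mu> * m powr q \<le> \<mu> * \<bar>fn x t\<bar> powr q"
          using * \<mu> q m by (intro mult_left_mono powr_mono2) auto
        then show ?thesis using F[OF *(1)] True by simp
      qed (simp add: F_nonneg)
    qed
  qed (rule integrable_F)
  finally show ?thesis .
qed

text \<open>
  The bumps are centred at distance at least \<open>2\<close> from each other, so their supports are disjoint.
  A combination with coefficients of total size \<open>1\<close> has one coefficient of size at least
  \<open>1 / (k + 1)\<close>, and near the centre of the corresponding bump the combination, scaled by \<open>r\<close>, is
  at least a multiple of \<open>r\<close>. Hence \<open>\<Phi>\<close> is at least a multiple of \<open>r powr q\<close>, which for small \<open>r\<close>
  exceeds the quadratic term of order \<open>r\<^sup>2\<close>.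
\<close>

theorem negative_cross_polytopes:
  assumes F: "\<And>t. \<bar>t\<bar> \<le> \<delta> \<Longrightarrow> \<mu> * \<bar>t\<bar> powr q \<le> F t" and q: "0 < q" "q < 2" and \<mu>: "\<mu> > 0" and \<delta>: "\<delta> > 0"
  shows "\<exists>e. (\<forall>i\<le>k. e i \<in> energy_space) \<and> (\<forall>x\<in>cross_polytope e k. J x < 0)"
proof -
  define b where "b = (SOME i. i \<in> (Basis :: 'a set))"
  have b: "norm b = 1" unfolding b_def by (rule norm_Basis) (rule SOME_Basis)
  define z where "z i = (2 * real i) *\<^sub>R b" for i
  have far: "dist (z i) (z j) \<ge> 2" if "i \<noteq> j" for i j
  proof -
    have "dist (z i) (z j) = \<bar>2 * real i - 2 * real j\<bar>"
      using b by (simp add: z_def dist_norm flip: scaleR_diff_left)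
    then show ?thesis using that by linarith
  qed
  define \<beta> where "\<beta> = flat_exp 0 (1 - (1/2)\<^sup>2)"
  have \<beta>: "\<beta> > 0" by (simp add: \<beta>_def flat_exp_def power2_eq_square)
  have bump_ge: "\<beta> \<le> bump w 1 t" if "t \<in> ball w (1/2)" for w t :: 'a
  proof -
    have "(norm (t - w))\<^sup>2 \<le> (1/2)\<^sup>2"
      using that by (intro power_mono) (auto simp: dist_norm norm_minus_commute)
    then have s: "1 - (1/2)\<^sup>2 \<le> 1\<^sup>2 - inner (t - w) (t - w)"
      by (simp add: power2_norm_eq_inner)
    have "flat_exp 0 r \<le> flat_exp 0 s" if "r \<le> s" "r > 0" for r s
      using that by (simp add: flat_exp_def divide_left_mono)
    from this[OF s] show ?thesis by (simp add: \<beta>_def bump_def power2_eq_square)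
  qed
  define v where "v = measure lborel (ball (0::'a) (1/2))"
  have v: "v > 0" unfolding v_def by (rule content_ball_pos) simp
  have vol: "measure lborel (ball w (1/2)) = v" for w :: 'a
    unfolding v_def by (simp add: content_ball)
  define N where "N = (\<Sum>i\<le>k. norm (bump_element (z i))) + 1"
  have N: "N > 0" by (simp add: N_def add_nonneg_pos sum_nonneg)
  \<comment> \<open>The threshold for \<open>r powr (2 - q)\<close> below which \<open>(r * N)\<^sup>2 / 2\<close> is less than the lower bound for \<open>\<Phi>\<close>.\<close>
  define \<kappa> where "\<kappa> = 2 * (\<mu> * (\<beta> / real (Suc k)) powr q * v) / N\<^sup>2"
  have \<kappa>: "\<kappa> > 0" using \<mu> \<beta> v N by (simp add: \<kappa>_def)
  define r where "r = min \<delta> ((\<kappa> / 2) powr (1 / (2 - q)))"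
  have r: "r > 0" "r \<le> \<delta>" using \<delta> \<kappa> by (auto simp: r_def)
  have "r powr (2 - q) \<le> ((\<kappa> / 2) powr (1 / (2 - q))) powr (2 - q)"
    using r q by (intro powr_mono2) (auto simp: r_def)
  also have "\<dots> = \<kappa> / 2" using q \<kappa> by (simp add: powr_powr)
  finally have r\<kappa>: "r powr (2 - q) < \<kappa>" using \<kappa> by linarith
  define e where "e i = r *\<^sub>R bump_element (z i)" for i
  have "J x < 0" if "x \<in> cross_polytope e k" for x
  proof -
    obtain a where a: "(\<Sum>i\<le>k. \<bar>a i\<bar>) = 1" and x: "x = (\<Sum>i\<le>k. a i *\<^sub>R e i)"
      using \<open>x \<in> cross_polytope e k\<close> by (auto simp: cross_polytope_def)
    have fn_x: "AE t in lborel. fn x t = (\<Sum>i\<le>k. a i * (r * bump (z i) 1 t))"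
      unfolding x e_def by (rule fn_bump_combination)
    obtain j where j: "j \<le> k" "1 / real (Suc k) \<le> \<bar>a j\<bar>"
    proof (rule ccontr)
      assume "\<not> thesis"
      then have "\<bar>a i\<bar> < 1 / real (Suc k)" if "i \<le> k" for i using that \<open>\<And>j. _ \<Longrightarrow> _ \<Longrightarrow> thesis\<close> by force
      then have "(\<Sum>i\<le>k. \<bar>a i\<bar>) < (\<Sum>i\<le>k. 1 / real (Suc k))"
        by (intro sum_strict_mono) auto
      then show False using a by simp
    qed
    have small: "AE t in lborel. \<bar>fn x t\<bar> \<le> \<delta>"
      using fn_x
    proof eventually_elim
      fix t assume "fn x t = (\<Sum>i\<le>k. a i * (r * bump (z i) 1 t))"
      then have "\<bar>fn x t\<bar> \<le> (\<Sum>i\<le>k. \<bar>a i * (r * bump (z i) 1 t)\<bar>)" by (simp add: sum_abs)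
      also have "\<dots> \<le> (\<Sum>i\<le>k. \<bar>a i\<bar> * r)"
      proof (rule sum_mono)
        fix i
        have "r * bump (z i) 1 t \<le> r * 1" using r bump_le_1 by (intro mult_left_mono) auto
        then show "\<bar>a i * (r * bump (z i) 1 t)\<bar> \<le> \<bar>a i\<bar> * r"
          using r bump_nonneg[of "z i" 1 t] by (simp add: abs_mult mult_left_mono)
      qed
      also have "\<dots> = r" using a by (simp flip: sum_distrib_right)
      finally show "\<bar>fn x t\<bar> \<le> \<delta>" using r by linarith
    qed
    have large: "AE t in lborel. t \<in> ball (z j) (1/2) \<longrightarrow> r * (\<beta> / real (Suc k)) \<le> \<bar>fn x t\<bar>"
      using fn_x
    proof eventually_elim
      fix t assume fx: "fn x t = (\<Sum>i\<le>k. a i * (r * bump (z i) 1 t))"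
      show "t \<in> ball (z j) (1/2) \<longrightarrow> r * (\<beta> / real (Suc k)) \<le> \<bar>fn x t\<bar>"
      proof
        assume t: "t \<in> ball (z j) (1/2)"
        have "bump (z i) 1 t = 0" if "i \<noteq> j" for i
        proof (rule bump_eq_0)
          have "2 \<le> dist (z i) t + dist (z j) t"
            using far[OF that] dist_triangle2[of "z i" "z j" t] by linarith
          then show "1 \<le> dist (z i) t" using t by simp
        qed simp
        then have "(\<Sum>i\<le>k. a i * (r * bump (z i) 1 t)) = (\<Sum>i\<in>{j}. a i * (r * bump (z i) 1 t))"
          using j(1) by (intro sum.mono_neutral_right) auto
        then have "\<bar>fn x t\<bar> = \<bar>a j\<bar> * (r * bump (z j) 1 t)"
          using r bump_nonneg[of "z j" 1 t] by (simp add: fx abs_mult)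
        also have "\<dots> \<ge> (1 / real (Suc k)) * (r * \<beta>)"
          using j(2) bump_ge[OF t] r \<beta> by (intro mult_mono) auto
        finally show "r * (\<beta> / real (Suc k)) \<le> \<bar>fn x t\<bar>" by simp
      qed
    qed
    have fin: "emeasure lborel (ball (z j) (1/2)) < \<infinity>" by (rule emeasure_lborel_ball_finite)
    have "\<mu> * (r * (\<beta> / real (Suc k))) powr q * measure lborel (ball (z j) (1/2)) \<le> \<Phi> x"
      by (rule \<Phi>_lower_bound[OF F q(1) \<mu> _ fin small large]) (use r \<beta> in auto)
    then have \<Phi>: "r powr q * (\<mu> * (\<beta> / real (Suc k)) powr q * v) \<le> \<Phi> x"
      using r \<beta> by (simp only: vol powr_mult less_imp_le divide_nonneg_nonneg of_nat_0_le_iff ac_simps)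
    have "norm x \<le> (\<Sum>i\<le>k. \<bar>a i\<bar> * (r * norm (bump_element (z i))))"
      unfolding x e_def by (rule order_trans[OF norm_sum]) (use r in \<open>simp add: abs_mult mult.assoc\<close>)
    also have "\<dots> \<le> (\<Sum>i\<le>k. \<bar>a i\<bar> * (r * N))"
    proof (intro sum_mono mult_left_mono)
      fix i assume "i \<in> {..k}"
      then have "norm (bump_element (z i)) \<le> (\<Sum>i\<le>k. norm (bump_element (z i)))"
        by (intro member_le_sum) auto
      then show "norm (bump_element (z i)) \<le> N" by (simp add: N_def)
    qed (use r in auto)
    also have "\<dots> = r * N" using a by (simp flip: sum_distrib_right)
    finally have "(norm x)\<^sup>2 \<le> (r * N)\<^sup>2" by (rule power_mono) simp
    also have "\<dots> = r powr q * r powr (2 - q) * N\<^sup>2"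
    proof -
      have "r powr q * r powr (2 - q) = r powr 2" by (simp flip: powr_add)
      also have "\<dots> = r\<^sup>2" using r by simp
      finally show ?thesis by (simp add: power_mult_distrib)
    qed
    also have "\<dots> < r powr q * \<kappa> * N\<^sup>2"
      using r N r\<kappa> by (intro mult_strict_right_mono mult_strict_left_mono) auto
    also have "\<dots> = 2 * (r powr q * (\<mu> * (\<beta> / real (Suc k)) powr q * v))"
      using N by (simp add: \<kappa>_def)
    finally show ?thesis using \<Phi> by (simp add: J_def)
  qed
  moreover have "e i \<in> energy_space" for i
    unfolding e_def by (intro subspace_scale S(1) bump_element)
  ultimately show ?thesis by (intro exI[of _ e]) blast
qed

end

section \<open>Solutions of the original problem\<close>

text \<open>
  Uniqueness makes the arbitrary choice in \<open>weak_grad\<close> harmless.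
\<close>

lemma weak_grad_eq_AE:
  assumes "has_weak_gradient u g"
  shows "has_weak_gradient u (weak_grad u)" "AE t in lborel. weak_grad u t = g t"
proof -
  show w: "has_weak_gradient u (weak_grad u)"
    unfolding weak_grad_def by (rule someI[of _ g]) (rule assms)
  show "AE t in lborel. weak_grad u t = g t"
    by (rule weak_gradient_unique[OF w assms])
qed

context confining_potential
begin

lemma fn_in_E_space:
  assumes "x \<in> energy_space"
  shows "fn x \<in> E_space V"
proof -
  have "has_weak_gradient (fn x) (gr x)" using assms by (simp add: energy_space_iff)
  moreover have "integrable lborel (\<lambda>t. \<bar>fn x t\<bar> powr 2)"
    using square_integrable_norm[OF square_integrable_fn[of x]] by simp
  moreover have "integrable lborel (\<lambda>t. (norm (gr x t))\<^sup>2)"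
    by (rule square_integrable_norm[OF square_integrable_components(2)])
  ultimately show ?thesis
    using integrable_V_square[of x] unfolding E_space_def H1_def Lp_def by auto
qed

lemma E_space_packed:
  assumes "\<eta> \<in> E_space V"
  shows "pack \<eta> (weak_grad \<eta>) \<in> energy_space"
    and "AE t in lborel. fn (pack \<eta> (weak_grad \<eta>)) t = \<eta> t"
    and "AE t in lborel. gr (pack \<eta> (weak_grad \<eta>)) t = weak_grad \<eta> t"
proof -
  obtain g where g: "has_weak_gradient \<eta> g" "integrable lborel (\<lambda>x. (norm (g x))\<^sup>2)"
    using assms by (auto simp: E_space_def H1_def)
  have V: "integrable lborel (\<lambda>t. V t * (\<eta> t)\<^sup>2)"
    using assms by (simp add: E_space_def)
  note w = weak_grad_eq_AE[OF g(1)]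
  have m: "\<eta> \<in> borel_measurable borel" "weak_grad \<eta> \<in> borel_measurable lborel"
    using weak_gradientD(1,2)[OF w(1)] by (simp_all add: locally_integrable_def)
  have sq: "square_integrable (weak_grad \<eta>)"
    by (rule square_integrable_bound[OF m(2) g(2)]) (use w(2) in eventually_elim, simp)
  show "pack \<eta> (weak_grad \<eta>) \<in> energy_space"
    by (rule pack_in_energy_space[OF w(1) V sq])
  show "AE t in lborel. fn (pack \<eta> (weak_grad \<eta>)) t = \<eta> t"
    "AE t in lborel. gr (pack \<eta> (weak_grad \<eta>)) t = weak_grad \<eta> t"
    by (rule pack[OF m(1) V sq])+
qed

lemma weak_grad_fn: "x \<in> energy_space \<Longrightarrow> AE t in lborel. weak_grad (fn x) t = gr x t"
  by (rule weak_grad_eq_AE(2)) (simp add: energy_space_iff)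

lemma borel_measurable_weak_grad_fn:
  "x \<in> energy_space \<Longrightarrow> weak_grad (fn x) \<in> borel_measurable borel"
  using weak_gradientD(2)[OF weak_grad_eq_AE(1)] by (auto simp: energy_space_iff locally_integrable_def)

lemma integrable_powr_fn:
  assumes "AE t in lborel. \<bar>fn x t\<bar> \<le> \<delta>" "a \<ge> 1" "\<delta> > 0"
  shows "integrable lborel (\<lambda>t. \<bar>fn x t\<bar> powr a)"
proof (rule Bochner_Integration.integrable_bound)
  show "integrable lborel (\<lambda>t. \<delta> powr (a - 1) * \<bar>fn x t\<bar>)"
    by (intro integrable_mult_right integrable_abs integrable_fn)
  show "AE t in lborel. norm (\<bar>fn x t\<bar> powr a) \<le> norm (\<delta> powr (a - 1) * \<bar>fn x t\<bar>)"
    using assms(1)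
  proof eventually_elim
    fix t assume t: "\<bar>fn x t\<bar> \<le> \<delta>"
    have "\<bar>fn x t\<bar> powr a = \<bar>fn x t\<bar> powr ((a - 1) + 1)" by simp
    also have "\<dots> = \<bar>fn x t\<bar> powr (a - 1) * \<bar>fn x t\<bar>"
      by (subst powr_add) simp
    also have "\<dots> \<le> \<delta> powr (a - 1) * \<bar>fn x t\<bar>"
      using t assms(2) by (intro mult_right_mono powr_mono2) auto
    finally show "norm (\<bar>fn x t\<bar> powr a) \<le> norm (\<delta> powr (a - 1) * \<bar>fn x t\<bar>)" by simp
  qed
qed measurable

end

text \<open>
  The last assumption says that the constant \<open>\<delta>\<close> is a strict supersolution; it is what makes
  fixed points of the truncated problem solve the original one.
\<close>

locale power_problem = confining_potential V V0
  for V :: "'a::euclidean_space \<Rightarrow> real" and V0 :: real +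
  fixes p q lam \<delta> :: real
  assumes exponents: "1 < q" "q < 2" "2 < p" and lam: "lam > 0" and \<delta>: "\<delta> > 0"
    and small: "\<delta> powr (p - 1) + lam * \<delta> powr (q - 1) < V0 * \<delta>"
begin

definition truncated_rhs :: "real \<Rightarrow> real" where
  "truncated_rhs t = odd_power p (clamp_at \<delta> t) + lam * odd_power q (clamp_at \<delta> t)"

definition truncated_primitive :: "real \<Rightarrow> real" where
  "truncated_primitive t = truncated_power p \<delta> t + lam * truncated_power q \<delta> t"

sublocale truncated_problem V V0 truncated_rhs truncated_primitive "\<delta> powr (p - 1) + lam * \<delta> powr (q - 1)"
proof
  show "continuous_on UNIV truncated_rhs"
    unfolding truncated_rhs_def[abs_def] using exponents
    by (intro continuous_intros continuous_on_clamped_odd_power) auto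
  show "\<bar>truncated_rhs t\<bar> \<le> \<delta> powr (p - 1) + lam * \<delta> powr (q - 1)" for t
  proof -
    have "\<bar>truncated_rhs t\<bar> \<le> \<bar>odd_power p (clamp_at \<delta> t)\<bar> + lam * \<bar>odd_power q (clamp_at \<delta> t)\<bar>"
      using abs_triangle_ineq[of "odd_power p (clamp_at \<delta> t)" "lam * odd_power q (clamp_at \<delta> t)"] lam
      by (simp add: truncated_rhs_def abs_mult)
    also have "\<dots> \<le> \<delta> powr (p - 1) + lam * \<delta> powr (q - 1)"
      using exponents lam \<delta> by (intro add_mono mult_left_mono abs_clamped_odd_power_le) auto
    finally show ?thesis .
  qed
  show "truncated_rhs (- t) = - truncated_rhs t" for t
    using \<delta> by (simp add: truncated_rhs_def clamp_at_uminus odd_power_uminus)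
  show "truncated_primitive \<in> borel_measurable borel"
    unfolding truncated_primitive_def[abs_def] using exponents
    by (intro borel_measurable_continuous_onI continuous_intros continuous_on_truncated_power) auto
  show "truncated_primitive s + truncated_rhs s * (t - s) \<le> truncated_primitive t" for s t
  proof -
    have "truncated_power p \<delta> s + odd_power p (clamp_at \<delta> s) * (t - s) \<le> truncated_power p \<delta> t"
      using exponents \<delta> by (intro truncated_power_subgradient) auto
    moreover have "lam * (truncated_power q \<delta> s + odd_power q (clamp_at \<delta> s) * (t - s)) \<le> lam * truncated_power q \<delta> t"
      using exponents \<delta> lam by (intro mult_left_mono truncated_power_subgradient) auto
    ultimately show ?thesis
      by (simp add: truncated_primitive_def truncated_rhs_def algebra_simps)
  qed
  show "truncated_primitive 0 = 0"
    using \<delta> by (simp add: truncated_primitive_def truncated_power_0)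
qed

lemma fixed_point_small:
  assumes "x \<in> energy_space" "T x = x"
  shows "AE t in lborel. \<bar>fn x t\<bar> \<le> \<delta>"
proof (rule fixed_point_bounded[OF assms \<delta>])
  fix t assume "t > \<delta>"
  have "truncated_rhs t \<le> \<delta> powr (p - 1) + lam * \<delta> powr (q - 1)"
    using f_bound[of t] by linarith
  also have "\<dots> < V0 * \<delta>" by (rule small)
  also have "\<dots> \<le> V0 * t" using \<open>t > \<delta>\<close> V0_pos by simp
  finally show "truncated_rhs t < V0 * t" .
qed

lemma fixed_point_solution:
  assumes x: "x \<in> energy_space" "T x = x"
  shows "weak_solution V p q lam (fn x)"
  unfolding weak_solution_def V_space_def
proof (intro conjI ballI)
  note le = fixed_point_small[OF x]
  have "integrable lborel (\<lambda>t. \<bar>fn x t\<bar> powr p)"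
    by (rule integrable_powr_fn[OF le]) (use exponents \<delta> in auto)
  then show "fn x \<in> E_space V \<inter> Lp p"
    using fn_in_E_space[OF x(1)] by (simp add: Lp_def)
  fix \<eta> assume "\<eta> \<in> E_space V \<inter> Lp p"
  then have \<eta>: "\<eta> \<in> E_space V" by simp
  let ?y = "pack \<eta> (weak_grad \<eta>)"
  note y = E_space_packed[OF \<eta>]
  have [measurable]: "\<eta> \<in> borel_measurable borel" "weak_grad \<eta> \<in> borel_measurable borel"
    "weak_grad (fn x) \<in> borel_measurable borel"
  proof -
    show "\<eta> \<in> borel_measurable borel" using \<eta> by (simp add: E_space_def H1_def Lp_def)
    obtain g where "has_weak_gradient \<eta> g" using \<eta> by (auto simp: E_space_def H1_def)
    then show "weak_grad \<eta> \<in> borel_measurable borel"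
      using weak_gradientD(2)[OF weak_grad_eq_AE(1)] by (auto simp: locally_integrable_def)
  qed (rule borel_measurable_weak_grad_fn[OF x(1)])
  have "(LINT t|lborel. weak_grad (fn x) t \<bullet> weak_grad \<eta> t) = (LINT t|lborel. gr x t \<bullet> gr ?y t)"
    by (rule integral_cong_AE) (measurable, use weak_grad_fn[OF x(1)] y(3) in eventually_elim, simp)
  moreover have "(LINT t|lborel. V t * fn x t * \<eta> t) = (LINT t|lborel. V t * fn x t * fn ?y t)"
    by (rule integral_cong_AE) (measurable, use y(2) in eventually_elim, simp)
  moreover have "(LINT t|lborel. (\<bar>fn x t\<bar> powr (p - 2) * fn x t + lam * (\<bar>fn x t\<bar> powr (q - 2) * fn x t)) * \<eta> t)
      = (LINT t|lborel. truncated_rhs (fn x t) * fn ?y t)"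
    by (rule integral_cong_AE)
       (measurable, use le y(2) in eventually_elim, simp add: truncated_rhs_def clamp_at_eq odd_power_def)
  moreover have "inner x ?y = (LINT t|lborel. truncated_rhs (fn x t) * fn ?y t)"
    using inner_T[OF y(1), of x] x(2) by simp
  ultimately show "(LINT t|lborel. weak_grad (fn x) t \<bullet> weak_grad \<eta> t) + (LINT t|lborel. V t * fn x t * \<eta> t)
      = (LINT t|lborel. (\<bar>fn x t\<bar> powr (p - 2) * fn x t + lam * (\<bar>fn x t\<bar> powr (q - 2) * fn x t)) * \<eta> t)"
    unfolding inner_eq(1)[of x ?y] by simp
qed

lemma energy_fixed_point:
  assumes x: "x \<in> energy_space" "T x = x"
  shows "energy V p q lam (fn x) = J x"
proof -
  note le = fixed_point_small[OF x]
  have int: "integrable lborel (\<lambda>t. \<bar>fn x t\<bar> powr p)" "integrable lborel (\<lambda>t. \<bar>fn x t\<bar> powr q)"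
    by (rule integrable_powr_fn[OF le]; use exponents \<delta> in simp)+
  note [measurable] = borel_measurable_weak_grad_fn[OF x(1)]
  have "(LINT t|lborel. (norm (weak_grad (fn x) t))\<^sup>2) = (LINT t|lborel. (norm (gr x t))\<^sup>2)"
    by (rule integral_cong_AE) (measurable, use weak_grad_fn[OF x(1)] in eventually_elim, simp)
  moreover have "\<Phi> x = (LINT t|lborel. 1 / p * \<bar>fn x t\<bar> powr p + lam / q * \<bar>fn x t\<bar> powr q)"
    unfolding \<Phi>_def
    by (rule integral_cong_AE)
       (measurable, use le in eventually_elim, simp add: truncated_primitive_def truncated_power_eq)
  then have "\<Phi> x = 1 / p * (LINT t|lborel. \<bar>fn x t\<bar> powr p) + lam / q * (LINT t|lborel. \<bar>fn x t\<bar> powr q)"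
    using int by simp
  ultimately show ?thesis
    by (simp add: energy_def J_def norm_eq add_divide_distrib)
qed

lemma fixed_point_nontrivial:
  assumes "x \<in> energy_space" "J x < 0"
  shows "\<not> (AE t in lborel. fn x t = 0)"
proof
  assume "AE t in lborel. fn x t = 0"
  then have "AE t in lborel. fn x t = fn 0 t"
    using fn_ops(5) by eventually_elim simp
  then have "x = 0"
    by (rule energy_space_determined_by_fn[OF assms(1) subspace_0[OF S(1)]])
  then show False using assms(2) \<Phi>_zero by (simp add: J_def)
qed

lemma infinitely_many_fixed_points: "infinite {x \<in> energy_space. T x = x \<and> J x < 0}"
proof (rule infinitely_many_negative_fixed_points)
  fix k
  show "\<exists>e. (\<forall>i\<le>k. e i \<in> energy_space) \<and> (\<forall>x\<in>cross_polytope e k. J x < 0)"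
  proof (rule negative_cross_polytopes[of \<delta> "lam / q" q])
    fix t :: real assume t: "\<bar>t\<bar> \<le> \<delta>"
    have "0 \<le> truncated_power p \<delta> t"
      using exponents \<delta> by (intro truncated_power_nonneg) auto
    then show "lam / q * \<bar>t\<bar> powr q \<le> truncated_primitive t"
      using truncated_power_eq[OF t, of q] by (simp add: truncated_primitive_def)
  qed (use exponents lam \<delta> in auto)
qed

text \<open>
  Distinct elements of the energy space have functions that differ on a set of positive measure, since
  a function determines its weak gradient almost everywhere; so infinitely many fixed points
  give infinitely many classes.
\<close>

theorem infinitely_many_solutions:
  "infinite ({u. weak_solution V p q lam u \<and> \<not> (AE t in lborel. u t = 0) \<and> energy V p q lam u < 0} // ae_eq)"
    (is "infinite (?U // ae_eq)")
proof
  let ?X = "{x \<in> energy_space. T x = x \<and> J x < 0}"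
  let ?c = "\<lambda>x. ae_eq `` {fn x}"
  assume fin: "finite (?U // ae_eq)"
  have "?c ` ?X \<subseteq> ?U // ae_eq"
    using fixed_point_solution energy_fixed_point fixed_point_nontrivial by (auto intro!: quotientI)
  then have "finite (?c ` ?X)" using fin by (rule finite_subset)
  moreover have "inj_on ?c ?X"
  proof (rule inj_onI)
    fix x y assume x: "x \<in> ?X" and y: "y \<in> ?X" and eq: "?c x = ?c y"
    have "(fn x, fn y) \<in> ae_eq"
      using eq by (rule eq_equiv_class[OF _ equiv_ae_eq]) simp
    then show "x = y"
      using x y by (intro energy_space_determined_by_fn) (auto simp: ae_eq_def)
  qed
  ultimately show False
    using infinitely_many_fixed_points finite_imageD by blast
qed

end

theorem theorem1p2:
  fixes V :: "real ^ 'n \<Rightarrow> real" and p q V0 :: real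
  assumes "CARD('n) \<ge> 3"
    and "1 < q" and "q < 2" and "2 < p"
    and "continuous_on UNIV V"
    and "V0 > 0" and "\<And>x. V0 \<le> V x"
    and "integrable lborel (\<lambda>x. 1 / V x)"
  shows "\<exists>Lam0>0. \<forall>lam. 0 < lam \<and> lam < Lam0 \<longrightarrow>
    infinite ({u. weak_solution V p q lam u \<and> \<not> (AE x in lborel. u x = 0)
                  \<and> energy V p q lam u < 0} // ae_eq)"
proof -
  \<comment> \<open>The two powers each take up at most a quarter of \<open>V0 * \<delta>\<close>: the first by the choice of \<open>\<delta>\<close>, the second by the choice of \<open>Lam0\<close>.\<close>
  define \<delta> where "\<delta> = (V0 / 4) powr (1 / (p - 2))"
  have \<delta>: "\<delta> > 0" using assms(6) by (simp add: \<delta>_def)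
  have "\<delta> powr (p - 1) = \<delta> powr ((p - 2) + 1)" by simp
  also have "\<dots> = \<delta> powr (p - 2) * \<delta>" using \<delta> by (subst powr_add) simp
  also have "\<delta> powr (p - 2) = V0 / 4" using assms(4,6) by (simp add: \<delta>_def powr_powr)
  finally have p: "\<delta> powr (p - 1) = V0 / 4 * \<delta>" .
  define Lam0 where "Lam0 = V0 / 4 * \<delta> powr (2 - q)"
  have "Lam0 > 0" using assms(6) \<delta> by (simp add: Lam0_def)
  moreover have "infinite ({u. weak_solution V p q lam u \<and> \<not> (AE x in lborel. u x = 0)
                  \<and> energy V p q lam u < 0} // ae_eq)" if lam: "0 < lam" "lam < Lam0" for lam
  proof -
    have "lam * \<delta> powr (q - 1) < Lam0 * \<delta> powr (q - 1)"
      using lam \<delta> by (intro mult_strict_right_mono) auto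
    also have "\<dots> = V0 / 4 * (\<delta> powr (2 - q) * \<delta> powr (q - 1))" by (simp add: Lam0_def)
    also have "\<delta> powr (2 - q) * \<delta> powr (q - 1) = \<delta> powr ((2 - q) + (q - 1))" by (rule powr_add[symmetric])
    also have "\<dots> = \<delta>" using \<delta> by simp
    finally have "lam * \<delta> powr (q - 1) < V0 / 4 * \<delta>" .
    moreover have "0 < V0 * \<delta>" using assms(6) \<delta> by simp
    ultimately have "\<delta> powr (p - 1) + lam * \<delta> powr (q - 1) < V0 * \<delta>"
      unfolding p by linarith
    then interpret power_problem V V0 p q lam \<delta>
      using assms lam \<delta> by unfold_locales auto
    show ?thesis by (rule infinitely_many_solutions)
  qed
  ultimately show ?thesis by blast
qed

end
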